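(* Let $\mathcal{I}=[0,1]$, let $\tilde{A}(t)$ be an $N\times N$ matrix-valued function analytic on $\mathcal{I}$ and let $\tilde{B}(t,s)$ be an $N\times N$ matrix-valued function analytic in both variables on $\mathcal{I}$. Let $\tilde U(t,s)$ be the solution of $$\partial_t \tilde U(t,s)=\tilde A(t)\tilde U(t,s)+\tilde B(t,s),\quad \tilde U(s,s)=I_N,\qquad t\ge s,\ t,s\in\mathcal{I},$$ and put $U(t,s)=\tilde U(t,s)\Theta(t-s)$, $A(t,s)=\tilde A(t)\Theta(t-s)$, $B(t,s)=\tilde B(t,s)\Theta(t-s)$. Let $\mathbf{U}=[Y^{(k,\ell)}]_{k,\ell=1}^N$, $\mathbf{A}=[F^{(k,\ell)}]_{k,\ell=1}^N$, $\mathbf{B}=[G^{(k,\ell)}]_{k,\ell=1}^N$, $\mathbf{C}=[H^{(k,\ell)}]_{k,\ell=1}^N$ be the block matrices whose blocks are the coefficient matrices of the entries of $U$, $A$, $B$ and $C:=\sum_{k\ge1}A^{\star k}$, respectively, and let $\mathbf{T}$ be the block diagonal matrix with $N$ diagonal blocks all equal to $T$, the coefficient matrix of $\Theta(t-s)$. Then $$\mathbf{U}=\mathbf{T}(I+\mathbf{C})(I+\mathbf{B})=\mathbf{T}(I-\mathbf{A})^{-1}(I+\mathbf{B}),$$ and the solution is expressed by $$U_{k,\ell}(t,s)=\phi(t)^TY^{(k,\ell)}\phi(s),\qquad k,\ell=1,\dots,N,\quad t\ne s,\ t,s\in(0,1).$$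
   Context: $\Theta$ is the Heaviside function, $\Theta(t-s)=1$ if $t\ge s$ and $0$ if $t<s$. $\mathcal{A}_\Theta(\mathcal{I})$ is the set of $f(t,s)=\tilde f(t,s)\Theta(t-s)$ with $\tilde f$ analytic in both variables over $\mathcal{I}=[0,1]$. For $f,g\in\mathcal{A}_\Theta(\mathcal{I})$ the $\star$-product is $(f\star g)(t,s)=\int_{\mathcal{I}}f(t,\tau)g(\tau,s)\,d\tau=\Theta(t-s)\int_s^t\tilde f(t,\tau)\tilde g(\tau,s)\,d\tau$; for matrices $(A\star B)_{k,\ell}=\sum_{j}A_{k,j}\star B_{j,\ell}$, and $A^{\star k}$ is the $k$-th $\star$-power. $\{p_k\}_{k\ge0}$ are the orthonormal shifted Legendre polynomials on $[0,1]$ and $\phi(t)=(p_0(t),p_1(t),p_2(t),\dots)^T$. The coefficient matrix of $f\in\mathcal{A}_\Theta(\mathcal{I})$ is the infinite matrix $F=[f_{k,\ell}]_{k,\ell\ge0}$ with $f_{k,\ell}=\int_{\mathcal{I}}\int_{\mathcal{I}}f(\tau,\rho)p_k(\tau)p_\ell(\rho)\,d\rho\,d\tau$. For such an infinite matrix, $\phi(t)^TF\phi(s)$ denotes $\lim_{M\to\infty}\sum_{k=0}^M\sum_{\ell=0}^M f_{k,\ell}\,p_k(t)p_\ell(s)$. Block matrices are $N\times N$ arrays of infinite matrices; $I$ is the identity of this size (identity blocks on the diagonal, zero blocks elsewhere), products of block matrices have blocks $\sum_{j=1}^N X^{(k,j)}Y^{(j,\ell)}$, with entries of products of infinite matrices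 given by (convergent) series, and $(I-\mathbf{A})^{-1}=I+\mathbf{C}$ is the inverse of $I-\mathbf{A}$. *)

theory Defs
  imports "HOL-Analysis.Analysis" "HOL-Computational_Algebra.Polynomial"
begin

section \<open>Analytic data on the unit interval\<close>

text \<open>
  Functions are complex valued; the real-valued case is included.  Analyticity on the closed
  interval or square is local representability by convergent power series at every point,
  boundary points included; for two variables it is joint analyticity.
\<close>

definition analytic1 :: "(real \<Rightarrow> complex) \<Rightarrow> bool" where
  "analytic1 f \<longleftrightarrow>
     (\<forall>a\<in>{0..1}. \<exists>r>0. \<exists>c :: nat \<Rightarrow> complex.
        \<forall>t\<in>{0..1}. \<bar>t - a\<bar> < r \<longrightarrow> (\<lambda>i. c i * of_real ((t - a) ^ i)) sums f t)"

definition analytic2 :: "(real \<Rightarrow> real \<Rightarrow> complex) \<Rightarrow> bool" where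
  "analytic2 f \<longleftrightarrow>
     (\<forall>a\<in>{0..1}. \<forall>b\<in>{0..1}. \<exists>r>0. \<exists>c :: nat \<Rightarrow> nat \<Rightarrow> complex.
        \<forall>t\<in>{0..1}. \<forall>s\<in>{0..1}. \<bar>t - a\<bar> < r \<longrightarrow> \<bar>s - b\<bar> < r \<longrightarrow>
          ((\<lambda>(i, j). c i j * of_real ((t - a) ^ i * (s - b) ^ j)) has_sum f t s) UNIV)"

definition heaviside :: "real \<Rightarrow> real" where
  "heaviside x = (if x \<ge> 0 then 1 else 0)"


section \<open>The star product\<close>

type_synonym kernel = "real \<Rightarrow> real \<Rightarrow> complex"
type_synonym 'n mkernel = "real \<Rightarrow> real \<Rightarrow> complex ^ 'n ^ 'n"

definition star :: "kernel \<Rightarrow> kernel \<Rightarrow> kernel" where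
  "star f g = (\<lambda>t s. LBINT \<tau>:{0..1}. f t \<tau> * g \<tau> s)"

definition entry :: "('n::finite) mkernel \<Rightarrow> 'n \<Rightarrow> 'n \<Rightarrow> kernel" where
  "entry F k l = (\<lambda>t s. F t s $ k $ l)"

definition mstar :: "('n::finite) mkernel \<Rightarrow> 'n mkernel \<Rightarrow> 'n mkernel" where
  "mstar F G = (\<lambda>t s. \<chi> k l. \<Sum>j\<in>UNIV. star (entry F k j) (entry G j l) t s)"

text \<open>
  The index is shifted, because the zeroth star-power is a Dirac distribution and not a function:
  \<open>star_pow_Suc F m\<close> is the star-power of \<open>F\<close> with exponent \<open>m + 1\<close>.
\<close>

primrec star_pow_Suc :: "('n::finite) mkernel \<Rightarrow> nat \<Rightarrow> 'n mkernel" where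
  "star_pow_Suc F 0 = F"
| "star_pow_Suc F (Suc m) = mstar F (star_pow_Suc F m)"

definition star_series :: "('n::finite) mkernel \<Rightarrow> 'n mkernel" where
  "star_series F = (\<lambda>t s. \<Sum>m. star_pow_Suc F m t s)"


section \<open>Shifted Legendre polynomials and coefficient matrices\<close>

text \<open>
  Rodrigues' formula for the shifted Legendre polynomial
  \<open>P\<^sub>k(2t - 1) = (1 / k!) (d/dt)\<^sup>k (t\<^sup>2 - t)\<^sup>k\<close>; its squared norm on \<open>[0,1]\<close> is \<open>1 / (2k + 1)\<close>.
\<close>

definition legendre01 :: "nat \<Rightarrow> real \<Rightarrow> real" where
  "legendre01 k t =
     sqrt (2 * real k + 1) / fact k * poly ((pderiv ^^ k) ([:0, -1, 1:] ^ k)) t"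

type_synonym infmat = "nat \<Rightarrow> nat \<Rightarrow> complex"
type_synonym 'n blockmat = "'n \<Rightarrow> 'n \<Rightarrow> infmat"

definition coeff_mat :: "kernel \<Rightarrow> infmat" where
  "coeff_mat f = (\<lambda>k l. LBINT \<tau>:{0..1}. (LBINT \<rho>:{0..1}.
     f \<tau> \<rho> * of_real (legendre01 k \<tau>) * of_real (legendre01 l \<rho>)))"

definition block_coeff_mat :: "('n::finite) mkernel \<Rightarrow> 'n blockmat" where
  "block_coeff_mat F = (\<lambda>k l. coeff_mat (entry F k l))"

text \<open>\<open>legendre_limit F t s v\<close> says that \<open>\<phi>(t)\<^sup>T F \<phi>(s)\<close> exists and equals \<open>v\<close>.\<close>

definition legendre_limit :: "infmat \<Rightarrow> real \<Rightarrow> real \<Rightarrow> complex \<Rightarrow> bool" where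
  "legendre_limit F t s v \<longleftrightarrow>
     (\<lambda>M. \<Sum>k\<le>M. \<Sum>l\<le>M. F k l * of_real (legendre01 k t) * of_real (legendre01 l s))
       \<longlonglongrightarrow> v"


section \<open>Algebra of block matrices\<close>

definition inf_mult :: "infmat \<Rightarrow> infmat \<Rightarrow> infmat" where
  "inf_mult X Y = (\<lambda>i j. \<Sum>m. X i m * Y m j)"

definition block_mult :: "('n::finite) blockmat \<Rightarrow> 'n blockmat \<Rightarrow> 'n blockmat" where
  "block_mult X Y = (\<lambda>k l i j. \<Sum>q\<in>UNIV. inf_mult (X k q) (Y q l) i j)"

text \<open>All series occurring in the block product \<open>X Y\<close> converge.\<close>

definition block_mult_conv :: "('n::finite) blockmat \<Rightarrow> 'n blockmat \<Rightarrow> bool" where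
  "block_mult_conv X Y \<longleftrightarrow> (\<forall>k q l i j. summable (\<lambda>m. X k q i m * Y q l m j))"

definition block_diag :: "infmat \<Rightarrow> 'n blockmat" where
  "block_diag X = (\<lambda>k l i j. if k = l then X i j else 0)"

definition block_one :: "'n blockmat" where
  "block_one = block_diag (\<lambda>i j. if i = j then 1 else 0)"

definition block_add :: "'n blockmat \<Rightarrow> 'n blockmat \<Rightarrow> 'n blockmat" where
  "block_add X Y = (\<lambda>k l i j. X k l i j + Y k l i j)"

definition block_diff :: "'n blockmat \<Rightarrow> 'n blockmat \<Rightarrow> 'n blockmat" where
  "block_diff X Y = (\<lambda>k l i j. X k l i j - Y k l i j)"

text \<open>
  Infinite matrices mapping square-summable sequences to square-summable sequences; such a matrix
  is automatically a bounded operator on the Hilbert sequence space.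
\<close>

definition l2_operator :: "infmat \<Rightarrow> bool" where
  "l2_operator X \<longleftrightarrow>
     (\<forall>x :: nat \<Rightarrow> complex. summable (\<lambda>j. (cmod (x j))\<^sup>2) \<longrightarrow>
        (\<forall>i. summable (\<lambda>j. X i j * x j)) \<and>
        summable (\<lambda>i. (cmod (\<Sum>j. X i j * x j))\<^sup>2))"

text \<open>
  A two-sided inverse with convergent products.  The restriction to operators on square-summable
  sequences is what makes it unique: formal two-sided inverses of infinite matrices are not.  For
  instance, let \<open>T\<close> be the coefficient matrix of the Heaviside kernel, which is tridiagonal.  Then
  \<open>I - T\<close> annihilates a nonzero column \<open>v\<close> and is annihilated by a nonzero row \<open>w\<close>, both
  rapidly growing, and the matrix \<open>v w\<close> can be added to any formal inverse.
\<close>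

definition is_block_inverse :: "('n::finite) blockmat \<Rightarrow> 'n blockmat \<Rightarrow> bool" where
  "is_block_inverse X Y \<longleftrightarrow>
     (\<forall>k l. l2_operator (Y k l)) \<and>
     block_mult_conv X Y \<and> block_mult X Y = block_one \<and>
     block_mult_conv Y X \<and> block_mult Y X = block_one"

definition block_inverse :: "('n::finite) blockmat \<Rightarrow> 'n blockmat" where
  "block_inverse X = (THE Y. is_block_inverse X Y)"

end

theory Submission
  imports Defs
begin

text \<open>
  In the Legendre basis the star-product of kernels is the product of coefficient matrices, so that
  the differential equation can be solved by linear algebra with infinite matrices.

  Let \<open>V\<close> be the kernel \<open>\<Theta>(t - s) (\<partial>/\<partial>t) U(t, s) = \<Theta>(t - s) (A(t) U(t, s) + B(t, s))\<close>.  Integration from \<open>s\<close> to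
  \<open>t\<close>, with the initial value \<open>U(s, s) = 1\<close>, gives two kernel identities,
  \<open>U = \<Theta> + \<Theta> \<star> V\<close> and \<open>V = A + A \<star> V + B\<close>.  By Parseval's identity (\<open>coeff_mat_star\<close>) they turn into
  \<open>U = T (I + V)\<close> and \<open>(I - A) (I + V) = I + B\<close> for the coefficient matrices.  The Neumann series
  \<open>C\<close> satisfies \<open>C = A + A \<star> C = A + C \<star> A\<close> (\<open>neumann_series\<close>), so \<open>I + C\<close> is a two-sided inverse of
  \<open>I - A\<close>; multiplication by it from the left gives \<open>I + V = (I + C) (I + B)\<close> and \<open>U = T (I + C) (I + B)\<close>.
  The products may be rearranged because Bessel's inequality makes every coefficient matrix a
  Hilbert-Schmidt matrix (\<open>hilbert_schmidt_coeff_mat\<close>, \<open>block_mult_assoc\<close>).  The same associativity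
  shows that \<open>I - A\<close> has no other inverse among the operators on square-summable sequences.

  The expansion of \<open>U\<close> is delicate because \<open>U\<close> jumps on the diagonal.  For fixed \<open>t\<close> the function
  \<open>U(t, \<cdot>)\<close> is Lipschitz at every \<open>s \<noteq> t\<close>, so its one-dimensional Legendre series converges there, by the
  Christoffel-Darboux formula and Bessel's inequality (\<open>legendre_pointwise_convergence\<close>).  The square
  partial sums of the double series differ from those of this series by the truncation error in the
  variable \<open>t\<close>.  As \<open>U = \<Theta> + \<Theta> \<star> V\<close> and \<open>T\<close> is tridiagonal with entries of size \<open>O(1/k)\<close>, the
  Cauchy-Schwarz inequality bounds that error by a tail of the Hilbert-Schmidt norm of \<open>V\<close>
  (\<open>theta_defect_tendsto_0\<close>).  Both steps rest on the boundedness of \<open>p\<^sub>k(t)\<close> in \<open>k\<close> for fixed \<open>t\<close> in the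
  open interval (\<open>legendre01_bounded\<close>).
\<close>

section \<open>Shifted Legendre polynomials\<close>

definition legendre_poly :: "nat \<Rightarrow> real poly" where
  "legendre_poly n = smult (1 / fact n) ((pderiv ^^ n) ([:0, -1, 1:] ^ n))"

text \<open>
  The primitive of \<open>legendre_poly (Suc n)\<close> that vanishes at both ends of the interval.
\<close>

definition legendre_primitive :: "nat \<Rightarrow> real poly" where
  "legendre_primitive n = smult (1 / fact (Suc n)) ((pderiv ^^ n) ([:0, -1, 1:] ^ Suc n))"

lemma pderiv_legendre_primitive: "pderiv (legendre_primitive n) = legendre_poly (Suc n)"
  unfolding legendre_poly_def legendre_primitive_def by (simp add: pderiv_smult)

lemma higher_pderiv_linear_mult:
  "(pderiv ^^ Suc n) ([:-1, 2:] * f) =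
     [:-1, 2:] * (pderiv ^^ Suc n) f + smult (2 * of_nat (Suc n)) ((pderiv ^^ n) (f :: real poly))"
proof (induction n)
  case 0
  have "pderiv [:-1, 2::real:] = [:2:]" by (simp add: pderiv_pCons)
  then show ?case by (simp add: pderiv_mult del: mult_pCons_left)
next
  case (Suc n)
  have "(pderiv ^^ Suc (Suc n)) ([:-1, 2:] * f) =
    pderiv ([:-1, 2:] * (pderiv ^^ Suc n) f + smult (2 * of_nat (Suc n)) ((pderiv ^^ n) f))"
    using Suc.IH by (metis funpow.simps(2) o_apply)
  also have "\<dots> = [:-1, 2:] * (pderiv ^^ Suc (Suc n)) f + smult 2 ((pderiv ^^ Suc n) f)
      + smult (2 * of_nat (Suc n)) ((pderiv ^^ Suc n) f)"
  proof -
    have "pderiv [:-1, 2::real:] = [:2:]" by (simp add: pderiv_pCons)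
    then show ?thesis
      by (simp only: pderiv_add pderiv_mult pderiv_smult funpow.simps o_apply)
        (simp del: mult_pCons_left)
  qed
  also have "\<dots> = [:-1, 2:] * (pderiv ^^ Suc (Suc n)) f
      + smult (2 * of_nat (Suc (Suc n))) ((pderiv ^^ Suc n) f)"
    unfolding add.assoc smult_add_left[symmetric] by (simp add: algebra_simps)
  finally show ?case .
qed

text \<open>
  With \<open>w = t\<^sup>2 - t\<close>, the \<open>(n + 2)\<close>-nd derivative of \<open>w\<^bsup>n+2\<^esup>\<close> is the \<open>(n + 1)\<close>-st derivative of
  \<open>(n + 2) w\<^bsup>n+1\<^esup> w'\<close>.  As \<open>w' = 2t - 1\<close> is linear, Leibniz' rule leaves two terms.
\<close>

lemma legendre_poly_product_rule:
  "legendre_poly (Suc (Suc n)) =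
     [:-1, 2:] * legendre_poly (Suc n) + smult (2 * of_nat (Suc n)) (legendre_primitive n)"
proof -
  let ?w = "[:0, -1, 1:] :: real poly"
  have "(pderiv ^^ Suc (Suc n)) (?w ^ Suc (Suc n)) = (pderiv ^^ Suc n) (pderiv (?w ^ Suc (Suc n)))"
    by (simp only: funpow_Suc_right o_apply)
  also have "pderiv (?w ^ Suc (Suc n)) = smult (of_nat (Suc (Suc n))) ([:-1, 2:] * ?w ^ Suc n)"
    by (simp only: pderiv_power_Suc) (simp add: pderiv_pCons algebra_simps)
  also have "(pderiv ^^ Suc n) \<dots> = smult (of_nat (Suc (Suc n)))
      ([:-1, 2:] * (pderiv ^^ Suc n) (?w ^ Suc n) +
        smult (2 * of_nat (Suc n)) ((pderiv ^^ n) (?w ^ Suc n)))"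
    by (simp only: higher_pderiv_smult higher_pderiv_linear_mult)
  finally have "legendre_poly (Suc (Suc n)) = smult (1 / fact (Suc (Suc n)) * of_nat (Suc (Suc n)))
      ([:-1, 2:] * (pderiv ^^ Suc n) (?w ^ Suc n) +
        smult (2 * of_nat (Suc n)) ((pderiv ^^ n) (?w ^ Suc n)))"
    unfolding legendre_poly_def by (simp only: smult_smult)
  also have "1 / fact (Suc (Suc n)) * of_nat (Suc (Suc n)) = 1 / (fact (Suc n) :: real)"
    by (simp add: divide_simps)
  finally show ?thesis
    unfolding legendre_poly_def legendre_primitive_def
    by (simp only: smult_add_right mult_smult_right smult_smult mult.commute)
qed

text \<open>
  Here \<open>w\<^bsup>n+2\<^esup>\<close> is differentiated twice first, and \<open>(w')\<^sup>2 = 4 w + 1\<close> makes the result a combination of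
  \<open>w\<^bsup>n+1\<^esup>\<close> and \<open>w\<^sup>n\<close>.
\<close>

lemma legendre_poly_second_derivative:
  "legendre_poly (Suc (Suc n)) =
     smult (4 * of_nat n + 6) (legendre_primitive n) + legendre_poly n"
proof -
  let ?w = "[:0, -1, 1:] :: real poly"
  have sq: "[:-1, 2:] * [:-1, 2:] = smult 4 ?w + 1" by (simp add: one_pCons)
  have d: "pderiv ?w = [:-1, 2:]" by (simp add: pderiv_pCons)
  have dd: "pderiv [:-1, 2::real:] = [:2:]" by (simp add: pderiv_pCons)
  have "pderiv (pderiv (?w ^ Suc (Suc n))) =
      smult (of_nat (Suc (Suc n))) (smult 2 (?w ^ Suc n) +
        smult (of_nat (Suc n)) (?w ^ n * ([:-1, 2:] * [:-1, 2:])))"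
  proof -
    have gen: "pderiv (pderiv (w ^ Suc (Suc n))) = smult (of_nat (Suc (Suc n)))
       (smult 2 (w ^ Suc n) + smult (of_nat (Suc n)) (w ^ n * (x * x)))"
      if "pderiv w = x" "pderiv x = [:2:]" for w x :: "real poly"
      by (simp only: pderiv_power_Suc pderiv_smult pderiv_mult that)
        (simp add: smult_add_right algebra_simps del: of_nat_Suc)
    show ?thesis by (rule gen[OF d dd])
  qed
  also have "\<dots> = smult (of_nat (Suc (Suc n)))
      (smult (4 * of_nat n + 6) (?w ^ Suc n) + smult (of_nat (Suc n)) (?w ^ n))"
  proof -
    have "?w ^ n * (smult 4 ?w + 1) = smult 4 (?w ^ Suc n) + ?w ^ n"
      by (simp only: distrib_left mult_smult_right mult_1_right power_Suc2)
    then have "smult 2 (?w ^ Suc n) + smult (of_nat (Suc n)) (?w ^ n * (smult 4 ?w + 1)) =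
       smult (2 + of_nat (Suc n) * 4) (?w ^ Suc n) + smult (of_nat (Suc n)) (?w ^ n)"
      by (simp only: smult_add_right smult_add_left smult_smult add.assoc)
    also have "(2 + of_nat (Suc n) * 4 :: real) = 4 * of_nat n + 6" by simp
    finally show ?thesis unfolding sq by (simp only:)
  qed
  finally have "(pderiv ^^ Suc (Suc n)) (?w ^ Suc (Suc n)) = (pderiv ^^ n) (smult (of_nat (Suc (Suc n)))
      (smult (4 * of_nat n + 6) (?w ^ Suc n) + smult (of_nat (Suc n)) (?w ^ n)))"
    by (simp only: funpow_Suc_right o_apply)
  also have "\<dots> = smult (of_nat (Suc (Suc n))) (smult (4 * of_nat n + 6) ((pderiv ^^ n) (?w ^ Suc n))
       + smult (of_nat (Suc n)) ((pderiv ^^ n) (?w ^ n)))"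
    by (simp only: higher_pderiv_smult higher_pderiv_add)
  finally have "legendre_poly (Suc (Suc n)) =
      smult (1 / fact (Suc (Suc n)) * of_nat (Suc (Suc n)) * (4 * of_nat n + 6)) ((pderiv ^^ n) (?w ^ Suc n))
       + smult (1 / fact (Suc (Suc n)) * of_nat (Suc (Suc n)) * of_nat (Suc n)) ((pderiv ^^ n) (?w ^ n))"
    unfolding legendre_poly_def by (simp only: smult_smult smult_add_right mult.assoc)
  also have "1 / fact (Suc (Suc n)) * of_nat (Suc (Suc n)) * of_nat (Suc n) = 1 / (fact n :: real)"
    by (simp add: divide_simps)
  also have "1 / fact (Suc (Suc n)) * of_nat (Suc (Suc n)) * (4 * of_nat n + 6) =
     (4 * of_nat n + 6) * (1 / (fact (Suc n) :: real))"
    by (simp add: divide_simps)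
  finally show ?thesis
    unfolding legendre_poly_def legendre_primitive_def
    by (simp only: smult_smult)
qed

lemma legendre01_eq: "legendre01 n t = sqrt (2 * real n + 1) * poly (legendre_poly n) t"
  by (simp add: legendre01_def legendre_poly_def)

text \<open>
  Eliminate \<open>legendre_primitive n\<close> from the two preceding expressions.
\<close>

lemma legendre_poly_recurrence:
  "(real n + 2) * poly (legendre_poly (Suc (Suc n))) t =
     (2 * real n + 3) * (2 * t - 1) * poly (legendre_poly (Suc n)) t - (real n + 1) * poly (legendre_poly n) t"
proof -
  define z where "z = poly (legendre_primitive n) t"
  have 1: "poly (legendre_poly (Suc (Suc n))) t =
      (2 * t - 1) * poly (legendre_poly (Suc n)) t + 2 * (real n + 1) * z"
    unfolding legendre_poly_product_rule z_def by (simp add: algebra_simps)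
  have 2: "poly (legendre_poly (Suc (Suc n))) t = (4 * real n + 6) * z + poly (legendre_poly n) t"
    unfolding legendre_poly_second_derivative z_def by simp
  show ?thesis using 1 2 by algebra
qed

lemma legendre_poly_0: "legendre_poly 0 = 1" by (simp add: legendre_poly_def)
lemma legendre_poly_1: "legendre_poly (Suc 0) = [:-1, 2:]"
  by (simp add: legendre_poly_def pderiv_pCons)

lemma legendre_poly_at_0: "poly (legendre_poly n) 0 = (-1) ^ n"
proof (induction n rule: induct_nat_012)
  case (ge2 n)
  have "(real n + 2) * poly (legendre_poly (Suc (Suc n))) 0 = (real n + 2) * (-1) ^ Suc (Suc n)"
    using legendre_poly_recurrence[of n 0] ge2 by (simp add: algebra_simps)
  then show ?case by (simp del: power_Suc)
qed (auto simp: legendre_poly_0 legendre_poly_1)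

lemma legendre_poly_at_1: "poly (legendre_poly n) 1 = 1"
proof (induction n rule: induct_nat_012)
  case (ge2 n)
  have "(real n + 2) * poly (legendre_poly (Suc (Suc n))) 1 = (real n + 2) * 1"
    using legendre_poly_recurrence[of n 1] ge2 by (simp add: algebra_simps)
  then show ?case by (simp del: power_Suc)
qed (auto simp: legendre_poly_0 legendre_poly_1)

lemma poly_legendre_primitive:
  "poly (legendre_primitive n) t =
    (poly (legendre_poly (Suc (Suc n))) t - poly (legendre_poly n) t) / (4 * real n + 6)"
  unfolding legendre_poly_second_derivative by (simp add: field_simps)

text \<open>
  The off-diagonal entries of the Jacobi matrix of the orthonormal polynomials, which represents
  multiplication by \<open>2t - 1\<close>.  The numbers \<open>prim n\<close> below play the same part for integration.
\<close>

definition jac :: "nat \<Rightarrow> real" where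
  "jac n = (real n + 1) / (sqrt (2 * real n + 1) * sqrt (2 * real n + 3))"

definition prim :: "nat \<Rightarrow> real" where
  "prim n = 1 / (2 * sqrt (2 * real n + 1) * sqrt (2 * real n + 3))"

lemma legendre01_0: "legendre01 0 t = 1"
  by (simp add: legendre01_eq legendre_poly_0)

lemma legendre01_1: "(2 * t - 1) * legendre01 0 t = jac 0 * legendre01 (Suc 0) t"
  by (simp add: legendre01_eq legendre_poly_0 legendre_poly_1 jac_def)

lemma legendre01_recurrence:
  "(2 * t - 1) * legendre01 (Suc n) t = jac (Suc n) * legendre01 (Suc (Suc n)) t + jac n * legendre01 n t"
proof -
  define a b c where "a = sqrt (2 * real n + 1)" and "b = sqrt (2 * real n + 3)" and "c = sqrt (2 * real n + 5)"
  have pos: "a > 0" "b > 0" "c > 0" unfolding a_def b_def c_def by auto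
  have b2: "b * b = 2 * real n + 3" unfolding b_def by simp
  define p q r where "p = poly (legendre_poly n) t" and "q = poly (legendre_poly (Suc n)) t"
    and "r = poly (legendre_poly (Suc (Suc n))) t"
  have rec: "(real n + 2) * r = (2 * real n + 3) * (2 * t - 1) * q - (real n + 1) * p"
    unfolding p_def q_def r_def by (rule legendre_poly_recurrence)
  have j: "jac (Suc n) = (real n + 2) / (b * c)" "jac n = (real n + 1) / (a * b)"
    unfolding jac_def a_def b_def c_def by (simp_all add: algebra_simps)
  have l: "legendre01 n t = a * p" "legendre01 (Suc n) t = b * q" "legendre01 (Suc (Suc n)) t = c * r"
    unfolding legendre01_eq a_def b_def c_def p_def q_def r_def by (simp_all add: algebra_simps)
  have "(2 * t - 1) * (b * q) = ((real n + 2) * r + (real n + 1) * p) / b"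
  proof -
    have "(real n + 2) * r + (real n + 1) * p = (2 * t - 1) * (b * q) * b"
      unfolding rec b2[symmetric] by (simp add: algebra_simps)
    then show ?thesis using pos by simp
  qed
  then have "(2 * t - 1) * (b * q) = (real n + 2) * r / b + (real n + 1) * p / b"
    by (simp add: add_divide_distrib)
  moreover have "(real n + 2) / (b * c) * (c * r) = (real n + 2) * r / b"
     "(real n + 1) / (a * b) * (a * p) = (real n + 1) * p / b"
    using pos by simp_all
  ultimately show ?thesis unfolding j l by presburger
qed

lemma jac_pos: "jac n > 0" by (auto simp: jac_def intro!: divide_pos_pos mult_pos_pos)

lemma jac_square: "(jac n)\<^sup>2 = 1/4 * (1 + 1 / ((2 * real n + 1) * (2 * real n + 3)))"
proof -
  have "(jac n)\<^sup>2 = (real n + 1)\<^sup>2 / ((2 * real n + 1) * (2 * real n + 3))"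
    by (simp add: jac_def power_divide power_mult_distrib)
  also have "\<dots> = 1/4 * (1 + 1 / ((2 * real n + 1) * (2 * real n + 3)))"
  proof -
    have "(2 * real n + 1) * (2 * real n + 3) > 0" by (intro mult_pos_pos) auto
    then show ?thesis by (simp add: divide_simps) (simp add: algebra_simps power2_eq_square)
  qed
  finally show ?thesis .
qed

lemma jac_square_gt: "(jac n)\<^sup>2 > 1/4"
proof -
  have "1 / ((2 * real n + 1) * (2 * real n + 3)) > 0"
    by (intro divide_pos_pos mult_pos_pos) auto
  then show ?thesis unfolding jac_square by simp
qed

lemma jac_square_antimono: "(jac (Suc n))\<^sup>2 \<le> (jac n)\<^sup>2"
  unfolding jac_square by (simp, intro divide_left_mono mult_mono) auto

lemma jac_le_1: "jac n \<le> 1"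
proof -
  have "(jac n)\<^sup>2 \<le> 1/4 * (1 + 1/1)" unfolding jac_square
    using mult_mono[of 1 "2 * real n + 1" 1 "2 * real n + 3"]
    by (intro mult_left_mono add_mono divide_left_mono) auto
  then have "(jac n)\<^sup>2 \<le> 1\<^sup>2" by simp
  then show ?thesis by (rule power2_le_imp_le) simp
qed

text \<open>
  The quadratic form \<open>S n\<close> in two consecutive values is, by the recurrence, unchanged by a step from
  \<open>n\<close> to \<open>n + 1\<close> except for the change of the coefficient \<open>jac\<close>.  These coefficients decrease to \<open>1/2\<close>, so
  \<open>S\<close> decreases, and for \<open>\<bar>2t - 1\<bar> < 1\<close> the form stays uniformly positive definite.
\<close>

lemma legendre01_bounded:
  assumes "0 < t" "t < 1"
  shows "\<exists>K>0. \<forall>n. \<bar>legendre01 n t\<bar> \<le> K"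
proof -
  define x where "x = 2 * t - 1"
  have x: "x\<^sup>2 < 1" unfolding x_def using assms by (intro abs_square_less_1[THEN iffD2]) auto
  define S where "S n = (jac n)\<^sup>2 * ((legendre01 (Suc n) t)\<^sup>2 + (legendre01 n t)\<^sup>2)
     - x * jac n * legendre01 (Suc n) t * legendre01 n t" for n
  have step: "S (Suc n) \<le> S n" for n
  proof -
    have "S (Suc n) = S n + ((jac (Suc n))\<^sup>2 - (jac n)\<^sup>2) * (legendre01 (Suc n) t)\<^sup>2"
      using legendre01_recurrence[of t n] unfolding S_def x_def by algebra
    then show ?thesis using jac_square_antimono[of n]
      by (simp add: mult_nonpos_nonneg)
  qed
  have S0: "S n \<le> S 0" for n using step by (rule lift_Suc_antimono_le) simp
  have lower: "(1 - x\<^sup>2) / 4 * (legendre01 n t)\<^sup>2 \<le> S n" for n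
  proof -
    have "S n = (jac n * legendre01 (Suc n) t - x * legendre01 n t / 2)\<^sup>2
        + ((jac n)\<^sup>2 - x\<^sup>2 / 4) * (legendre01 n t)\<^sup>2"
      unfolding S_def by (simp add: power2_eq_square algebra_simps)
    also have "\<dots> \<ge> ((jac n)\<^sup>2 - x\<^sup>2 / 4) * (legendre01 n t)\<^sup>2" by simp
    also have "((jac n)\<^sup>2 - x\<^sup>2 / 4) * (legendre01 n t)\<^sup>2 \<ge> (1 - x\<^sup>2) / 4 * (legendre01 n t)\<^sup>2"
      using jac_square_gt[of n] by (intro mult_right_mono) auto
    finally show ?thesis by simp
  qed
  define K where "K = S 0 / ((1 - x\<^sup>2) / 4)"
  have "(legendre01 n t)\<^sup>2 \<le> K" for n
    unfolding K_def using lower[of n] S0[of n] x by (simp add: field_simps)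
  then have "\<bar>legendre01 n t\<bar> \<le> sqrt K" for n by (simp add: real_le_rsqrt)
  then have "0 < sqrt K + 1 \<and> (\<forall>n. \<bar>legendre01 n t\<bar> \<le> sqrt K + 1)"
    using order_trans[OF abs_ge_zero[of "legendre01 0 t"]] by (smt (verit))
  then show ?thesis by blast
qed

text \<open>
  The primitive of \<open>legendre01 n\<close> that vanishes at \<open>0\<close>, expanded in the basis itself.
\<close>

definition legendre_int :: "nat \<Rightarrow> real \<Rightarrow> real" where
  "legendre_int n t = (if n = 0 then t else prim n * legendre01 (Suc n) t - prim (n - 1) * legendre01 (n - 1) t)"

lemma prim_scaled: "sqrt (2 * real n + 3) / (4 * real n + 6) = 1 / (2 * sqrt (2 * real n + 3))"
proof -
  define b where "b = sqrt (2 * real n + 3)"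
  have "b > 0" "b * b = 2 * real n + 3" unfolding b_def by auto
  then have "4 * real n + 6 = 2 * (b * b)" by simp
  then show ?thesis unfolding b_def[symmetric] using \<open>b > 0\<close> by simp
qed

lemma legendre_int_Suc:
  "legendre_int (Suc n) t = sqrt (2 * real n + 3) * poly (legendre_primitive n) t"
proof -
  have "sqrt (2 * real n + 3) * poly (legendre_primitive n) t =
     (sqrt (2 * real n + 3) / (4 * real n + 6)) * (poly (legendre_poly (Suc (Suc n))) t - poly (legendre_poly n) t)"
    by (simp add: poly_legendre_primitive)
  also have "\<dots> = 1 / (2 * sqrt (2 * real n + 3)) *
      (poly (legendre_poly (Suc (Suc n))) t - poly (legendre_poly n) t)"
    by (simp only: prim_scaled)
  also have "\<dots> = legendre_int (Suc n) t"
  proof -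
    define a b c p q where "a = sqrt (2 * real n + 1)" and "b = sqrt (2 * real n + 3)"
      and "c = sqrt (2 * real n + 5)" and "p = poly (legendre_poly (Suc (Suc n))) t"
      and "q = poly (legendre_poly n) t"
    have "legendre_int (Suc n) t = 1 / (2 * b * c) * (c * p) - 1 / (2 * a * b) * (a * q)"
      unfolding legendre_int_def legendre01_eq prim_def a_def b_def c_def p_def q_def
      by (simp add: add.commute)
    moreover have "a > 0" "b > 0" "c > 0" unfolding a_def b_def c_def by auto
    then have "1 / (2 * b * c) * (c * p) - 1 / (2 * a * b) * (a * q) = 1 / (2 * b) * (p - q)"
      by (simp add: right_diff_distrib)
    ultimately show ?thesis unfolding b_def[symmetric] p_def[symmetric] q_def[symmetric] by simp
  qed
  finally show ?thesis by simp
qed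

lemma legendre_int_deriv: "(legendre_int n has_real_derivative legendre01 n t) (at t within S)"
proof (cases n)
  case 0
  have "legendre_int 0 = (\<lambda>t. t)" by (simp add: legendre_int_def fun_eq_iff)
  then show ?thesis using 0 by (simp add: legendre01_0)
next
  case (Suc m)
  have "legendre_int n = (\<lambda>t. sqrt (2 * real m + 3) * poly (legendre_primitive m) t)"
    unfolding Suc by (intro ext legendre_int_Suc)
  moreover have "((\<lambda>t. sqrt (2 * real m + 3) * poly (legendre_primitive m) t) has_real_derivative
     sqrt (2 * real m + 3) * poly (legendre_poly (Suc m)) t) (at t within S)"
    unfolding pderiv_legendre_primitive[symmetric]
    by (intro DERIV_cmult DERIV_subset[OF poly_DERIV]) auto
  ultimately show ?thesis unfolding Suc by (simp add: legendre01_eq algebra_simps)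
qed

lemma legendre_int_at_0: "legendre_int n 0 = 0"
  by (cases n) (auto simp: legendre_int_Suc poly_legendre_primitive legendre_poly_at_0 legendre_int_def[of 0])

lemma legendre_int_at_1: "legendre_int n 1 = (if n = 0 then 1 else 0)"
  by (cases n) (auto simp: legendre_int_Suc poly_legendre_primitive legendre_poly_at_1 legendre_int_def[of 0])

lemma legendre_int_eq_sum:
  "legendre_int n t = prim n * legendre01 (Suc n) t + (if n = 0 then 1/2 else - prim (n - 1) * legendre01 (n - 1) t)"
  by (cases n) (auto simp: legendre_int_def legendre01_eq legendre_poly_1 prim_def field_simps)

lemma prim_pos: "prim n > 0" by (auto simp: prim_def intro!: divide_pos_pos mult_pos_pos)

lemma prim_le: "prim n \<le> 1 / (2 * (real n + 1))"
proof -
  have "sqrt ((real n + 1)\<^sup>2) \<le> sqrt ((2 * real n + 1) * (2 * real n + 3))"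
    by (intro real_sqrt_le_mono) (simp add: power2_eq_square algebra_simps)
  then have "real n + 1 \<le> sqrt (2 * real n + 1) * sqrt (2 * real n + 3)"
    by (simp add: real_sqrt_mult)
  then show ?thesis unfolding prim_def by (intro divide_left_mono) (auto simp: mult.assoc)
qed

lemma continuous_legendre01 [continuous_intros]:
  "continuous_on S f \<Longrightarrow> continuous_on S (\<lambda>x. legendre01 k (f x))"
  unfolding legendre01_eq by (intro continuous_intros)

text \<open>
  The span of the \<open>legendre01 k\<close> contains \<open>1\<close> and, by the recurrence, is closed under multiplication by \<open>t\<close>.
\<close>

lemma real_polynomial_in_legendre_span:
  "\<exists>n c. \<forall>t. (\<Sum>i\<le>N. a i * t ^ i) = (\<Sum>k\<le>(n::nat). c k * legendre01 k t :: real)"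
proof -
  define Sp where "Sp = {f. \<exists>n c. \<forall>t. f t = (\<Sum>k\<le>(n::nat). c k * legendre01 k t :: real)}"
  have addI: "(\<lambda>t. f t + g t) \<in> Sp" if "f \<in> Sp" "g \<in> Sp" for f g
  proof -
    obtain n c where f: "\<forall>t. f t = (\<Sum>k\<le>(n::nat). c k * legendre01 k t)"
      using \<open>f \<in> Sp\<close> unfolding Sp_def by blast
    obtain m d where g: "\<forall>t. g t = (\<Sum>k\<le>(m::nat). d k * legendre01 k t)"
      using \<open>g \<in> Sp\<close> unfolding Sp_def by blast
    have f': "f t = (\<Sum>k\<le>max n m. (if k \<le> n then c k else 0) * legendre01 k t)" for t
      unfolding f[rule_format] by (rule sum.mono_neutral_cong_left) auto
    have g': "g t = (\<Sum>k\<le>max n m. (if k \<le> m then d k else 0) * legendre01 k t)" for t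
      unfolding g[rule_format] by (rule sum.mono_neutral_cong_left) auto
    have "f t + g t = (\<Sum>k\<le>max n m. ((if k \<le> n then c k else 0) + (if k \<le> m then d k else 0)) * legendre01 k t)" for t
      unfolding f' g' sum.distrib[symmetric] distrib_right ..
    then show ?thesis unfolding Sp_def
      by (intro CollectI exI[of _ "max n m"]
        exI[of _ "\<lambda>k. (if k \<le> n then c k else 0) + (if k \<le> m then d k else 0)"]) blast
  qed
  have scaleI: "(\<lambda>t. r * f t) \<in> Sp" if "f \<in> Sp" for f r
  proof -
    obtain n c where f: "\<forall>t. f t = (\<Sum>k\<le>(n::nat). c k * legendre01 k t)"
      using \<open>f \<in> Sp\<close> unfolding Sp_def by blast
    have "r * f t = (\<Sum>k\<le>n. (r * c k) * legendre01 k t)" for t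
      unfolding f[rule_format] sum_distrib_left by (simp add: mult.assoc)
    then show ?thesis unfolding Sp_def
      by (intro CollectI exI[of _ n] exI[of _ "\<lambda>k. r * c k"]) blast
  qed
  have base: "legendre01 k \<in> Sp" for k
  proof -
    have "legendre01 k t = (\<Sum>j\<le>k. (if j = k then 1 else 0) * legendre01 j t)" for t
      by (simp add: if_distrib [where f="\<lambda>x. x * _"] cong: if_cong)
    then show ?thesis unfolding Sp_def by (intro CollectI exI allI)
  qed
  have sumI: "(\<lambda>t. \<Sum>k\<le>(n::nat). F k t) \<in> Sp" if "\<And>k. F k \<in> Sp" for n F
    by (induction n) (use that addI in auto)
  have xI: "(\<lambda>t. t * f t) \<in> Sp" if f: "f \<in> Sp" for f
  proof -
    have xp: "(\<lambda>t. t * legendre01 k t) \<in> Sp" for k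
    proof (cases k)
      case 0
      have "(\<lambda>t. t * legendre01 k t) = (\<lambda>t. 1/2 * jac 0 * legendre01 1 t + 1/2 * legendre01 0 t)"
      proof
        fix t show "t * legendre01 k t = 1/2 * jac 0 * legendre01 1 t + 1/2 * legendre01 0 t"
          unfolding 0 using legendre01_1[of t] by (simp add: legendre01_0 algebra_simps)
      qed
      then show ?thesis using addI[OF scaleI[OF base] scaleI[OF base]] by metis
    next
      case (Suc m)
      have "(\<lambda>t. t * legendre01 k t) = (\<lambda>t. 1/2 * jac k * legendre01 (Suc k) t
          + (1/2 * jac m * legendre01 m t + 1/2 * legendre01 k t))"
      proof
        fix t show "t * legendre01 k t = 1/2 * jac k * legendre01 (Suc k) t
          + (1/2 * jac m * legendre01 m t + 1/2 * legendre01 k t)"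
          unfolding Suc using legendre01_recurrence[of t m] by (simp add: algebra_simps)
      qed
      then show ?thesis using addI[OF scaleI[OF base] addI[OF scaleI[OF base] scaleI[OF base]]] by metis
    qed
    obtain n c where "\<forall>t. f t = (\<Sum>k\<le>(n::nat). c k * legendre01 k t)"
      using f unfolding Sp_def by blast
    then have "(\<lambda>t. t * f t) = (\<lambda>t. \<Sum>k\<le>n. c k * (t * legendre01 k t))"
      by (simp add: sum_distrib_left fun_eq_iff algebra_simps)
    then show ?thesis using sumI[of "\<lambda>k t. c k * (t * legendre01 k t)" n] scaleI[OF xp] by simp
  qed
  have pow: "(\<lambda>t. t ^ i) \<in> Sp" for i
  proof (induction i)
    case 0
    show ?case using base[of 0] by (simp add: legendre01_0[abs_def])
  next
    case (Suc i)
    then show ?case using xI by force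
  qed
  have "(\<lambda>t. \<Sum>i\<le>N. a i * t ^ i) \<in> Sp" by (intro sumI scaleI pow)
  then show ?thesis unfolding Sp_def by blast
qed

section \<open>Legendre series on the unit interval\<close>

abbreviation lunit :: "real measure" where
  "lunit \<equiv> restrict_space lborel {0..1}"

lemma space_lunit [simp]: "space lunit = {0..1}"
  by (simp add: space_restrict_space)

lemma emeasure_lunit: "emeasure lunit {0..1} = 1"
  by (simp add: emeasure_restrict_space)


lemma finite_measure_lunit: "finite_measure lunit"
  by (intro finite_measureI) (simp add: emeasure_lunit)

interpretation lunit: finite_measure lunit by (rule finite_measure_lunit)

interpretation lunit_pair: pair_sigma_finite lunit lunit
  by (intro pair_sigma_finite.intro lunit.sigma_finite_measure_axioms)

lemma measure_lunit [simp]: "measure lunit {0..1} = 1"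
  by (simp add: measure_def emeasure_lunit)

lemma set_integral_lunit:
  fixes f :: "real \<Rightarrow> 'b::{banach, second_countable_topology}"
  shows "(LBINT x:{0..1}. f x) = (\<integral>x. f x \<partial>lunit)"
  unfolding set_lebesgue_integral_def by (subst integral_restrict_space) auto

lemma integral_lunit_cong:
  "(\<And>x. 0 \<le> x \<Longrightarrow> x \<le> 1 \<Longrightarrow> f x = g x) \<Longrightarrow> (\<integral>x. f x \<partial>lunit) = (\<integral>x. g x \<partial>lunit)"
  by (rule Bochner_Integration.integral_cong) auto

lemma AE_lunit_not_in:
  assumes "finite Z" shows "AE x in lunit. x \<notin> Z"
proof -
  have "AE x in lborel. x \<notin> Z"
    by (rule AE_not_in[OF finite_imp_null_set_lborel[OF assms]])
  then show ?thesis by (subst AE_restrict_space_iff) auto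
qed

text \<open>
  The class of functions for which all integrals below exist: it contains the continuous functions and
  the sections of kernels with a jump, and it is closed under products.
\<close>

definition bdd_meas :: "(real \<Rightarrow> 'a::{banach, second_countable_topology}) \<Rightarrow> bool" where
  "bdd_meas f \<longleftrightarrow> f \<in> borel_measurable lunit \<and> (\<exists>K. \<forall>x\<in>{0..1}. norm (f x) \<le> K)"

lemma bdd_measI: "f \<in> borel_measurable lunit \<Longrightarrow> (\<And>x. 0 \<le> x \<Longrightarrow> x \<le> 1 \<Longrightarrow> norm (f x) \<le> K) \<Longrightarrow> bdd_meas f"
  unfolding bdd_meas_def by (metis atLeastAtMost_iff)

lemma bdd_meas_measurable [measurable_dest]: "bdd_meas f \<Longrightarrow> f \<in> borel_measurable lunit"
  by (simp add: bdd_meas_def)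

lemma bdd_meas_bound:
  assumes "bdd_meas f"
  obtains K where "K \<ge> 0" "\<And>x. 0 \<le> x \<Longrightarrow> x \<le> 1 \<Longrightarrow> norm (f x) \<le> K"
proof -
  obtain K where "\<forall>x\<in>{0..1}. norm (f x) \<le> K" using assms by (auto simp: bdd_meas_def)
  then show ?thesis by (intro that[of "max K 0"]) (auto intro: max.coboundedI1)
qed

lemma bdd_meas_integrable:
  assumes "bdd_meas f" shows "integrable lunit f"
proof -
  obtain K where "\<And>x. 0 \<le> x \<Longrightarrow> x \<le> 1 \<Longrightarrow> norm (f x) \<le> K" using bdd_meas_bound[OF assms] by metis
  then show ?thesis using assms
    by (intro lunit.integrable_const_bound[of f K] AE_I2) auto
qed

lemma continuous_measurable_lunit:
  fixes f :: "real \<Rightarrow> 'a::{banach, second_countable_topology}"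
  assumes "continuous_on {0..1} f"
  shows "f \<in> borel_measurable lunit"
proof -
  have "f \<in> borel_measurable (restrict_space borel {0..1})"
    by (rule borel_measurable_continuous_on_restrict[OF assms])
  then show ?thesis
    by (simp add: measurable_cong_sets[OF sets_restrict_space_cong[of lborel borel]])
qed

lemma bdd_meas_continuous:
  assumes "continuous_on {0..1} f" shows "bdd_meas f"
proof -
  have "compact (f ` {0..1})" by (intro compact_continuous_image assms) auto
  then obtain K where "\<forall>x\<in>f ` {0..1}. norm x \<le> K" using compact_imp_bounded bounded_iff by metis
  then show ?thesis by (intro bdd_measI[of f K] continuous_measurable_lunit assms) auto
qed

lemma bdd_meas_const [simp, intro]: "bdd_meas (\<lambda>_. c)"
  by (rule bdd_meas_continuous) auto

lemma bdd_meas_add [intro]: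
  assumes "bdd_meas f" "bdd_meas g" shows "bdd_meas (\<lambda>x. f x + g x)"
proof -
  note [measurable] = bdd_meas_measurable[OF assms(1)] bdd_meas_measurable[OF assms(2)]
  obtain K where K: "\<And>x. 0 \<le> x \<Longrightarrow> x \<le> 1 \<Longrightarrow> norm (f x) \<le> K" using assms(1) bdd_meas_bound by metis
  obtain L where L: "\<And>x. 0 \<le> x \<Longrightarrow> x \<le> 1 \<Longrightarrow> norm (g x) \<le> L" using assms(2) bdd_meas_bound by metis
  show ?thesis by (rule bdd_measI[of _ "K + L"], measurable) (blast intro: norm_triangle_mono K L)
qed

lemma bdd_meas_mult [intro]:
  fixes f g :: "real \<Rightarrow> 'a::{banach, second_countable_topology, real_normed_algebra}"
  assumes "bdd_meas f" "bdd_meas g" shows "bdd_meas (\<lambda>x. f x * g x)"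
proof -
  note [measurable] = bdd_meas_measurable[OF assms(1)] bdd_meas_measurable[OF assms(2)]
  obtain K where K: "K \<ge> 0" "\<And>x. 0 \<le> x \<Longrightarrow> x \<le> 1 \<Longrightarrow> norm (f x) \<le> K" using assms(1) bdd_meas_bound by metis
  obtain L where L: "\<And>x. 0 \<le> x \<Longrightarrow> x \<le> 1 \<Longrightarrow> norm (g x) \<le> L" using assms(2) bdd_meas_bound by metis
  show ?thesis
  proof (rule bdd_measI[of _ "K * L"])
    fix x :: real assume x: "0 \<le> x" "x \<le> 1"
    have "norm (f x * g x) \<le> norm (f x) * norm (g x)" by (rule norm_mult_ineq)
    also have "\<dots> \<le> K * L" using K L x by (intro mult_mono) auto
    finally show "norm (f x * g x) \<le> K * L" .
  qed measurable
qed

lemma bdd_meas_uminus [intro]: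
  assumes "bdd_meas f" shows "bdd_meas (\<lambda>x. - f x)"
  using assms by (auto simp: bdd_meas_def)

lemma bdd_meas_diff [intro]:
  assumes "bdd_meas f" "bdd_meas g" shows "bdd_meas (\<lambda>x. f x - g x)"
  using bdd_meas_add[OF assms(1) bdd_meas_uminus[OF assms(2)]] by simp

lemma bdd_meas_sum [intro]:
  assumes "\<And>i. i \<in> A \<Longrightarrow> bdd_meas (f i)" shows "bdd_meas (\<lambda>x. \<Sum>i\<in>A. f i x)"
  using assms by (induction A rule: infinite_finite_induct) auto

lemma bdd_meas_cnj [intro]: "bdd_meas f \<Longrightarrow> bdd_meas (\<lambda>x. cnj (f x))"
  unfolding bdd_meas_def by (auto intro!: borel_measurable_continuous_on[OF continuous_on_cnj[OF continuous_on_id]])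

lemma bdd_meas_norm_square:
  fixes f :: "real \<Rightarrow> 'a::{banach, second_countable_topology}"
  assumes "bdd_meas f" shows "bdd_meas (\<lambda>x. (norm (f x))\<^sup>2)"
proof -
  obtain K where K: "K \<ge> 0" "\<And>x. 0 \<le> x \<Longrightarrow> x \<le> 1 \<Longrightarrow> norm (f x) \<le> K"
    using bdd_meas_bound[OF assms] by metis
  show ?thesis
  proof (rule bdd_measI[where K="K\<^sup>2"])
    show "(\<lambda>x. (norm (f x))\<^sup>2) \<in> borel_measurable lunit"
      using bdd_meas_measurable[OF assms] by measurable
  qed (use K in \<open>auto intro!: power_mono\<close>)
qed

lemma bdd_meas_legendre [simp, intro]: "bdd_meas (\<lambda>x. complex_of_real (legendre01 k x))"
  by (intro bdd_meas_continuous continuous_intros)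

lemma integral_lunit_FTC:
  fixes f :: "real \<Rightarrow> 'a::euclidean_space"
  assumes "0 \<le> a" "a \<le> b" "b \<le> 1"
    and "\<And>x. a \<le> x \<Longrightarrow> x \<le> b \<Longrightarrow> (F has_vector_derivative f x) (at x within {a..b})"
    and "continuous_on {a..b} f"
  shows "(\<integral>x. indicator {a..b} x *\<^sub>R f x \<partial>lunit) = F b - F a"
proof -
  have "(\<integral>x. indicator {a..b} x *\<^sub>R f x \<partial>lunit) = (\<integral>x. indicator {a..b} x *\<^sub>R f x \<partial>lborel)"
    by (subst integral_restrict_space) (use assms(1-3) in \<open>auto intro!: Bochner_Integration.integral_cong simp: indicator_def\<close>)
  also have "\<dots> = F b - F a"
    by (rule integral_FTC_atLeastAtMost) (use assms in auto)
  finally show ?thesis .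
qed

definition legendre_coeff :: "(real \<Rightarrow> complex) \<Rightarrow> nat \<Rightarrow> complex" where
  "legendre_coeff f k = (\<integral>x. f x * of_real (legendre01 k x) \<partial>lunit)"

lemma integral_lunit_le:
  fixes f :: "real \<Rightarrow> 'a::{banach, second_countable_topology}"
  assumes "bdd_meas f" "\<And>x. 0 \<le> x \<Longrightarrow> x \<le> 1 \<Longrightarrow> norm (f x) \<le> K"
  shows "norm (\<integral>x. f x \<partial>lunit) \<le> K"
proof -
  have "norm (\<integral>x. f x \<partial>lunit) \<le> (\<integral>x. K \<partial>lunit)"
    by (rule Bochner_Integration.integral_norm_bound_integral) (use assms bdd_meas_integrable in auto)
  then show ?thesis by simp
qed

text \<open>
  Favard's argument: the Gram matrix is determined by its first row, which is known because
  \<open>legendre_int n\<close> vanishes at both ends for \<open>n > 0\<close>, and by the symmetry of the Jacobi matrix.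
\<close>

lemma legendre01_orthonormal:
  "(\<integral>x. legendre01 m x * legendre01 n x \<partial>lunit) = (if m = n then 1 else 0)"
proof -
  define G where "G m n = (\<integral>x. legendre01 m x * legendre01 n x \<partial>lunit)" for m n
  have int: "integrable lunit (\<lambda>x. legendre01 m x * legendre01 n x)" for m n
    by (intro bdd_meas_integrable bdd_meas_continuous continuous_intros)
  have G0: "G 0 n = (if n = 0 then 1 else 0)" for n
  proof -
    have "G 0 n = (\<integral>x. indicator {0..1} x *\<^sub>R legendre01 n x \<partial>lunit)"
      unfolding G_def by (rule integral_lunit_cong) (simp add: legendre01_0)
    also have "\<dots> = legendre_int n 1 - legendre_int n 0"
      by (rule integral_lunit_FTC)
        (auto intro!: legendre_int_deriv continuous_intros simp flip: has_real_derivative_iff_has_vector_derivative)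
    finally show ?thesis by (simp add: legendre_int_at_0 legendre_int_at_1)
  qed
  define R where "R m n = (\<integral>x. (2 * x - 1) * legendre01 m x * legendre01 n x \<partial>lunit)" for m n
  have Rsym: "R m n = R n m" for m n
    unfolding R_def by (simp add: mult.commute mult.left_commute)
  have R: "R m n = jac m * G (Suc m) n + (if m = 0 then 0 else jac (m - 1) * G (m - 1) n)" for m n
  proof (cases m)
    case 0
    show ?thesis unfolding R_def G_def 0 legendre01_1 by (simp add: mult.assoc)
  next
    case (Suc k)
    have "R m n = (\<integral>x. jac m * (legendre01 (Suc m) x * legendre01 n x) + jac k * (legendre01 k x * legendre01 n x) \<partial>lunit)"
      unfolding R_def Suc legendre01_recurrence by (simp add: algebra_simps)
    also have "\<dots> = jac m * G (Suc m) n + jac k * G k n"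
      unfolding G_def using int by simp
    finally show ?thesis by (simp add: Suc)
  qed
  have Gsym: "G m n = G n m" for m n unfolding G_def by (simp add: mult.commute)
  have "\<forall>n. G m n = (if m = n then 1 else 0)" for m
  proof (induction m rule: less_induct)
    case (less m)
    show ?case
    proof (cases m)
      case 0 then show ?thesis using G0 by auto
    next
      case (Suc k)
      have IH: "G k n = (if k = n then 1 else 0)" "k > 0 \<Longrightarrow> G (k - 1) n = (if k - 1 = n then 1 else 0)" for n
        using less[of k] less[of "k - 1"] Suc by auto
      have "G (Suc k) n = (if Suc k = n then 1 else 0)" for n
      proof -
        have "jac k * G (Suc k) n + (if k = 0 then 0 else jac (k - 1) * G (k - 1) n) =
          jac n * G k (Suc n) + (if n = 0 then 0 else jac (n - 1) * G k (n - 1))"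
          using R[of k n] R[of n k] Rsym[of k n] Gsym[of "Suc n" k] Gsym[of "n - 1" k] by presburger
        then have "jac k * G (Suc k) n = jac k * (if Suc k = n then 1 else 0)"
          unfolding IH(1) using IH(2)[of n] by (cases n) (auto split: if_splits)
        then show ?thesis using jac_pos[of k] by (simp add: mult_cancel_left)
      qed
      then show ?thesis using Suc by simp
    qed
  qed
  then show ?thesis unfolding G_def by blast
qed

lemma legendre_coeff_legendre:
  "legendre_coeff (\<lambda>x. of_real (legendre01 m x)) n = (if m = n then 1 else 0)"
proof -
  have "legendre_coeff (\<lambda>x. of_real (legendre01 m x)) n = of_real (\<integral>x. legendre01 m x * legendre01 n x \<partial>lunit)"
    unfolding legendre_coeff_def by (simp flip: of_real_mult)
  then show ?thesis by (simp add: legendre01_orthonormal)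
qed

lemma legendre_coeff_add:
  "bdd_meas f \<Longrightarrow> bdd_meas g \<Longrightarrow> legendre_coeff (\<lambda>x. f x + g x) k = legendre_coeff f k + legendre_coeff g k"
  unfolding legendre_coeff_def distrib_right
  by (intro Bochner_Integration.integral_add bdd_meas_integrable bdd_meas_mult) auto

lemma legendre_coeff_diff:
  "bdd_meas f \<Longrightarrow> bdd_meas g \<Longrightarrow> legendre_coeff (\<lambda>x. f x - g x) k = legendre_coeff f k - legendre_coeff g k"
  unfolding legendre_coeff_def left_diff_distrib
  by (intro Bochner_Integration.integral_diff bdd_meas_integrable bdd_meas_mult) auto

lemma legendre_coeff_sum:
  "(\<And>i. i \<in> A \<Longrightarrow> bdd_meas (f i)) \<Longrightarrow> legendre_coeff (\<lambda>x. \<Sum>i\<in>A. f i x) k = (\<Sum>i\<in>A. legendre_coeff (f i) k)"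
  unfolding legendre_coeff_def sum_distrib_right
  by (intro Bochner_Integration.integral_sum bdd_meas_integrable bdd_meas_mult) auto

lemma legendre_coeff_scale: "legendre_coeff (\<lambda>x. c * f x) k = c * legendre_coeff f k"
  unfolding legendre_coeff_def by (simp add: mult.assoc)

lemma legendre_coeff_cong:
  "(\<And>x. 0 \<le> x \<Longrightarrow> x \<le> 1 \<Longrightarrow> f x = g x) \<Longrightarrow> legendre_coeff f k = legendre_coeff g k"
  unfolding legendre_coeff_def by (rule integral_lunit_cong) simp

text \<open>
  Expand the integral of \<open>\<bar>f - S\<bar>\<^sup>2\<close>, where \<open>S\<close> is the partial sum of the Legendre series of \<open>f\<close>.
\<close>

lemma bessel:
  assumes f: "bdd_meas f"
  shows "(\<Sum>k<n. (cmod (legendre_coeff f k))\<^sup>2) \<le> (\<integral>x. (cmod (f x))\<^sup>2 \<partial>lunit)"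
proof -
  define c where "c = legendre_coeff f"
  define S where "S x = (\<Sum>k<n. c k * of_real (legendre01 k x))" for x
  have S: "bdd_meas S" unfolding S_def by (intro bdd_meas_sum bdd_meas_mult) auto
  define E where "E = (\<Sum>k<n. complex_of_real ((cmod (c k))\<^sup>2))"
  have fS: "(\<integral>x. f x * cnj (S x) \<partial>lunit) = E"
  proof -
    have "(\<integral>x. f x * cnj (S x) \<partial>lunit) = (\<integral>x. (\<Sum>k<n. cnj (c k) * (f x * of_real (legendre01 k x))) \<partial>lunit)"
      by (rule integral_lunit_cong) (simp add: S_def sum_distrib_left mult_ac)
    also have "\<dots> = (\<Sum>k<n. cnj (c k) * c k)"
      by (subst Bochner_Integration.integral_sum) (simp_all add: c_def legendre_coeff_def bdd_meas_integrable bdd_meas_mult f)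
    finally show ?thesis unfolding E_def complex_norm_square by (simp add: mult.commute)
  qed
  have Sf: "(\<integral>x. S x * cnj (f x) \<partial>lunit) = E"
  proof -
    have "(\<integral>x. S x * cnj (f x) \<partial>lunit) = (\<integral>x. cnj (f x * cnj (S x)) \<partial>lunit)"
      by (rule integral_lunit_cong) (simp add: mult.commute)
    also have "\<dots> = cnj E" unfolding fS[symmetric] by (rule integral_bounded_linear[OF bounded_linear_cnj bdd_meas_integrable[OF bdd_meas_mult[OF f bdd_meas_cnj[OF S]]]])
    finally show ?thesis unfolding E_def by simp
  qed
  have SS: "(\<integral>x. S x * cnj (S x) \<partial>lunit) = E"
  proof -
    have "legendre_coeff S k = (if k < n then c k else 0)" for k
    proof -
      have "legendre_coeff S k = (\<Sum>j<n. c j * (if j = k then 1 else 0))"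
        unfolding S_def by (subst legendre_coeff_sum) (auto simp: legendre_coeff_scale legendre_coeff_legendre)
      then show ?thesis by (simp add: if_distrib[of "\<lambda>x. _ * x"] cong: if_cong)
    qed
    note cS = this
    have "(\<integral>x. S x * cnj (S x) \<partial>lunit) = (\<integral>x. (\<Sum>k<n. cnj (c k) * (S x * of_real (legendre01 k x))) \<partial>lunit)"
      by (rule integral_lunit_cong) (simp add: S_def[of "_"] sum_distrib_left mult_ac)
    also have "\<dots> = (\<Sum>k<n. cnj (c k) * legendre_coeff S k)"
      by (subst Bochner_Integration.integral_sum) (simp_all add: legendre_coeff_def bdd_meas_integrable bdd_meas_mult S)
    also have "\<dots> = (\<Sum>k<n. cnj (c k) * c k)" unfolding cS by (intro sum.cong) auto
    finally show ?thesis unfolding E_def complex_norm_square by (simp add: mult.commute)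
  qed
  have nn: "complex_of_real (\<integral>x. (cmod (g x))\<^sup>2 \<partial>lunit) = (\<integral>x. g x * cnj (g x) \<partial>lunit)"
    if "bdd_meas g" for g
    unfolding complex_norm_square[symmetric]
    by (rule integral_of_real[OF bdd_meas_integrable[OF bdd_meas_norm_square[OF that]], symmetric])
  have "complex_of_real (\<integral>x. (cmod (f x - S x))\<^sup>2 \<partial>lunit) =
     (\<integral>x. f x * cnj (f x) - f x * cnj (S x) - S x * cnj (f x) + S x * cnj (S x) \<partial>lunit)"
    unfolding nn[OF bdd_meas_diff[OF f S]] by (simp add: algebra_simps)
  also have "\<dots> = (\<integral>x. f x * cnj (f x) \<partial>lunit) - E - E + E"
    unfolding fS[symmetric] using fS Sf SS f S by (simp add: bdd_meas_integrable bdd_meas_mult bdd_meas_cnj)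
  also have "\<dots> = complex_of_real ((\<integral>x. (cmod (f x))\<^sup>2 \<partial>lunit) - (\<Sum>k<n. (cmod (c k))\<^sup>2))"
    unfolding nn[OF f, symmetric] E_def by simp
  finally have "(\<integral>x. (cmod (f x - S x))\<^sup>2 \<partial>lunit) =
      (\<integral>x. (cmod (f x))\<^sup>2 \<partial>lunit) - (\<Sum>k<n. (cmod (c k))\<^sup>2)"
    by (simp only: of_real_eq_iff)
  moreover have "(\<integral>x. (cmod (f x - S x))\<^sup>2 \<partial>lunit) \<ge> 0" by simp
  ultimately show ?thesis unfolding c_def by simp
qed

lemma bessel_bound:
  assumes "bdd_meas f" "\<And>x. 0 \<le> x \<Longrightarrow> x \<le> 1 \<Longrightarrow> cmod (f x) \<le> K"
  shows "(\<Sum>k<n. (cmod (legendre_coeff f k))\<^sup>2) \<le> K\<^sup>2"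
proof -
  have "norm (\<integral>x. (cmod (f x))\<^sup>2 \<partial>lunit) \<le> K\<^sup>2"
    by (rule integral_lunit_le[OF bdd_meas_norm_square[OF assms(1)]]) (use assms(2) in \<open>auto intro!: power_mono\<close>)
  then show ?thesis using bessel[OF assms(1), of n] by simp
qed

lemma legendre_coeff_summable:
  assumes "bdd_meas f" shows "summable (\<lambda>k. (cmod (legendre_coeff f k))\<^sup>2)"
  by (rule bdd_meas_bound[OF assms], rule summableI_nonneg_bounded[OF _ bessel_bound[OF assms]]) auto

lemma legendre_coeff_tendsto_0:
  assumes "bdd_meas f" shows "legendre_coeff f \<longlonglongrightarrow> 0"
proof -
  have "(\<lambda>k. (cmod (legendre_coeff f k))\<^sup>2) \<longlonglongrightarrow> 0"
    by (rule summable_LIMSEQ_zero[OF legendre_coeff_summable[OF assms]])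
  then have "(\<lambda>k. sqrt ((cmod (legendre_coeff f k))\<^sup>2)) \<longlonglongrightarrow> sqrt 0" by (intro tendsto_intros)
  then show ?thesis by (simp add: tendsto_norm_zero_iff)
qed

lemma legendre_density:
  fixes f :: "real \<Rightarrow> complex"
  assumes "continuous_on {0..1} f" "\<epsilon> > 0"
  shows "\<exists>(n::nat) c. \<forall>x. 0 \<le> x \<and> x \<le> 1 \<longrightarrow>
     cmod (f x - (\<Sum>k\<le>n. c k * of_real (legendre01 k x))) \<le> \<epsilon>"
proof -
  have "\<exists>g. polynomial_function g \<and> (\<forall>x\<in>{0..1}. cmod (f x - g x) < \<epsilon>)"
    by (rule Stone_Weierstrass_polynomial_function) (use assms in auto)
  then obtain g where g: "polynomial_function g" "\<And>x. 0 \<le> x \<Longrightarrow> x \<le> 1 \<Longrightarrow> cmod (f x - g x) < \<epsilon>"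
    by auto
  have "real_polynomial_function (Re \<circ> g)" "real_polynomial_function (Im \<circ> g)"
    using g(1) bounded_linear_Re bounded_linear_Im unfolding polynomial_function_def by blast+
  then obtain a N b M where ab: "Re \<circ> g = (\<lambda>x. \<Sum>i\<le>(N::nat). a i * x ^ i)" "Im \<circ> g = (\<lambda>x. \<Sum>i\<le>(M::nat). b i * x ^ i)"
    unfolding real_polynomial_function_iff_sum by metis
  obtain n c where c: "\<forall>t. (\<Sum>i\<le>N. a i * t ^ i) = (\<Sum>k\<le>(n::nat). c k * legendre01 k t)"
    using real_polynomial_in_legendre_span by blast
  obtain m d where d: "\<forall>t. (\<Sum>i\<le>M. b i * t ^ i) = (\<Sum>k\<le>(m::nat). d k * legendre01 k t)"
    using real_polynomial_in_legendre_span by blast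
  define e where "e k = Complex (if k \<le> n then c k else 0) (if k \<le> m then d k else 0)" for k
  have c': "Re (g x) = (\<Sum>k\<le>max n m. (if k \<le> n then c k else 0) * legendre01 k x)" for x
    unfolding fun_cong[OF ab(1), unfolded o_apply] c[rule_format] by (rule sum.mono_neutral_cong_left) auto
  have d': "Im (g x) = (\<Sum>k\<le>max n m. (if k \<le> m then d k else 0) * legendre01 k x)" for x
    unfolding fun_cong[OF ab(2), unfolded o_apply] d[rule_format] by (rule sum.mono_neutral_cong_left) auto
  have "g x = (\<Sum>k\<le>max n m. e k * of_real (legendre01 k x))" for x
    by (rule complex_eqI) (simp_all add: c' d' e_def)
  then show ?thesis using g(2) by (metis less_imp_le)
qed

lemma sum_norm_mult_le:
  fixes a b :: "'i \<Rightarrow> complex"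
  assumes "(\<Sum>k\<in>A. (cmod (a k))\<^sup>2) \<le> K\<^sup>2" "(\<Sum>k\<in>A. (cmod (b k))\<^sup>2) \<le> L\<^sup>2" "K \<ge> 0" "L \<ge> 0"
  shows "(\<Sum>k\<in>A. cmod (a k * b k)) \<le> K * L"
proof -
  have "(\<Sum>k\<in>A. cmod (a k * b k)) \<le> L2_set (\<lambda>k. cmod (a k)) A * L2_set (\<lambda>k. cmod (b k)) A"
    using L2_set_mult_ineq[of "\<lambda>k. cmod (a k)" "\<lambda>k. cmod (b k)" A] by (simp add: norm_mult)
  also have "\<dots> \<le> K * L"
    unfolding L2_set_def using assms by (intro mult_mono) (auto intro!: real_le_lsqrt sum_nonneg)
  finally show ?thesis .
qed

text \<open>
  The defect \<open>D n\<close> of the identity is linear in \<open>f\<close>, vanishes for polynomials of degree less than \<open>n\<close>, and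
  is at most \<open>2 \<parallel>f\<parallel> \<parallel>g\<parallel>\<close> by Bessel's inequality.  Polynomials are uniformly dense in the continuous
  functions, so continuity of one factor is enough.
\<close>

theorem parseval:
  assumes f: "continuous_on {0..1} f" and g: "bdd_meas g"
  shows "(\<lambda>k. legendre_coeff f k * legendre_coeff g k) sums (\<integral>x. f x * g x \<partial>lunit)"
proof -
  have bf: "bdd_meas f" by (rule bdd_meas_continuous[OF f])
  obtain K where K: "K \<ge> 0" "\<And>x. 0 \<le> x \<Longrightarrow> x \<le> 1 \<Longrightarrow> cmod (g x) \<le> K"
    using bdd_meas_bound[OF g] by metis
  define D where "D n f = (\<Sum>k<n. legendre_coeff f k * legendre_coeff g k) - (\<integral>x. f x * g x \<partial>lunit)" for n f
  have "\<exists>N. \<forall>n\<ge>N. cmod (D n f) < \<epsilon>" if "\<epsilon> > 0" for \<epsilon>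
  proof -
    \<comment> \<open>The defect of the approximation error \<open>h\<close> is at most \<open>2 \<delta> K\<close>.\<close>
    define \<delta> where "\<delta> = \<epsilon> / (2 * (K + 1))"
    have \<delta>: "\<delta> > 0" unfolding \<delta>_def using K that by simp
    obtain N c where c: "\<And>x. 0 \<le> x \<Longrightarrow> x \<le> 1 \<Longrightarrow>
       cmod (f x - (\<Sum>k\<le>(N::nat). c k * of_real (legendre01 k x))) \<le> \<delta>"
      using legendre_density[OF f \<delta>] by blast
    define q where "q x = (\<Sum>k\<le>N. c k * complex_of_real (legendre01 k x))" for x
    have q: "bdd_meas q" unfolding q_def by (intro bdd_meas_sum bdd_meas_mult) auto
    define h where "h x = f x - q x" for x
    have h: "bdd_meas h" "\<And>x. 0 \<le> x \<Longrightarrow> x \<le> 1 \<Longrightarrow> cmod (h x) \<le> \<delta>"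
      unfolding h_def using bdd_meas_diff[OF bf q] c by (auto simp: q_def)
    have cq: "legendre_coeff q k = (if k \<le> N then c k else 0)" for k
    proof -
      have "legendre_coeff q k = (\<Sum>j\<le>N. c j * (if j = k then 1 else 0))"
        unfolding q_def by (subst legendre_coeff_sum) (auto simp: legendre_coeff_scale legendre_coeff_legendre)
      then show ?thesis by (simp add: if_distrib[of "\<lambda>x. _ * x"] cong: if_cong)
    qed
    have Dq: "D n q = 0" if "n > N" for n
    proof -
      have "(\<integral>x. q x * g x \<partial>lunit) = (\<integral>x. (\<Sum>k\<le>N. c k * (g x * of_real (legendre01 k x))) \<partial>lunit)"
        by (rule integral_lunit_cong) (simp add: q_def sum_distrib_right sum_distrib_left mult_ac)
      also have "\<dots> = (\<Sum>k\<le>N. c k * legendre_coeff g k)"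
        by (subst Bochner_Integration.integral_sum) (simp_all add: legendre_coeff_def bdd_meas_integrable bdd_meas_mult g)
      also have "\<dots> = (\<Sum>k<n. legendre_coeff q k * legendre_coeff g k)"
        unfolding cq by (rule sum.mono_neutral_cong_left) (use that in auto)
      finally show ?thesis unfolding D_def by simp
    qed
    have Dh: "cmod (D n h) \<le> \<delta> * K + \<delta> * K" for n
    proof -
      have "cmod (\<Sum>k<n. legendre_coeff h k * legendre_coeff g k) \<le> \<delta> * K"
        by (rule order_trans[OF norm_sum], rule sum_norm_mult_le)
          (use h g K \<delta> in \<open>auto intro!: bessel_bound\<close>)
      moreover have "cmod (\<integral>x. h x * g x \<partial>lunit) \<le> \<delta> * K"
        by (rule integral_lunit_le) (use h g K \<delta> in \<open>auto simp: norm_mult intro!: mult_mono\<close>)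
      ultimately show ?thesis unfolding D_def by (meson add_mono norm_triangle_le_diff)
    qed
    have "D n f = D n h + D n q" for n
    proof -
      have "legendre_coeff f k = legendre_coeff h k + legendre_coeff q k" for k
        unfolding h_def legendre_coeff_diff[OF bf q] by simp
      moreover have "(\<integral>x. f x * g x \<partial>lunit) = (\<integral>x. h x * g x \<partial>lunit) + (\<integral>x. q x * g x \<partial>lunit)"
        unfolding Bochner_Integration.integral_add[OF bdd_meas_integrable[OF bdd_meas_mult[OF h(1) g]]
            bdd_meas_integrable[OF bdd_meas_mult[OF q g]], symmetric]
        by (simp add: h_def algebra_simps)
      ultimately show ?thesis unfolding D_def by (simp add: distrib_right sum.distrib)
    qed
    note Df = this
    have "cmod (D n f) < \<epsilon>" if "n > N" for n
    proof -
      have "cmod (D n f) \<le> 2 * \<delta> * K" using Dq[OF that] Dh[of n] Df[of n] by (simp add: mult_ac)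
      also have "\<dots> < 2 * \<delta> * (K + 1)" using \<delta> by simp
      also have "\<dots> = \<epsilon>" unfolding \<delta>_def using K by (simp add: field_simps)
      finally show ?thesis .
    qed
    then show ?thesis by (intro exI[of _ "Suc N"]) auto
  qed
  then have "(\<lambda>n. D n f) \<longlonglongrightarrow> 0" by (intro LIMSEQ_I) simp
  then show ?thesis unfolding D_def sums_def by (simp add: LIM_zero_iff)
qed

text \<open>
  The form of Fubini's theorem behind associativity: the kernel \<open>G\<close> may act on either side.
\<close>

lemma integral_swap_lunit:
  fixes a b :: "real \<Rightarrow> complex"
  assumes a: "bdd_meas a" and b: "bdd_meas b"
    and G: "case_prod G \<in> borel_measurable (lunit \<Otimes>\<^sub>M lunit)"
    and K: "\<And>x y. x \<in> {0..1} \<Longrightarrow> y \<in> {0..1} \<Longrightarrow> cmod (G x y) \<le> K"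
  shows "(\<integral>y. (\<integral>x. a x * G x y \<partial>lunit) * b y \<partial>lunit) = (\<integral>x. a x * (\<integral>y. G x y * b y \<partial>lunit) \<partial>lunit)"
proof -
  note [measurable] = bdd_meas_measurable[OF a] bdd_meas_measurable[OF b] G
  obtain A where A: "A \<ge> 0" "\<And>x. 0 \<le> x \<Longrightarrow> x \<le> 1 \<Longrightarrow> cmod (a x) \<le> A"
    using bdd_meas_bound[OF a] by metis
  obtain B where B: "B \<ge> 0" "\<And>x. 0 \<le> x \<Longrightarrow> x \<le> 1 \<Longrightarrow> cmod (b x) \<le> B"
    using bdd_meas_bound[OF b] by metis
  interpret P: finite_measure "lunit \<Otimes>\<^sub>M lunit"
    by (rule finite_measure_pair_measure) (rule finite_measure_lunit)+
  have int: "integrable (lunit \<Otimes>\<^sub>M lunit) (\<lambda>(x, y). a x * G x y * b y)"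
  proof (rule P.integrable_const_bound)
    have "cmod (a x * G x y * b y) \<le> A * K * B" if "x \<in> {0..1}" "y \<in> {0..1}" for x y
      using A B K[OF that] that unfolding norm_mult
      by (intro mult_mono mult_nonneg_nonneg) (auto intro: order_trans[OF norm_ge_zero])
    then show "AE z in lunit \<Otimes>\<^sub>M lunit. cmod (case z of (x, y) \<Rightarrow> a x * G x y * b y) \<le> A * K * B"
      by (intro AE_I2) (auto simp: space_pair_measure)
  qed measurable
  have "(\<integral>y. (\<integral>x. a x * G x y \<partial>lunit) * b y \<partial>lunit) = (\<integral>y. (\<integral>x. a x * G x y * b y \<partial>lunit) \<partial>lunit)"
    by simp
  also have "\<dots> = (\<integral>x. (\<integral>y. a x * G x y * b y \<partial>lunit) \<partial>lunit)"
    by (rule lunit_pair.Fubini_integral[OF int])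
  also have "\<dots> = (\<integral>x. a x * (\<integral>y. G x y * b y \<partial>lunit) \<partial>lunit)"
    by (simp add: mult.assoc)
  finally show ?thesis .
qed

text \<open>
  Dominated convergence.  The exceptional set \<open>Z\<close> takes the points at which a kernel jumps.
\<close>

lemma continuous_on_integral_lunit:
  fixes F :: "'a::metric_space \<Rightarrow> real \<Rightarrow> complex"
  assumes meas: "\<And>x. x \<in> X \<Longrightarrow> F x \<in> borel_measurable lunit"
    and bound: "\<And>x y. x \<in> X \<Longrightarrow> 0 \<le> y \<Longrightarrow> y \<le> 1 \<Longrightarrow> cmod (F x y) \<le> K"
    and lim: "\<And>x. x \<in> X \<Longrightarrow> \<exists>Z. finite Z \<and> (\<forall>y\<in>{0..1} - Z. continuous (at x within X) (\<lambda>x. F x y))"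
  shows "continuous_on X (\<lambda>x. \<integral>y. F x y \<partial>lunit)"
  unfolding continuous_on_sequentially
proof (intro allI ballI impI)
  fix u x assume x: "x \<in> X" and u: "(\<forall>n. u n \<in> X) \<and> u \<longlonglongrightarrow> x"
  obtain Z where Z: "finite Z" "\<forall>y\<in>{0..1} - Z. continuous (at x within X) (\<lambda>x. F x y)"
    using lim[OF x] by blast
  have "(\<lambda>n. \<integral>y. F (u n) y \<partial>lunit) \<longlonglongrightarrow> (\<integral>y. F x y \<partial>lunit)"
  proof (rule integral_dominated_convergence)
    show "integrable lunit (\<lambda>_. K)" by simp
    show "AE y in lunit. cmod (F (u n) y) \<le> K" for n
      using bound u by (intro AE_I2) auto
    show "AE y in lunit. (\<lambda>n. F (u n) y) \<longlonglongrightarrow> F x y"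
      using AE_lunit_not_in[OF Z(1)] AE_space
    proof eventually_elim
      case (elim y)
      then have "continuous (at x within X) (\<lambda>x. F x y)" using Z(2) by auto
      then show ?case using u unfolding continuous_within_sequentially o_def by auto
    qed
  qed (use meas x u in auto)
  then show "((\<lambda>x. \<integral>y. F x y \<partial>lunit) \<circ> u) \<longlonglongrightarrow> (\<integral>y. F x y \<partial>lunit)" by (simp add: o_def)
qed

section \<open>Volterra kernels\<close>

abbreviation triangle :: "(real \<times> real) set" where
  "triangle \<equiv> {(t, s). 0 \<le> s \<and> s \<le> t \<and> t \<le> 1}"

text \<open>
  The kernels \<open>f(t, s) \<Theta>(t - s)\<close> with \<open>f\<close> continuous up to the diagonal, a class closed under sums,
  star-products and uniform limits.
\<close>

definition volterra :: "kernel \<Rightarrow> bool" where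
  "volterra f \<longleftrightarrow> (\<forall>t s. t < s \<longrightarrow> f t s = 0) \<and> continuous_on triangle (\<lambda>(t, s). f t s)"

lemma closed_triangle: "closed triangle"
proof -
  have "triangle = {p. 0 \<le> snd p} \<inter> {p. snd p \<le> fst p} \<inter> {p. fst p \<le> 1}" by auto
  then show ?thesis by (simp only:) (intro closed_Int closed_Collect_le continuous_intros)
qed

lemma compact_triangle: "compact triangle"
proof -
  have eq: "triangle = ({0..1} \<times> {0..1}) \<inter> triangle" by auto
  show ?thesis
    by (subst eq) (intro compact_Int_closed compact_Times compact_Icc closed_triangle)
qed

lemma volterra_zero: "volterra f \<Longrightarrow> t < s \<Longrightarrow> f t s = 0"
  by (simp add: volterra_def)

lemma volterra_bound:
  assumes "volterra f"
  shows "\<exists>K\<ge>0. \<forall>t\<in>{0..1}. \<forall>s\<in>{0..1}. cmod (f t s) \<le> K"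
proof -
  have "compact ((\<lambda>(t, s). f t s) ` triangle)"
    using assms compact_triangle by (intro compact_continuous_image) (auto simp: volterra_def)
  then obtain K where K: "\<forall>z\<in>(\<lambda>(t, s). f t s) ` triangle. cmod z \<le> K"
    using bounded_iff[THEN iffD1, OF compact_imp_bounded] by blast
  have "cmod (f t s) \<le> max K 0" if ts: "t \<in> {0..1}" "s \<in> {0..1}" for t s
  proof (cases "s \<le> t")
    case True
    then have "f t s \<in> (\<lambda>(t, s). f t s) ` triangle" using ts by (intro image_eqI[of _ _ "(t, s)"]) auto
    then show ?thesis using K by (auto intro: max.coboundedI1)
  qed (use volterra_zero[OF assms, of t s] in auto)
  then show ?thesis by (intro exI[of _ "max K 0"]) auto
qed

lemma volterra_measurable:
  assumes "volterra f" shows "case_prod f \<in> borel_measurable (lunit \<Otimes>\<^sub>M lunit)"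
proof -
  have b: "(\<lambda>p. indicator triangle p *\<^sub>R case_prod f p) \<in> borel_measurable borel"
    using assms closed_triangle
    by (intro borel_measurable_continuous_on_indicator borel_closed) (auto simp: volterra_def)
  have m: "(\<lambda>p. p) \<in> (lunit \<Otimes>\<^sub>M lunit) \<rightarrow>\<^sub>M (borel :: (real \<times> real) measure)"
    unfolding borel_prod[symmetric]
  proof (rule measurable_pair)
    have i: "(\<lambda>x. x) \<in> lunit \<rightarrow>\<^sub>M borel" by (rule continuous_measurable_lunit) simp
    show "fst \<circ> (\<lambda>p. p) \<in> lunit \<Otimes>\<^sub>M lunit \<rightarrow>\<^sub>M (borel :: real measure)"
      using measurable_compose[OF measurable_fst i] by (simp add: o_def)
    show "snd \<circ> (\<lambda>p. p) \<in> lunit \<Otimes>\<^sub>M lunit \<rightarrow>\<^sub>M (borel :: real measure)"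
      using measurable_compose[OF measurable_snd i] by (simp add: o_def)
  qed
  have "(\<lambda>p. indicator triangle p *\<^sub>R case_prod f p) \<in> borel_measurable (lunit \<Otimes>\<^sub>M lunit)"
    using measurable_compose[OF m b] by simp
  also have "?this \<longleftrightarrow> ?thesis"
    by (rule measurable_cong) (auto simp: space_pair_measure indicator_def not_le intro: volterra_zero[OF assms])
  finally show ?thesis .
qed

lemma volterra_bdd_meas_row:
  assumes "volterra f" "0 \<le> t" "t \<le> 1" shows "bdd_meas (f t)"
proof -
  obtain K where K: "K \<ge> 0" "\<And>t s. t \<in> {0..1} \<Longrightarrow> s \<in> {0..1} \<Longrightarrow> cmod (f t s) \<le> K"
    using volterra_bound[OF assms(1)] by blast
  have "(\<lambda>s. case_prod f (t, s)) \<in> borel_measurable lunit"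
    by (rule measurable_compose[OF measurable_Pair1' volterra_measurable[OF assms(1)]]) (use assms in auto)
  then have "f t \<in> borel_measurable lunit" by simp
  then show ?thesis by (rule bdd_measI) (use K(2) assms in auto)
qed

lemma volterra_bdd_meas_col:
  assumes "volterra f" "0 \<le> s" "s \<le> 1" shows "bdd_meas (\<lambda>t. f t s)"
proof -
  obtain K where K: "K \<ge> 0" "\<And>t s. t \<in> {0..1} \<Longrightarrow> s \<in> {0..1} \<Longrightarrow> cmod (f t s) \<le> K"
    using volterra_bound[OF assms(1)] by blast
  have "(\<lambda>t. case_prod f (t, s)) \<in> borel_measurable lunit"
    by (rule measurable_compose[OF measurable_Pair2' volterra_measurable[OF assms(1)]]) (use assms in auto)
  then have "(\<lambda>t. f t s) \<in> borel_measurable lunit" by simp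
  then show ?thesis by (rule bdd_measI) (use K(2) assms in auto)
qed

lemma volterra_continuous_off_diagonal:
  assumes f: "volterra f" and ts: "0 \<le> t" "t \<le> 1" "0 \<le> s" "s \<le> 1" "t \<noteq> s"
  shows "continuous (at (t, s) within {0..1} \<times> {0..1}) (case_prod f)"
proof (cases "s < t")
  case True
  have "open {p :: real \<times> real. snd p < fst p}" by (intro open_Collect_less continuous_intros)
  then have "at (t, s) within {0..1} \<times> {0..1} = at (t, s) within triangle"
    by (rule at_within_nhd[rotated]) (use True in auto)
  moreover have "continuous (at (t, s) within triangle) (case_prod f)"
    using f ts True unfolding volterra_def continuous_on_eq_continuous_within by auto
  ultimately show ?thesis by simp
next
  case False
  then have "t < s" using ts by simp
  have "open {p :: real \<times> real. fst p < snd p}" by (intro open_Collect_less continuous_intros)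
  then have "\<forall>\<^sub>F p in nhds (t, s). p \<in> {p. fst p < snd p}"
    using \<open>t < s\<close> by (intro eventually_nhds_in_open) auto
  then have "\<forall>\<^sub>F p in at (t, s) within {0..1} \<times> {0..1}. case_prod f p = 0"
    unfolding eventually_at_filter
    by eventually_elim (auto simp: volterra_zero[OF f])
  then show ?thesis unfolding continuous_within
    using volterra_zero[OF f \<open>t < s\<close>] by (auto intro: tendsto_eventually)
qed

lemma volterra_continuous_compose:
  assumes f: "volterra f" and X: "p \<in> X" "\<And>q. q \<in> X \<Longrightarrow> a q \<in> {0..1} \<and> b q \<in> {0..1}"
    and ab: "continuous_on X a" "continuous_on X b" "a p \<noteq> b p"
  shows "continuous (at p within X) (\<lambda>q. f (a q) (b q))"
proof -
  have "continuous (at p within X) (\<lambda>q. (a q, b q))"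
    using ab X(1) by (intro continuous_Pair) (auto simp: continuous_on_eq_continuous_within)
  moreover have "continuous (at (a p, b p) within (\<lambda>q. (a q, b q)) ` X) (case_prod f)"
    by (rule continuous_within_subset[OF volterra_continuous_off_diagonal[OF f]])
      (use X ab(3) in auto)
  ultimately have "continuous (at p within X) (case_prod f \<circ> (\<lambda>q. (a q, b q)))"
    by (rule continuous_within_compose)
  then show ?thesis by (simp add: o_def)
qed

lemma star_eq: "star f g t s = (\<integral>x. f t x * g x s \<partial>lunit)"
  unfolding star_def set_integral_lunit ..

text \<open>
  The integrand at \<open>(t, s)\<close> jumps only at the two points \<open>t\<close> and \<open>s\<close> of the interval of integration.
\<close>

lemma volterra_star [intro]:
  assumes f: "volterra f" and g: "volterra g"
  shows "volterra (star f g)"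
  unfolding volterra_def
proof (intro conjI allI impI)
  fix t s :: real assume "t < s"
  have "f t x * g x s = 0" for x
    using \<open>t < s\<close> volterra_zero[OF f, of t x] volterra_zero[OF g, of x s] by (cases "t < x") auto
  then have "(\<lambda>x. f t x * g x s) = (\<lambda>_. 0)" by (rule ext)
  then show "star f g t s = 0" unfolding star_eq by (simp only: Bochner_Integration.integral_zero)
next
  obtain K where K: "K \<ge> 0" "\<And>t s. t \<in> {0..1} \<Longrightarrow> s \<in> {0..1} \<Longrightarrow> cmod (f t s) \<le> K"
    using volterra_bound[OF f] by blast
  obtain L where L: "L \<ge> 0" "\<And>t s. t \<in> {0..1} \<Longrightarrow> s \<in> {0..1} \<Longrightarrow> cmod (g t s) \<le> L"
    using volterra_bound[OF g] by blast
  have "continuous_on triangle (\<lambda>p. \<integral>x. f (fst p) x * g x (snd p) \<partial>lunit)"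
  proof (rule continuous_on_integral_lunit[where K="K * L"])
    fix p :: "real \<times> real" assume p: "p \<in> triangle"
    show "(\<lambda>x. f (fst p) x * g x (snd p)) \<in> borel_measurable lunit"
      using p by (intro bdd_meas_measurable bdd_meas_mult volterra_bdd_meas_row[OF f] volterra_bdd_meas_col[OF g]) auto
    show "cmod (f (fst p) x * g x (snd p)) \<le> K * L" if "0 \<le> x" "x \<le> 1" for x
      unfolding norm_mult using p that K L by (intro mult_mono) auto
    show "\<exists>Z. finite Z \<and> (\<forall>y\<in>{0..1} - Z. continuous (at p within triangle) (\<lambda>p. f (fst p) y * g y (snd p)))"
    proof (intro exI[of _ "{fst p, snd p}"] conjI ballI)
      fix y assume y: "y \<in> {0..1} - {fst p, snd p}"
      show "continuous (at p within triangle) (\<lambda>p. f (fst p) y * g y (snd p))"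
        by (intro continuous_mult volterra_continuous_compose[OF f] volterra_continuous_compose[OF g] continuous_intros)
          (use p y in auto)
    qed simp
  qed
  then show "continuous_on triangle (\<lambda>(t, s). star f g t s)"
    unfolding star_eq by (simp add: case_prod_unfold)
qed

lemma integral_swap_volterra:
  assumes ab: "bdd_meas a" "bdd_meas b" and f: "volterra f"
  shows "(\<integral>y. (\<integral>x. a x * f x y \<partial>lunit) * b y \<partial>lunit) = (\<integral>x. a x * (\<integral>y. f x y * b y \<partial>lunit) \<partial>lunit)"
    and "(\<integral>y. (\<integral>x. a x * f y x \<partial>lunit) * b y \<partial>lunit) = (\<integral>x. a x * (\<integral>y. f y x * b y \<partial>lunit) \<partial>lunit)"
proof -
  obtain K where K: "\<And>t s. t \<in> {0..1} \<Longrightarrow> s \<in> {0..1} \<Longrightarrow> cmod (f t s) \<le> K"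
    using volterra_bound[OF f] by blast
  show "(\<integral>y. (\<integral>x. a x * f x y \<partial>lunit) * b y \<partial>lunit) = (\<integral>x. a x * (\<integral>y. f x y * b y \<partial>lunit) \<partial>lunit)"
    by (rule integral_swap_lunit[OF ab volterra_measurable[OF f] K])
  show "(\<integral>y. (\<integral>x. a x * f y x \<partial>lunit) * b y \<partial>lunit) = (\<integral>x. a x * (\<integral>y. f y x * b y \<partial>lunit) \<partial>lunit)"
    by (rule integral_swap_lunit[OF ab measurable_pair_swap[OF volterra_measurable[OF f], simplified] K])
qed

lemma star_assoc:
  assumes f: "volterra f" and g: "volterra g" and h: "volterra h" and ts: "0 \<le> t" "t \<le> 1" "0 \<le> s" "s \<le> 1"
  shows "star (star f g) h t s = star f (star g h) t s"
  unfolding star_eq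
  by (rule integral_swap_volterra(1)[OF volterra_bdd_meas_row[OF f] volterra_bdd_meas_col[OF h] g]) (rule ts)+

text \<open>
  Legendre coefficients in one variable, as functions of the other one.  They are continuous although the
  kernel is not, which is what Parseval's identity asks for.
\<close>

definition row_coeff :: "kernel \<Rightarrow> nat \<Rightarrow> real \<Rightarrow> complex" where
  "row_coeff f l t = legendre_coeff (f t) l"

definition col_coeff :: "kernel \<Rightarrow> nat \<Rightarrow> real \<Rightarrow> complex" where
  "col_coeff f k s = legendre_coeff (\<lambda>t. f t s) k"

lemma continuous_on_legendre_coeff:
  assumes F: "\<And>x. x \<in> {0..1} \<Longrightarrow> bdd_meas (F x)"
    and K: "K \<ge> 0" "\<And>x y. x \<in> {0..1} \<Longrightarrow> y \<in> {0..1} \<Longrightarrow> cmod (F x y) \<le> K"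
    and cont: "\<And>x y. x \<in> {0..1} \<Longrightarrow> y \<in> {0..1} \<Longrightarrow> x \<noteq> y \<Longrightarrow> continuous (at x within {0..1}) (\<lambda>x. F x y)"
  shows "continuous_on {0..1} (\<lambda>x. legendre_coeff (F x) k)"
proof -
  obtain L where L: "L \<ge> 0" "\<And>x. 0 \<le> x \<Longrightarrow> x \<le> 1 \<Longrightarrow> cmod (of_real (legendre01 k x)) \<le> L"
    using bdd_meas_bound[OF bdd_meas_legendre] by metis
  show ?thesis unfolding legendre_coeff_def
  proof (rule continuous_on_integral_lunit[where K="K * L"])
    fix x :: real assume x: "x \<in> {0..1}"
    show "(\<lambda>y. F x y * of_real (legendre01 k y)) \<in> borel_measurable lunit"
      by (intro bdd_meas_measurable bdd_meas_mult F[OF x] bdd_meas_legendre)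
    show "cmod (F x y * of_real (legendre01 k y)) \<le> K * L" if "0 \<le> y" "y \<le> 1" for y
      unfolding norm_mult using x that K L by (intro mult_mono) auto
    show "\<exists>Z. finite Z \<and> (\<forall>y\<in>{0..1} - Z. continuous (at x within {0..1}) (\<lambda>x. F x y * of_real (legendre01 k y)))"
      using cont[OF x] by (intro exI[of _ "{x}"] conjI ballI continuous_mult continuous_const) auto
  qed
qed

lemma continuous_on_row_coeff:
  assumes f: "volterra f" shows "continuous_on {0..1} (row_coeff f l)"
proof -
  obtain K where "K \<ge> 0" "\<And>t s. t \<in> {0..1} \<Longrightarrow> s \<in> {0..1} \<Longrightarrow> cmod (f t s) \<le> K"
    using volterra_bound[OF f] by blast
  then show ?thesis unfolding row_coeff_def[abs_def]
    by (rule continuous_on_legendre_coeff[rotated])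
      (auto intro!: volterra_bdd_meas_row[OF f] volterra_continuous_compose[OF f] continuous_intros)
qed

lemma continuous_on_col_coeff:
  assumes f: "volterra f" shows "continuous_on {0..1} (col_coeff f k)"
proof -
  obtain K where "K \<ge> 0" "\<And>s t. s \<in> {0..1} \<Longrightarrow> t \<in> {0..1} \<Longrightarrow> cmod (f t s) \<le> K"
    using volterra_bound[OF f] by blast
  then show ?thesis unfolding col_coeff_def[abs_def]
    by (rule continuous_on_legendre_coeff[rotated])
      (auto intro!: volterra_bdd_meas_col[OF f] volterra_continuous_compose[OF f] continuous_intros)
qed

lemma coeff_mat_row: "coeff_mat f k l = legendre_coeff (row_coeff f l) k"
proof -
  have "coeff_mat f k l = (\<integral>\<tau>. (\<integral>\<rho>. of_real (legendre01 k \<tau>) * (f \<tau> \<rho> * of_real (legendre01 l \<rho>)) \<partial>lunit) \<partial>lunit)"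
    unfolding coeff_mat_def set_integral_lunit by (simp add: mult_ac)
  also have "\<dots> = legendre_coeff (row_coeff f l) k"
    unfolding legendre_coeff_def row_coeff_def by (simp add: mult.commute)
  finally show ?thesis .
qed

lemma coeff_mat_col:
  assumes f: "volterra f" shows "coeff_mat f k l = legendre_coeff (col_coeff f k) l"
proof -
  have "legendre_coeff (col_coeff f k) l =
     (\<integral>\<rho>. (\<integral>\<tau>. of_real (legendre01 k \<tau>) * f \<tau> \<rho> \<partial>lunit) * of_real (legendre01 l \<rho>) \<partial>lunit)"
    unfolding legendre_coeff_def col_coeff_def by (simp add: mult.commute)
  also have "\<dots> = (\<integral>\<tau>. of_real (legendre01 k \<tau>) * (\<integral>\<rho>. f \<tau> \<rho> * of_real (legendre01 l \<rho>) \<partial>lunit) \<partial>lunit)"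
    by (rule integral_swap_volterra(1)[OF bdd_meas_legendre bdd_meas_legendre f])
  also have "\<dots> = coeff_mat f k l"
    unfolding coeff_mat_row legendre_coeff_def row_coeff_def by (simp add: mult.commute)
  finally show ?thesis by simp
qed

lemma row_coeff_star:
  assumes f: "volterra f" and g: "volterra g" and t: "0 \<le> t" "t \<le> 1"
  shows "row_coeff (star f g) l t = (\<integral>x. f t x * row_coeff g l x \<partial>lunit)"
  unfolding row_coeff_def legendre_coeff_def star_eq
  by (rule integral_swap_volterra(1)[OF volterra_bdd_meas_row[OF f t] bdd_meas_legendre g])

text \<open>
  By Fubini's theorem the coefficient of \<open>f \<star> g\<close> is the integral of \<open>col_coeff f k\<close> times \<open>row_coeff g l\<close>,
  and the sum on the left is Parseval's series for this integral.
\<close>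

theorem coeff_mat_star:
  assumes f: "volterra f" and g: "volterra g"
  shows "(\<lambda>m. coeff_mat f k m * coeff_mat g m l) sums coeff_mat (star f g) k l"
proof -
  have b: "bdd_meas (row_coeff g l)" by (rule bdd_meas_continuous[OF continuous_on_row_coeff[OF g]])
  have "coeff_mat (star f g) k l = (\<integral>\<tau>. (\<integral>x. row_coeff g l x * f \<tau> x \<partial>lunit) * of_real (legendre01 k \<tau>) \<partial>lunit)"
    unfolding coeff_mat_row legendre_coeff_def
    by (rule integral_lunit_cong) (simp add: row_coeff_star[OF f g] mult.commute)
  also have "\<dots> = (\<integral>x. row_coeff g l x * (\<integral>\<tau>. f \<tau> x * of_real (legendre01 k \<tau>) \<partial>lunit) \<partial>lunit)"
    by (rule integral_swap_volterra(2)[OF b bdd_meas_legendre f])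
  also have "\<dots> = (\<integral>x. col_coeff f k x * row_coeff g l x \<partial>lunit)"
    unfolding col_coeff_def legendre_coeff_def by (simp add: mult.commute)
  finally show ?thesis
    using parseval[OF continuous_on_col_coeff[OF f] b] unfolding coeff_mat_col[OF f] coeff_mat_row[of g] by simp
qed

definition hilbert_schmidt :: "infmat \<Rightarrow> bool" where
  "hilbert_schmidt X \<longleftrightarrow> (\<lambda>(i, j). (cmod (X i j))\<^sup>2) summable_on UNIV"

text \<open>
  Bessel's inequality twice: first in the second variable for each \<open>col_coeff f i\<close>, then in the first variable
  for each section of \<open>f\<close>.
\<close>

theorem hilbert_schmidt_coeff_mat:
  assumes f: "volterra f" shows "hilbert_schmidt (coeff_mat f)"
proof -
  obtain K where K: "K \<ge> 0" "\<And>t s. t \<in> {0..1} \<Longrightarrow> s \<in> {0..1} \<Longrightarrow> cmod (f t s) \<le> K"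
    using volterra_bound[OF f] by blast
  have cont: "continuous_on {0..1} (col_coeff f i)" for i by (rule continuous_on_col_coeff[OF f])
  have fin: "(\<Sum>i<n. \<Sum>j<m. (cmod (coeff_mat f i j))\<^sup>2) \<le> K\<^sup>2" for n m
  proof -
    have "(\<Sum>i<n. \<Sum>j<m. (cmod (coeff_mat f i j))\<^sup>2) \<le> (\<Sum>i<n. \<integral>s. (cmod (col_coeff f i s))\<^sup>2 \<partial>lunit)"
      unfolding coeff_mat_col[OF f] by (intro sum_mono bessel bdd_meas_continuous cont)
    also have "\<dots> = (\<integral>s. (\<Sum>i<n. (cmod (col_coeff f i s))\<^sup>2) \<partial>lunit)"
      by (rule Bochner_Integration.integral_sum[symmetric])
        (intro bdd_meas_integrable bdd_meas_norm_square bdd_meas_continuous cont)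
    also have "\<dots> \<le> norm (\<integral>s. (\<Sum>i<n. (cmod (col_coeff f i s))\<^sup>2) \<partial>lunit)" by simp
    also have "\<dots> \<le> K\<^sup>2"
    proof (rule integral_lunit_le)
      show "bdd_meas (\<lambda>s. \<Sum>i<n. (cmod (col_coeff f i s))\<^sup>2)"
        by (intro bdd_meas_sum bdd_meas_norm_square bdd_meas_continuous cont)
      fix s :: real assume s: "0 \<le> s" "s \<le> 1"
      have "(\<Sum>i<n. (cmod (col_coeff f i s))\<^sup>2) \<le> K\<^sup>2"
        unfolding col_coeff_def by (rule bessel_bound) (use s K volterra_bdd_meas_col[OF f] in auto)
      then show "norm (\<Sum>i<n. (cmod (col_coeff f i s))\<^sup>2) \<le> K\<^sup>2" by (simp add: sum_nonneg)
    qed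
    finally show ?thesis .
  qed
  show ?thesis unfolding hilbert_schmidt_def
  proof (rule nonneg_bdd_above_summable_on)
    show "bdd_above (sum (\<lambda>(i, j). (cmod (coeff_mat f i j))\<^sup>2) ` {F. F \<subseteq> UNIV \<and> finite F})"
    proof (rule bdd_aboveI2)
      fix F :: "(nat \<times> nat) set" assume "F \<in> {F. F \<subseteq> UNIV \<and> finite F}"
      then have F: "finite F" by simp
      obtain n where n: "fst ` F \<subseteq> {..<n}" using finite_nat_bounded[of "fst ` F"] F by auto
      obtain m where m: "snd ` F \<subseteq> {..<m}" using finite_nat_bounded[of "snd ` F"] F by auto
      have "F \<subseteq> {..<n} \<times> {..<m}" using n m by force
      then have "(\<Sum>(i, j)\<in>F. (cmod (coeff_mat f i j))\<^sup>2) \<le> (\<Sum>(i, j)\<in>{..<n} \<times> {..<m}. (cmod (coeff_mat f i j))\<^sup>2)"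
        by (intro sum_mono2) auto
      also have "\<dots> \<le> K\<^sup>2" unfolding sum.cartesian_product[symmetric] by (rule fin)
      finally show "(\<Sum>(i, j)\<in>F. (cmod (coeff_mat f i j))\<^sup>2) \<le> K\<^sup>2" .
    qed
  qed auto
qed

abbreviation theta :: kernel where "theta \<equiv> (\<lambda>t s. of_real (heaviside (t - s)))"

lemma volterra_heaviside_mult:
  assumes "continuous_on triangle (\<lambda>(t, s). f t s)"
  shows "volterra (\<lambda>t s. of_real (heaviside (t - s)) * f t s)"
  unfolding volterra_def
proof (intro conjI allI impI)
  show "continuous_on triangle (\<lambda>(t, s). of_real (heaviside (t - s)) * f t s)"
    by (rule continuous_on_eq[OF assms]) (auto simp: heaviside_def)
qed (auto simp: heaviside_def)

lemma volterra_theta: "volterra theta"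
  using volterra_heaviside_mult[of "\<lambda>_ _. 1"] by simp

lemma volterra_add [intro]:
  assumes "volterra f" "volterra g" shows "volterra (\<lambda>t s. f t s + g t s)"
  using assms unfolding volterra_def by (auto simp: case_prod_unfold intro!: continuous_on_add)

lemma volterra_scale [intro]:
  assumes "volterra f" shows "volterra (\<lambda>t s. c * f t s)"
  using assms unfolding volterra_def by (auto simp: case_prod_unfold intro!: continuous_intros)

lemma volterra_sum [intro]:
  assumes "\<And>i. i \<in> A \<Longrightarrow> volterra (f i)" shows "volterra (\<lambda>t s. \<Sum>i\<in>A. f i t s)"
  using assms unfolding volterra_def by (auto simp: case_prod_unfold intro!: continuous_on_sum)

lemma coeff_mat_cong:
  assumes "\<And>t s. 0 \<le> t \<Longrightarrow> t \<le> 1 \<Longrightarrow> 0 \<le> s \<Longrightarrow> s \<le> 1 \<Longrightarrow> f t s = g t s"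
  shows "coeff_mat f = coeff_mat g"
  unfolding coeff_mat_row row_coeff_def fun_eq_iff
  by (intro allI legendre_coeff_cong) (use assms in auto)

lemma coeff_mat_add:
  assumes "volterra f" "volterra g"
  shows "coeff_mat (\<lambda>t s. f t s + g t s) k l = coeff_mat f k l + coeff_mat g k l"
proof -
  have "coeff_mat (\<lambda>t s. f t s + g t s) k l = legendre_coeff (\<lambda>x. row_coeff f l x + row_coeff g l x) k"
    unfolding coeff_mat_row
    by (rule legendre_coeff_cong) (simp add: row_coeff_def legendre_coeff_add volterra_bdd_meas_row assms)
  then show ?thesis unfolding coeff_mat_row
    by (simp add: legendre_coeff_add bdd_meas_continuous continuous_on_row_coeff assms)
qed

lemma coeff_mat_scale:
  "coeff_mat (\<lambda>t s. c * f t s) k l = c * coeff_mat f k l"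
  unfolding coeff_mat_row row_coeff_def legendre_coeff_scale ..

lemma coeff_mat_zero: "coeff_mat (\<lambda>t s. 0) k l = 0"
  unfolding coeff_mat_row row_coeff_def legendre_coeff_def by simp

lemma coeff_mat_sum:
  assumes "finite A" "\<And>i. i \<in> A \<Longrightarrow> volterra (f i)"
  shows "coeff_mat (\<lambda>t s. \<Sum>i\<in>A. f i t s) k l = (\<Sum>i\<in>A. coeff_mat (f i) k l)"
  using assms
  by (induction A rule: finite_induct) (auto simp: coeff_mat_zero coeff_mat_add volterra_sum)

section \<open>Block matrices and square-summable sequences\<close>

definition square_summable :: "('i \<Rightarrow> complex) \<Rightarrow> bool" where
  "square_summable x \<longleftrightarrow> (\<lambda>i. (cmod (x i))\<^sup>2) summable_on UNIV"

lemma square_summable_nat: "square_summable (x :: nat \<Rightarrow> complex) \<longleftrightarrow> summable (\<lambda>i. (cmod (x i))\<^sup>2)"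
  unfolding square_summable_def by (rule summable_on_UNIV_nonneg_real_iff) simp

lemma square_summable_mult:
  assumes "square_summable x" "square_summable y"
  shows "(\<lambda>i. cmod (x i * y i)) summable_on UNIV"
  by (rule Infinite_Sum.abs_summable_product)
    (use assms in \<open>auto simp: square_summable_def norm_mult power2_eq_square\<close>)

lemma square_summable_mult_suminf:
  fixes x y :: "nat \<Rightarrow> complex"
  assumes "square_summable x" "square_summable y"
  shows "summable (\<lambda>i. x i * y i)"
  by (rule summable_on_imp_summable[OF abs_summable_summable[OF square_summable_mult[OF assms]]])

lemma square_summable_add:
  assumes "square_summable x" "square_summable y"
  shows "square_summable (\<lambda>i. x i + y i)"
  unfolding square_summable_def
proof (rule summable_on_comparison_test)
  show "(\<lambda>i. 2 * (cmod (x i))\<^sup>2 + 2 * (cmod (y i))\<^sup>2) summable_on UNIV"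
    using assms unfolding square_summable_def by (intro summable_on_add summable_on_cmult_right)
  fix i
  have "(cmod (x i + y i))\<^sup>2 \<le> (cmod (x i) + cmod (y i))\<^sup>2"
    by (intro power_mono norm_triangle_ineq) auto
  also have "\<dots> \<le> 2 * (cmod (x i))\<^sup>2 + 2 * (cmod (y i))\<^sup>2"
    using sum_squares_bound[of "cmod (x i)" "cmod (y i)"] by (simp add: power2_sum)
  finally show "(cmod (x i + y i))\<^sup>2 \<le> 2 * (cmod (x i))\<^sup>2 + 2 * (cmod (y i))\<^sup>2" .
qed auto

lemma square_summable_unit: "square_summable (\<lambda>i. if i = j then c else 0)"
  unfolding square_summable_def
  by (subst summable_on_cong_neutral[where T="{j}" and g="\<lambda>i. (cmod c)\<^sup>2"]) auto

lemma square_summable_unit_add: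
  assumes "square_summable x"
  shows "square_summable (\<lambda>i. (if i = j then c else 0) + x i)"
  by (rule square_summable_add[OF square_summable_unit assms])

lemma square_summable_blocks:
  fixes x :: "'n::finite \<Rightarrow> nat \<Rightarrow> complex"
  assumes "\<And>q. square_summable (x q)"
  shows "square_summable (\<lambda>(q, m). x q m)"
proof -
  have "(\<lambda>p. (cmod (case p of (q, m) \<Rightarrow> x q m))\<^sup>2) summable_on Sigma UNIV (\<lambda>_. UNIV)"
    by (rule summable_on_SigmaI[where g="\<lambda>q. \<Sum>\<^sub>\<infinity>m. (cmod (x q m))\<^sup>2"])
      (use assms in \<open>auto simp: square_summable_def\<close>)
  then show ?thesis by (simp add: square_summable_def)
qed

lemma hilbert_schmidt_row: "hilbert_schmidt X \<Longrightarrow> square_summable (X i)"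
  using summable_on_SigmaD1[of "\<lambda>i j. (cmod (X i j))\<^sup>2" UNIV "\<lambda>_. UNIV" i]
  by (auto simp: hilbert_schmidt_def square_summable_def)

lemma hilbert_schmidt_col:
  assumes "hilbert_schmidt X" shows "square_summable (\<lambda>i. X i j)"
proof -
  have "(\<lambda>(j, i). (cmod (X i j))\<^sup>2) summable_on UNIV \<times> UNIV"
    by (subst summable_on_swap) (use assms in \<open>simp add: hilbert_schmidt_def\<close>)
  then show ?thesis
    using summable_on_SigmaD1[of "\<lambda>j i. (cmod (X i j))\<^sup>2" UNIV "\<lambda>_. UNIV" j]
    by (auto simp: square_summable_def)
qed

lemma hilbert_schmidt_row_norms:
  assumes "hilbert_schmidt X"
  shows "summable (\<lambda>i. \<Sum>j. (cmod (X i j))\<^sup>2)"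
proof -
  have "(\<lambda>i. infsum (\<lambda>j. (cmod (X i j))\<^sup>2) UNIV) summable_on UNIV"
    by (rule summable_on_Sigma_banach) (use assms in \<open>simp add: hilbert_schmidt_def\<close>)
  moreover have "infsum (\<lambda>j. (cmod (X i j))\<^sup>2) UNIV = (\<Sum>j. (cmod (X i j))\<^sup>2)" for i
    using hilbert_schmidt_row[OF assms, of i] unfolding square_summable_def
    by (intro sums_unique has_sum_imp_sums has_sum_infsum)
  ultimately show ?thesis by (simp add: summable_on_imp_summable)
qed

lemma cauchy_schwarz_suminf:
  fixes x y :: "nat \<Rightarrow> complex"
  assumes "square_summable x" "square_summable y"
  shows "(cmod (\<Sum>i. x i * y i))\<^sup>2 \<le> (\<Sum>i. (cmod (x i))\<^sup>2) * (\<Sum>i. (cmod (y i))\<^sup>2)"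
proof -
  have s: "summable (\<lambda>i. (cmod (x i))\<^sup>2)" "summable (\<lambda>i. (cmod (y i))\<^sup>2)"
    using assms by (simp_all add: square_summable_nat)
  define X Y where "X = (\<Sum>i. (cmod (x i))\<^sup>2)" and "Y = (\<Sum>i. (cmod (y i))\<^sup>2)"
  have nn: "X \<ge> 0" "Y \<ge> 0" unfolding X_def Y_def using s by (auto intro: suminf_nonneg)
  have fin: "cmod (\<Sum>i<n. x i * y i) \<le> sqrt X * sqrt Y" for n
    by (rule order_trans[OF norm_sum], rule sum_norm_mult_le)
      (use nn s in \<open>auto simp: X_def Y_def intro!: sum_le_suminf\<close>)
  have "(\<lambda>n. cmod (\<Sum>i<n. x i * y i)) \<longlonglongrightarrow> cmod (\<Sum>i. x i * y i)"
    by (intro tendsto_norm summable_LIMSEQ square_summable_mult_suminf assms)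
  then have "cmod (\<Sum>i. x i * y i) \<le> sqrt X * sqrt Y"
    by (rule LIMSEQ_le_const2) (use fin in auto)
  then have "(cmod (\<Sum>i. x i * y i))\<^sup>2 \<le> (sqrt X * sqrt Y)\<^sup>2"
    by (rule power_mono) simp
  then show ?thesis using nn unfolding X_def[symmetric] Y_def[symmetric] by (simp add: power_mult_distrib)
qed

definition block_rows_l2 :: "('n::finite) blockmat \<Rightarrow> bool" where
  "block_rows_l2 X \<longleftrightarrow> (\<forall>k q i. square_summable (X k q i))"

definition block_cols_l2 :: "('n::finite) blockmat \<Rightarrow> bool" where
  "block_cols_l2 X \<longleftrightarrow> (\<forall>q l j. square_summable (\<lambda>m. X q l m j))"

definition block_hs :: "('n::finite) blockmat \<Rightarrow> bool" where
  "block_hs X \<longleftrightarrow> (\<forall>k l. hilbert_schmidt (X k l))"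

lemma block_hs_rows: "block_hs X \<Longrightarrow> block_rows_l2 X"
  by (simp add: block_hs_def block_rows_l2_def hilbert_schmidt_row)

lemma block_hs_cols: "block_hs X \<Longrightarrow> block_cols_l2 X"
  by (simp add: block_hs_def block_cols_l2_def hilbert_schmidt_col)

lemma block_one_apply: "block_one k l i j = (if k = l \<and> i = j then 1 else 0)"
  by (simp add: block_one_def block_diag_def)

lemma block_add_one_rows:
  assumes "block_rows_l2 X" shows "block_rows_l2 (block_add block_one X)"
proof -
  have "square_summable (\<lambda>j. (if j = i then if k = q then 1 else 0 else 0) + X k q i j)" for k q i
    using assms by (intro square_summable_unit_add) (simp add: block_rows_l2_def)
  moreover have "block_add block_one X k q i = (\<lambda>j. (if j = i then if k = q then 1 else 0 else 0) + X k q i j)" for k q i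
    by (auto simp: block_add_def block_one_apply fun_eq_iff)
  ultimately show ?thesis unfolding block_rows_l2_def by simp
qed

lemma block_add_one_cols:
  assumes "block_cols_l2 X" shows "block_cols_l2 (block_add block_one X)"
proof -
  have "square_summable (\<lambda>i. (if i = j then if k = q then 1 else 0 else 0) + X k q i j)" for k q j
    using assms by (intro square_summable_unit_add) (simp add: block_cols_l2_def)
  moreover have "(\<lambda>i. block_add block_one X k q i j) = (\<lambda>i. (if i = j then if k = q then 1 else 0 else 0) + X k q i j)" for k q j
    by (auto simp: block_add_def block_one_apply fun_eq_iff)
  ultimately show ?thesis unfolding block_cols_l2_def by simp
qed

lemma block_mult_conv_l2:
  assumes "block_rows_l2 X" "block_cols_l2 Y" shows "block_mult_conv X Y"
  using assms unfolding block_mult_conv_def block_rows_l2_def block_cols_l2_def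
  by (auto intro!: square_summable_mult_suminf)

text \<open>
  A block matrix is an ordinary matrix over the index set \<open>'n \<times> nat\<close>.  This removes the block structure
  from the sums that follow.
\<close>

lemma infsum_blocks:
  fixes F :: "'n::finite \<Rightarrow> nat \<Rightarrow> complex"
  assumes "(\<lambda>(q, m). F q m) summable_on UNIV"
  shows "(\<Sum>q\<in>UNIV. \<Sum>m. F q m) = infsum (\<lambda>(q, m). F q m) UNIV"
proof -
  have sm: "F q summable_on UNIV" for q
    using summable_on_SigmaD1[of F UNIV "\<lambda>_. UNIV" q] assms by simp
  have "(\<Sum>q\<in>UNIV. \<Sum>m. F q m) = (\<Sum>q\<in>UNIV. infsum (F q) UNIV)"
    by (intro sum.cong refl sums_unique[symmetric] has_sum_imp_sums has_sum_infsum sm)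
  also have "\<dots> = infsum (\<lambda>q. infsum (F q) UNIV) UNIV" by simp
  also have "\<dots> = infsum (\<lambda>(q, m). F q m) UNIV"
    using infsum_Sigma'_banach[of F UNIV "\<lambda>_. UNIV"] assms by simp
  finally show ?thesis .
qed

lemma block_mult_flat:
  assumes "(\<lambda>(q, m). X k q i m * Y q l m j) summable_on UNIV"
  shows "block_mult X Y k l i j = infsum (\<lambda>(q, m). X k q i m * Y q l m j) UNIV"
  unfolding block_mult_def inf_mult_def
  by (rule infsum_blocks[where F="\<lambda>q m. X k q i m * Y q l m j", OF assms])

lemma block_mult_flat_l2:
  assumes "block_rows_l2 X" "block_cols_l2 Y"
  shows "(\<lambda>(q, m). X k q i m * Y q l m j) summable_on UNIV"
proof -
  have "square_summable (\<lambda>(q, m). X k q i m)"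
    by (rule square_summable_blocks) (use assms in \<open>simp add: block_rows_l2_def\<close>)
  moreover have "square_summable (\<lambda>(q, m). Y q l m j)"
    by (rule square_summable_blocks) (use assms in \<open>simp add: block_cols_l2_def\<close>)
  ultimately have "(\<lambda>p. (\<lambda>(q, m). X k q i m) p * (\<lambda>(q, m). Y q l m j) p) summable_on UNIV"
    by (rule abs_summable_summable[OF square_summable_mult])
  then show ?thesis by (simp add: case_prod_unfold)
qed

text \<open>
  The double sequence \<open>u a * z b\<close> is square-summable, so the Cauchy-Schwarz inequality applies to its
  product with \<open>W\<close>.  The identity part contributes the product of \<open>u\<close> and \<open>z\<close> on the diagonal.
\<close>

lemma triple_product_summable:
  fixes u z :: "'i \<Rightarrow> complex" and W :: "'i \<Rightarrow> 'i \<Rightarrow> complex"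
  assumes u: "square_summable u" and z: "square_summable z"
    and W: "square_summable (\<lambda>(a, b). W a b)"
  shows "(\<lambda>(a, b). u a * ((if a = b then 1 else 0) + W a b) * z b) summable_on UNIV"
proof -
  have "(\<lambda>a. u a * z a) summable_on UNIV"
    by (rule abs_summable_summable[OF square_summable_mult[OF u z]])
  then have "((\<lambda>(a, b). if a = b then u a * z b else 0) \<circ> (\<lambda>a. (a, a))) summable_on UNIV"
    by (simp add: o_def)
  then have "(\<lambda>(a, b). if a = b then u a * z b else 0) summable_on range (\<lambda>a. (a, a))"
    by (subst summable_on_reindex) (auto intro: injI)
  then have 1: "(\<lambda>(a, b). if a = b then u a * z b else 0) summable_on UNIV"
    by (subst summable_on_cong_neutral[where T="range (\<lambda>a. (a, a))"]) auto
  have uz: "square_summable (\<lambda>(a, b). u a * z b)"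
  proof -
    have zs: "((\<lambda>b. (cmod (z b))\<^sup>2) has_sum (\<Sum>\<^sub>\<infinity>b. (cmod (z b))\<^sup>2)) UNIV"
      using z unfolding square_summable_def by (rule has_sum_infsum)
    have "(\<lambda>p. (cmod (case p of (a, b) \<Rightarrow> u a * z b))\<^sup>2) summable_on Sigma UNIV (\<lambda>_. UNIV)"
    proof (rule summable_on_SigmaI[where g="\<lambda>a. (cmod (u a))\<^sup>2 * (\<Sum>\<^sub>\<infinity>b. (cmod (z b))\<^sup>2)"])
      show "((\<lambda>y. (cmod (case (x, y) of (a, b) \<Rightarrow> u a * z b))\<^sup>2) has_sum (cmod (u x))\<^sup>2 * (\<Sum>\<^sub>\<infinity>b. (cmod (z b))\<^sup>2)) UNIV" for x
        using has_sum_cmult_right[OF zs, of "(cmod (u x))\<^sup>2"] by (simp add: norm_mult power_mult_distrib)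
      show "(\<lambda>a. (cmod (u a))\<^sup>2 * (\<Sum>\<^sub>\<infinity>b. (cmod (z b))\<^sup>2)) summable_on UNIV"
        using u unfolding square_summable_def by (rule summable_on_cmult_left)
    qed auto
    then show ?thesis by (simp add: square_summable_def)
  qed
  have "(\<lambda>p. (\<lambda>(a, b). u a * z b) p * (\<lambda>(a, b). W a b) p) summable_on UNIV"
    by (rule abs_summable_summable[OF square_summable_mult[OF uz W]])
  from summable_on_add[OF 1 this] show ?thesis
    by (rule summable_on_cong[THEN iffD1, rotated]) (auto simp: algebra_simps)
qed

lemma square_summable_flat_hs:
  assumes "block_hs H"
  shows "square_summable (\<lambda>((q :: 'n::finite, m), (r, n)). H q r m n)"
proof -
  have "(\<lambda>p. case p of ((q, r), (m, n)) \<Rightarrow> (cmod (H q r m n))\<^sup>2) summable_on Sigma UNIV (\<lambda>_. UNIV)"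
  proof (rule summable_on_SigmaI[where g="\<lambda>(q, r). \<Sum>\<^sub>\<infinity>(m, n). (cmod (H q r m n))\<^sup>2"])
    fix x :: "'n \<times> 'n"
    obtain q r where x: "x = (q, r)" by (cases x)
    have "(\<lambda>(m, n). (cmod (H q r m n))\<^sup>2) summable_on UNIV"
      using assms by (simp add: block_hs_def hilbert_schmidt_def)
    then show "((\<lambda>y. case (x, y) of ((q, r), (m, n)) \<Rightarrow> (cmod (H q r m n))\<^sup>2) has_sum
        (case x of (q, r) \<Rightarrow> \<Sum>\<^sub>\<infinity>(m, n). (cmod (H q r m n))\<^sup>2)) UNIV"
      unfolding x by (simp add: has_sum_infsum)
  qed auto
  then have "(\<lambda>((q, r), (m, n)). (cmod (H q r m n))\<^sup>2) summable_on UNIV"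
    by (simp add: case_prod_unfold)
  moreover have "bij_betw (\<lambda>((q, r), (m, n)). ((q :: 'n, m :: nat), (r :: 'n, n :: nat))) UNIV UNIV"
    by (rule bij_betw_byWitness[where f'="\<lambda>((q, m), (r, n)). ((q, r), (m, n))"]) auto
  ultimately have "(\<lambda>((q, m), (r, n)). (cmod (H q r m n))\<^sup>2) summable_on UNIV"
    by (subst summable_on_reindex_bij_betw[symmetric]) (auto simp: case_prod_unfold)
  then show ?thesis unfolding square_summable_def by (simp add: case_prod_unfold)
qed

text \<open>
  Only the middle factor has to be of the form identity plus Hilbert-Schmidt; for the outer ones it
  suffices that rows or columns are square-summable.  This weak condition on \<open>Z\<close> is used for the
  uniqueness of the inverse, where nothing else is known about a competitor.
\<close>

theorem block_mult_assoc:
  assumes X: "block_rows_l2 X" and H: "block_hs H" and Y: "Y = block_add block_one H" and Z: "block_cols_l2 Z"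
  shows "block_mult (block_mult X Y) Z = block_mult X (block_mult Y Z)"
    and "\<And>k l i j. (\<lambda>(r, n). block_mult X Y k r i n * Z r l n j) summable_on UNIV"
proof -
  have Yc: "block_cols_l2 Y" "block_rows_l2 Y"
    unfolding Y using H by (auto intro: block_add_one_cols block_hs_cols block_add_one_rows block_hs_rows)
  have main: "(\<lambda>(r, n). block_mult X Y k r i n * Z r l n j) summable_on UNIV \<and>
     block_mult (block_mult X Y) Z k l i j = block_mult X (block_mult Y Z) k l i j" for k l i j
  proof -
    define u where "u = (\<lambda>(q, m). X k q i m)"
    define z where "z = (\<lambda>(r, n). Z r l n j)"
    define W where "W = (\<lambda>(q, m) (r, n). H q r m n)"
    define V where "V a b = (if a = b then 1 else 0) + W a b" for a b
    have V: "V (q, m) (r, n) = Y q r m n" for q m r n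
      by (simp add: V_def W_def Y block_add_def block_one_apply)
    have u: "square_summable u" unfolding u_def using X by (intro square_summable_blocks) (simp add: block_rows_l2_def)
    have z: "square_summable z" unfolding z_def using Z by (intro square_summable_blocks) (simp add: block_cols_l2_def)
    have W: "square_summable (\<lambda>(a, b). W a b)"
      using square_summable_flat_hs[OF H] unfolding W_def by (simp add: case_prod_unfold)
    have S: "(\<lambda>(a, b). u a * V a b * z b) summable_on UNIV \<times> UNIV"
      using triple_product_summable[OF u z W] unfolding V_def by simp
    then have S': "(\<lambda>(b, a). u a * V a b * z b) summable_on UNIV \<times> UNIV"
      by (subst summable_on_swap) simp
    have XY: "block_mult X Y k r i n = (\<Sum>\<^sub>\<infinity>a. u a * V a (r, n))" for r n
      unfolding block_mult_flat[OF block_mult_flat_l2[OF X Yc(1)]]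
      by (rule infsum_cong) (auto simp: u_def V)
    have YZ: "block_mult Y Z q l m j = (\<Sum>\<^sub>\<infinity>b. V (q, m) b * z b)" for q m
      unfolding block_mult_flat[OF block_mult_flat_l2[OF Yc(2) Z]]
      by (rule infsum_cong) (auto simp: z_def V)
    have sL: "(\<lambda>b. (\<Sum>\<^sub>\<infinity>a. u a * V a b) * z b) summable_on UNIV"
      using summable_on_Sigma_banach[OF S'] by (simp only: infsum_cmult_left')
    have sR: "(\<lambda>a. u a * (\<Sum>\<^sub>\<infinity>b. V a b * z b)) summable_on UNIV"
      using summable_on_Sigma_banach[OF S] by (simp only: infsum_cmult_right' mult.assoc)
    have sL': "(\<lambda>(r, n). block_mult X Y k r i n * Z r l n j) summable_on UNIV"
      using sL by (rule summable_on_cong[THEN iffD1, rotated]) (auto simp: XY z_def)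
    have sR': "(\<lambda>(q, m). X k q i m * block_mult Y Z q l m j) summable_on UNIV"
      using sR by (rule summable_on_cong[THEN iffD1, rotated]) (auto simp: YZ u_def)
    have "block_mult (block_mult X Y) Z k l i j = (\<Sum>\<^sub>\<infinity>b. (\<Sum>\<^sub>\<infinity>a. u a * V a b) * z b)"
      unfolding block_mult_flat[of "block_mult X Y" k i Z l j, OF sL'] by (rule infsum_cong) (auto simp: XY z_def)
    also have "\<dots> = (\<Sum>\<^sub>\<infinity>b. \<Sum>\<^sub>\<infinity>a. u a * V a b * z b)"
      by (simp only: infsum_cmult_left')
    also have "\<dots> = (\<Sum>\<^sub>\<infinity>a. \<Sum>\<^sub>\<infinity>b. u a * V a b * z b)"
      by (rule infsum_swap_banach[OF S'])
    also have "\<dots> = (\<Sum>\<^sub>\<infinity>a. u a * (\<Sum>\<^sub>\<infinity>b. V a b * z b))"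
      by (simp only: infsum_cmult_right' mult.assoc)
    also have "\<dots> = block_mult X (block_mult Y Z) k l i j"
      unfolding block_mult_flat[of X k i "block_mult Y Z" l j, OF sR'] by (rule infsum_cong) (auto simp: YZ u_def)
    finally show ?thesis by (rule conjI[OF sL'])
  qed
  show "block_mult (block_mult X Y) Z = block_mult X (block_mult Y Z)"
    by (intro ext) (rule main[THEN conjunct2])
  show "(\<lambda>(r, n). block_mult X Y k r i n * Z r l n j) summable_on UNIV" for k l i j
    by (rule main[THEN conjunct1])
qed

lemma block_mult_one_left: "block_mult block_one Y = Y"
proof (intro ext)
  fix k l :: 'a and i j :: nat
  have "inf_mult (block_one k q) (Y q l) i j = (if k = q then Y q l i j else 0)" for q
  proof -
    have "inf_mult (block_one k q) (Y q l) i j = (\<Sum>m\<in>{i}. block_one k q i m * Y q l m j)"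
      unfolding inf_mult_def by (rule suminf_finite) (auto simp: block_one_apply)
    then show ?thesis by (simp add: block_one_apply)
  qed
  then show "block_mult block_one Y k l i j = Y k l i j" by (simp add: block_mult_def)
qed

lemma block_mult_one_right: "block_mult Y block_one = Y"
proof (intro ext)
  fix k l :: 'a and i j :: nat
  have "inf_mult (Y k q) (block_one q l) i j = (if l = q then Y k q i j else 0)" for q
  proof -
    have "inf_mult (Y k q) (block_one q l) i j = (\<Sum>m\<in>{j}. Y k q i m * block_one q l m j)"
      unfolding inf_mult_def by (rule suminf_finite) (auto simp: block_one_apply)
    then show ?thesis by (auto simp: block_one_apply)
  qed
  then show "block_mult Y block_one k l i j = Y k l i j" by (simp add: block_mult_def)
qed

lemma block_mult_add_left:
  assumes "block_mult_conv X Z" "block_mult_conv Y Z"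
  shows "block_mult (block_add X Y) Z = block_add (block_mult X Z) (block_mult Y Z)"
proof -
  have "inf_mult (\<lambda>i j. X k q i j + Y k q i j) (Z q l) i j = inf_mult (X k q) (Z q l) i j + inf_mult (Y k q) (Z q l) i j" for k q l i j
    using suminf_add[of "\<lambda>m. X k q i m * Z q l m j" "\<lambda>m. Y k q i m * Z q l m j"] assms
    by (simp add: inf_mult_def block_mult_conv_def distrib_right)
  then show ?thesis by (simp add: block_mult_def block_add_def sum.distrib)
qed

lemma block_mult_add_right:
  assumes "block_mult_conv X Y" "block_mult_conv X Z"
  shows "block_mult X (block_add Y Z) = block_add (block_mult X Y) (block_mult X Z)"
proof -
  have "inf_mult (X k q) (\<lambda>i j. Y q l i j + Z q l i j) i j = inf_mult (X k q) (Y q l) i j + inf_mult (X k q) (Z q l) i j" for k q l i j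
    using suminf_add[of "\<lambda>m. X k q i m * Y q l m j" "\<lambda>m. X k q i m * Z q l m j"] assms
    by (simp add: inf_mult_def block_mult_conv_def distrib_left)
  then show ?thesis by (simp add: block_mult_def block_add_def sum.distrib)
qed

lemma block_one_rows: "block_rows_l2 block_one"
  unfolding block_rows_l2_def
proof (intro allI)
  fix k q :: 'a and i :: nat
  show "square_summable (block_one k q i)"
    using square_summable_unit[of i "if k = q then 1 else 0"]
    by (rule back_subst[of square_summable]) (auto simp: block_one_apply fun_eq_iff)
qed

lemma block_one_cols: "block_cols_l2 block_one"
  unfolding block_cols_l2_def
proof (intro allI)
  fix k q :: 'a and i :: nat
  show "square_summable (\<lambda>m. block_one k q m i)"
    using square_summable_unit[of i "if k = q then 1 else 0"]
    by (rule back_subst[of square_summable]) (auto simp: block_one_apply fun_eq_iff)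
qed

lemma l2_operator_one_plus_hs:
  assumes H: "hilbert_schmidt H"
  shows "l2_operator (\<lambda>i j. (if c \<and> i = j then 1 else 0) + H i j)"
  unfolding l2_operator_def
proof (intro allI impI conjI)
  fix x :: "nat \<Rightarrow> complex" assume x': "summable (\<lambda>j. (cmod (x j))\<^sup>2)"
  then have x: "square_summable x" by (simp add: square_summable_nat)
  have d: "(\<lambda>j. (if c \<and> i = j then 1 else 0) * x j) sums (if c then x i else 0)" for i
    using sums_finite[of "{i}" "\<lambda>j. (if c \<and> i = j then 1 else 0) * x j"] by auto
  have h: "summable (\<lambda>j. H i j * x j)" for i
    by (rule square_summable_mult_suminf[OF hilbert_schmidt_row[OF H] x])
  have s: "(\<lambda>j. ((if c \<and> i = j then 1 else 0) + H i j) * x j) sums ((if c then x i else 0) + (\<Sum>j. H i j * x j))" for i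
    using sums_add[OF d[of i] summable_sums[OF h[of i]]] by (simp add: distrib_right)
  show "summable (\<lambda>j. ((if c \<and> i = j then 1 else 0) + H i j) * x j)" for i
    using s by (rule sums_summable)
  have "square_summable (\<lambda>i. (if c then x i else 0) + (\<Sum>j. H i j * x j))"
  proof (rule square_summable_add)
    show "square_summable (\<lambda>i. if c then x i else 0)"
      using x by (cases c) (auto simp: square_summable_nat)
    show "square_summable (\<lambda>i. \<Sum>j. H i j * x j)"
      unfolding square_summable_nat
    proof (rule summable_comparison_test')
      show "summable (\<lambda>i. (\<Sum>j. (cmod (H i j))\<^sup>2) * (\<Sum>j. (cmod (x j))\<^sup>2))"
        by (intro summable_mult2 hilbert_schmidt_row_norms H)
      show "norm ((cmod (\<Sum>j. H i j * x j))\<^sup>2) \<le> (\<Sum>j. (cmod (H i j))\<^sup>2) * (\<Sum>j. (cmod (x j))\<^sup>2)" for i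
        using cauchy_schwarz_suminf[OF hilbert_schmidt_row[OF H] x] by simp
    qed
  qed
  then show "summable (\<lambda>i. (cmod (\<Sum>j. ((if c \<and> i = j then 1 else 0) + H i j) * x j))\<^sup>2)"
    unfolding square_summable_nat using s[THEN sums_unique] by simp
qed

text \<open>
  Apply the operator to a unit vector.
\<close>

lemma l2_operator_col:
  assumes "l2_operator X" shows "square_summable (\<lambda>i. X i j)"
proof -
  have "(\<Sum>m. X i m * (if m = j then 1 else 0)) = X i j" for i
    using suminf_finite[of "{j}" "\<lambda>m. X i m * (if m = j then 1 else 0)"] by auto
  note eq = this
  have "summable (\<lambda>m. (cmod (if m = j then 1 else 0 :: complex))\<^sup>2)"
    using square_summable_unit[of j 1] by (simp only: square_summable_nat)
  then have "summable (\<lambda>i. (cmod (\<Sum>m. X i m * (if m = j then 1 else 0)))\<^sup>2)"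
    using assms[unfolded l2_operator_def, THEN spec[of _ "\<lambda>m. if m = j then 1 else 0"]] by fast
  then show ?thesis unfolding eq square_summable_nat .
qed

text \<open>
  For any other inverse \<open>Y\<close>, \<open>Y = (Z X) Y = Z (X Y) = Z\<close>.  The rows of the known inverse \<open>Z\<close> and the
  columns of \<open>Y\<close> are square-summable, which justifies the associative law.
\<close>

theorem block_inverse_eqI:
  assumes X: "X = block_add block_one H" "block_hs H" and Z: "is_block_inverse X Z" "block_rows_l2 Z"
  shows "block_inverse X = Z"
  unfolding block_inverse_def
proof (rule the_equality)
  fix Y assume Y: "is_block_inverse X Y"
  then have "block_cols_l2 Y"
    unfolding is_block_inverse_def block_cols_l2_def using l2_operator_col by blast
  then have "block_mult (block_mult Z X) Y = block_mult Z (block_mult X Y)"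
    by (rule block_mult_assoc(1)[OF Z(2) X(2,1)])
  then show "Y = Z"
    using Y Z(1) by (simp add: is_block_inverse_def block_mult_one_left block_mult_one_right)
qed (rule Z(1))

section \<open>The Neumann series\<close>

definition mvolterra :: "('n::finite) mkernel \<Rightarrow> bool" where
  "mvolterra F \<longleftrightarrow> (\<forall>k l. volterra (entry F k l))"

lemma mvolterraD: "mvolterra F \<Longrightarrow> volterra (entry F k l)"
  by (simp add: mvolterra_def)

lemma entry_mstar: "entry (mstar F G) k l = (\<lambda>t s. \<Sum>j\<in>UNIV. star (entry F k j) (entry G j l) t s)"
  by (simp add: entry_def mstar_def)

lemma mvolterra_mstar: "mvolterra F \<Longrightarrow> mvolterra G \<Longrightarrow> mvolterra (mstar F G)"
  unfolding mvolterra_def entry_mstar by (intro allI volterra_sum volterra_star) auto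

lemma entry_add: "entry (\<lambda>t s. F t s + G t s) k l = (\<lambda>t s. entry F k l t s + entry G k l t s)"
  by (simp add: entry_def)

lemma mvolterra_add: "mvolterra F \<Longrightarrow> mvolterra G \<Longrightarrow> mvolterra (\<lambda>t s. F t s + G t s)"
  unfolding mvolterra_def entry_add by (intro allI volterra_add) auto

lemma block_coeff_mat_mstar:
  assumes "mvolterra F" "mvolterra G"
  shows "block_coeff_mat (mstar F G) = block_mult (block_coeff_mat F) (block_coeff_mat G)"
proof (intro ext)
  fix k l :: 'a and i j
  have "coeff_mat (entry (mstar F G) k l) i j = (\<Sum>q\<in>UNIV. coeff_mat (star (entry F k q) (entry G q l)) i j)"
    unfolding entry_mstar by (rule coeff_mat_sum) (use assms in \<open>auto intro: mvolterraD\<close>)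
  also have "\<dots> = (\<Sum>q\<in>UNIV. inf_mult (coeff_mat (entry F k q)) (coeff_mat (entry G q l)) i j)"
    unfolding inf_mult_def
    by (intro sum.cong refl sums_unique coeff_mat_star mvolterraD assms)
  finally show "block_coeff_mat (mstar F G) k l i j = block_mult (block_coeff_mat F) (block_coeff_mat G) k l i j"
    by (simp add: block_coeff_mat_def block_mult_def)
qed

lemma block_coeff_mat_add:
  assumes "mvolterra F" "mvolterra G"
  shows "block_coeff_mat (\<lambda>t s. F t s + G t s) = block_add (block_coeff_mat F) (block_coeff_mat G)"
  unfolding block_coeff_mat_def entry_add block_add_def
  using assms by (simp add: fun_eq_iff coeff_mat_add mvolterraD)

lemma block_coeff_mat_cong:
  assumes "\<And>t s. 0 \<le> t \<Longrightarrow> t \<le> 1 \<Longrightarrow> 0 \<le> s \<Longrightarrow> s \<le> 1 \<Longrightarrow> F t s = G t s"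
  shows "block_coeff_mat F = block_coeff_mat G"
  unfolding block_coeff_mat_def
  by (intro ext, rule fun_cong[OF fun_cong[OF coeff_mat_cong]]) (use assms in \<open>simp add: entry_def\<close>)

lemma block_hs_coeff: "mvolterra F \<Longrightarrow> block_hs (block_coeff_mat F)"
  by (simp add: block_hs_def block_coeff_mat_def hilbert_schmidt_coeff_mat mvolterraD)

lemma star_cong:
  assumes "\<And>x. 0 \<le> x \<Longrightarrow> x \<le> 1 \<Longrightarrow> f t x = f' t x" "\<And>x. 0 \<le> x \<Longrightarrow> x \<le> 1 \<Longrightarrow> g x s = g' x s"
  shows "star f g t s = star f' g' t s"
  unfolding star_eq by (rule integral_lunit_cong) (use assms in auto)

lemma volterra_bdd_meas_star:
  assumes "volterra f" "volterra g" "t \<in> {0..1}" "s \<in> {0..1}"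
  shows "bdd_meas (\<lambda>x. f t x * g x s)"
  by (rule bdd_meas_mult[OF volterra_bdd_meas_row volterra_bdd_meas_col]) (use assms in auto)

lemma star_sum_left:
  assumes "\<And>i. i \<in> A \<Longrightarrow> volterra (f i)" "volterra g" and ts: "t \<in> {0..1}" "s \<in> {0..1}"
  shows "star (\<lambda>t s. \<Sum>i\<in>A. f i t s) g t s = (\<Sum>i\<in>A. star (f i) g t s)"
  unfolding star_eq sum_distrib_right
  by (rule Bochner_Integration.integral_sum)
    (rule bdd_meas_integrable[OF volterra_bdd_meas_star], use assms in auto)

lemma star_sum_right:
  assumes "volterra f" "\<And>i. i \<in> A \<Longrightarrow> volterra (g i)" and ts: "t \<in> {0..1}" "s \<in> {0..1}"
  shows "star f (\<lambda>t s. \<Sum>i\<in>A. g i t s) t s = (\<Sum>i\<in>A. star f (g i) t s)"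
  unfolding star_eq sum_distrib_left
  by (rule Bochner_Integration.integral_sum)
    (rule bdd_meas_integrable[OF volterra_bdd_meas_star], use assms in auto)

lemma mstar_assoc:
  assumes F: "mvolterra F" and G: "mvolterra G" and H: "mvolterra H" and ts: "t \<in> {0..1}" "s \<in> {0..1}"
  shows "mstar (mstar F G) H t s = mstar F (mstar G H) t s"
proof -
  note v = mvolterraD[OF F] mvolterraD[OF G] mvolterraD[OF H]
  have "(\<Sum>j\<in>UNIV. star (entry (mstar F G) k j) (entry H j l) t s) =
      (\<Sum>j\<in>UNIV. star (entry F k j) (entry (mstar G H) j l) t s)" for k l
  proof -
    have "(\<Sum>j\<in>UNIV. star (entry (mstar F G) k j) (entry H j l) t s) =
       (\<Sum>j\<in>UNIV. \<Sum>i\<in>UNIV. star (star (entry F k i) (entry G i j)) (entry H j l) t s)"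
      unfolding entry_mstar by (intro sum.cong refl star_sum_left volterra_star v ts)
    also have "\<dots> = (\<Sum>j\<in>UNIV. \<Sum>i\<in>UNIV. star (entry F k i) (star (entry G i j) (entry H j l)) t s)"
      using ts by (intro sum.cong refl star_assoc v) auto
    also have "\<dots> = (\<Sum>i\<in>UNIV. \<Sum>j\<in>UNIV. star (entry F k i) (star (entry G i j) (entry H j l)) t s)"
      by (rule sum.swap)
    also have "\<dots> = (\<Sum>j\<in>UNIV. star (entry F k j) (entry (mstar G H) j l) t s)"
      unfolding entry_mstar by (intro sum.cong refl star_sum_right[symmetric] volterra_star v ts)
    finally show ?thesis .
  qed
  then show ?thesis unfolding mstar_def[of "mstar F G"] mstar_def[of F "mstar G H"] by (simp add: vec_eq_iff)
qed

lemma mstar_cong: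
  assumes "\<And>x. x \<in> {0..1} \<Longrightarrow> F t x = F' t x" "\<And>x. x \<in> {0..1} \<Longrightarrow> G x s = G' x s"
  shows "mstar F G t s = mstar F' G' t s"
  unfolding mstar_def vec_eq_iff
  by (auto intro!: sum.cong star_cong simp: entry_def assms)

lemma mvolterra_star_pow: "mvolterra A \<Longrightarrow> mvolterra (star_pow_Suc A m)"
  by (induction m) (auto intro: mvolterra_mstar)

lemma star_pow_commute:
  assumes A: "mvolterra A" and ts: "t \<in> {0..1}" "s \<in> {0..1}"
  shows "mstar (star_pow_Suc A m) A t s = star_pow_Suc A (Suc m) t s"
  using ts
proof (induction m arbitrary: t s)
  case (Suc m)
  have "mstar (star_pow_Suc A (Suc m)) A t s = mstar A (mstar (star_pow_Suc A m) A) t s"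
    using mstar_assoc[OF A mvolterra_star_pow[OF A] A Suc.prems] by simp
  also have "\<dots> = mstar A (star_pow_Suc A (Suc m)) t s"
    by (rule mstar_cong) (use Suc in auto)
  finally show ?case by simp
qed simp

text \<open>
  In the norm with weight \<open>e\<^bsup>-Lt\<^esup>\<close>, star-multiplication by \<open>A\<close> has norm at most \<open>a N / L\<close>, where \<open>N\<close> is
  the size of the matrices.
\<close>

lemma star_pow_bound:
  fixes A :: "('n::finite) mkernel"
  assumes A: "mvolterra A" and a: "a \<ge> 0"
    "\<And>k l t s. t \<in> {0..1} \<Longrightarrow> s \<in> {0..1} \<Longrightarrow> cmod (entry A k l t s) \<le> a"
    and ts: "t \<in> {0..1}" "s \<in> {0..1}"
  shows "cmod (entry (star_pow_Suc A m) k l t s) \<le> a * (1/2)^m * exp ((2 * a * real CARD('n) + 1) * t)"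
  using ts
proof (induction m arbitrary: k l t s)
  case 0
  have "a * 1 \<le> a * exp ((2 * a * real CARD('n) + 1) * t)"
    using 0 a by (intro mult_left_mono) auto
  then show ?case using a(2)[OF 0, of k l] by simp
next
  case (Suc m)
  \<comment> \<open>This choice gives \<open>a N / L \<le> 1/2\<close>; the summand 1 keeps \<open>L\<close> positive for \<open>a = 0\<close>.\<close>
  define L where "L = 2 * a * real CARD('n) + 1"
  have L: "L > 0" unfolding L_def using a by (simp add: add_nonneg_pos)
  have ent: "cmod (star (entry A k j) (entry (star_pow_Suc A m) j l) t s) \<le> a * (a * (1/2)^m) * (exp (L * t) / L)" for j
  proof -
    have E: "bdd_meas (\<lambda>x. indicator {0..t} x *\<^sub>R (a * (a * (1/2)^m) * exp (L * x)))"
    proof (rule bdd_measI[where K="a * (a * (1/2)^m) * exp L"])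
      show "(\<lambda>x. indicator {0..t} x *\<^sub>R (a * (a * (1/2)^m) * exp (L * x))) \<in> borel_measurable lunit"
      proof -
        have "(\<lambda>x. indicator {0..t} x *\<^sub>R (a * (a * (1/2)^m) * exp (L * x))) \<in> borel_measurable lborel"
          by measurable
        then show ?thesis by (rule measurable_restrict_space1)
      qed
      show "norm (indicator {0..t} x *\<^sub>R (a * (a * (1/2)^m) * exp (L * x))) \<le> a * (a * (1/2)^m) * exp L"
        if "0 \<le> x" "x \<le> 1" for x
        using that L a by (auto simp: indicator_def abs_mult intro!: mult_left_mono)
    qed
    have "norm (\<integral>x. entry A k j t x * entry (star_pow_Suc A m) j l x s \<partial>lunit) \<le>
        (\<integral>x. indicator {0..t} x *\<^sub>R (a * (a * (1/2)^m) * exp (L * x)) \<partial>lunit)"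
    proof (rule Bochner_Integration.integral_norm_bound_integral)
      show "integrable lunit (\<lambda>x. entry A k j t x * entry (star_pow_Suc A m) j l x s)"
        by (rule bdd_meas_integrable[OF volterra_bdd_meas_star[OF mvolterraD[OF A] mvolterraD[OF mvolterra_star_pow[OF A]] Suc.prems]])
      show "integrable lunit (\<lambda>x. indicator {0..t} x *\<^sub>R (a * (a * (1/2)^m) * exp (L * x)))"
        by (rule bdd_meas_integrable[OF E])
      fix x assume "x \<in> space lunit"
      then have x: "x \<in> {0..1}" by simp
      show "norm (entry A k j t x * entry (star_pow_Suc A m) j l x s) \<le> indicator {0..t} x *\<^sub>R (a * (a * (1/2)^m) * exp (L * x))"
      proof (cases "x \<le> t")
        case True
        have "norm (entry A k j t x * entry (star_pow_Suc A m) j l x s) \<le> a * (a * (1/2)^m * exp (L * x))"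
          unfolding norm_mult L_def using a x Suc.prems Suc.IH by (intro mult_mono) auto
        then show ?thesis using True x by (simp add: mult.assoc)
      next
        case False
        then show ?thesis using volterra_zero[OF mvolterraD[OF A], of t x k j] by simp
      qed
    qed
    also have "\<dots> = a * (a * (1/2)^m) * exp (L * t) / L - a * (a * (1/2)^m) * exp (L * 0) / L"
    proof (rule integral_lunit_FTC)
      show "((\<lambda>x. a * (a * (1/2)^m) * exp (L * x) / L) has_vector_derivative a * (a * (1/2)^m) * exp (L * x)) (at x within {0..t})" for x
        unfolding has_real_derivative_iff_has_vector_derivative[symmetric]
        using L by (auto intro!: derivative_eq_intros)
    qed (use Suc.prems in \<open>auto intro!: continuous_intros\<close>)
    also have "\<dots> \<le> a * (a * (1/2)^m) * (exp (L * t) / L)" using L a by simp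
    finally show ?thesis unfolding star_eq .
  qed
  have "cmod (entry (star_pow_Suc A (Suc m)) k l t s) \<le> (\<Sum>j\<in>UNIV. cmod (star (entry A k j) (entry (star_pow_Suc A m) j l) t s))"
    by (simp add: entry_mstar norm_sum)
  also have "\<dots> \<le> (\<Sum>j\<in>(UNIV::'n set). a * (a * (1/2)^m) * (exp (L * t) / L))" by (intro sum_mono ent)
  also have "\<dots> = (a * (1/2)^m * exp (L * t)) * (a * real CARD('n) / L)" by simp
  also have "\<dots> \<le> (a * (1/2)^m * exp (L * t)) * (1 / 2)"
    using L a by (intro mult_left_mono) (auto simp: L_def field_simps)
  finally show ?case unfolding L_def by (simp add: mult_ac)
qed

lemma suminf_entry:
  fixes X :: "nat \<Rightarrow> complex^'n^'n"
  assumes "summable X" shows "(\<Sum>m. X m) $ k $ l = (\<Sum>m. X m $ k $ l)"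
proof -
  have "bounded_linear (\<lambda>Y :: complex^'n^'n. Y $ k $ l)"
    by (rule bounded_linear_compose[where f="\<lambda>v. v $ l" and g="\<lambda>Y. Y $ k",
      OF bounded_linear_vec_nth bounded_linear_vec_nth])
  from bounded_linear.suminf[OF this assms] show ?thesis .
qed

lemma norm_matrix_le_sum: "norm (X :: complex^'n^'n) \<le> (\<Sum>k\<in>UNIV. \<Sum>l\<in>UNIV. cmod (X $ k $ l))"
proof -
  have "norm X \<le> (\<Sum>k\<in>UNIV. norm (X $ k))" unfolding norm_vec_def by (rule L2_set_le_sum) simp
  also have "\<dots> \<le> (\<Sum>k\<in>UNIV. \<Sum>l\<in>UNIV. cmod (X $ k $ l))"
    unfolding norm_vec_def by (intro sum_mono L2_set_le_sum) simp
  finally show ?thesis .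
qed

lemma mvolterra_bound:
  assumes "mvolterra (A :: ('n::finite) mkernel)"
  shows "\<exists>a\<ge>0. \<forall>k l. \<forall>t\<in>{0..1}. \<forall>s\<in>{0..1}. cmod (entry A k l t s) \<le> a"
proof -
  have "\<forall>k l. \<exists>K\<ge>0. \<forall>t\<in>{0..1}. \<forall>s\<in>{0..1}. cmod (entry A k l t s) \<le> K"
    using volterra_bound[OF mvolterraD[OF assms]] by blast
  then obtain K where K: "\<And>k l. K k l \<ge> 0" "\<And>k l t s. t \<in> {0..1} \<Longrightarrow> s \<in> {0..1} \<Longrightarrow> cmod (entry A k l t s) \<le> K k l"
    by metis
  have le: "K k l \<le> (\<Sum>k\<in>UNIV. \<Sum>l\<in>UNIV. K k l)" for k l
  proof -
    have "K k l \<le> (\<Sum>l\<in>UNIV. K k l)" by (rule member_le_sum) (auto simp: K)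
    also have "\<dots> \<le> (\<Sum>k\<in>UNIV. \<Sum>l\<in>UNIV. K k l)"
      by (rule member_le_sum[of k UNIV "\<lambda>k. \<Sum>l\<in>UNIV. K k l"]) (auto simp: K intro: sum_nonneg)
    finally show ?thesis .
  qed
  show ?thesis
    by (intro exI[of _ "\<Sum>k\<in>UNIV. \<Sum>l\<in>UNIV. K k l"] conjI allI ballI sum_nonneg K(1) order_trans[OF K(2) le])
qed

lemma star_sums:
  assumes v: "\<And>m. volterra (f m)" "\<And>m. volterra (g m)" and ts: "t \<in> {0..1}" "s \<in> {0..1}"
    and M: "\<And>m x. x \<in> {0..1} \<Longrightarrow> cmod (f m t x * g m x s) \<le> M m" "summable M"
    and FG: "\<And>x. x \<in> {0..1} \<Longrightarrow> (\<lambda>m. f m t x * g m x s) sums (F t x * G x s)"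
  shows "(\<lambda>m. star (f m) (g m) t s) sums star F G t s"
proof -
  have b: "bdd_meas (\<lambda>x. f m t x * g m x s)" for m by (rule volterra_bdd_meas_star[OF v ts])
  have "(\<lambda>m. \<integral>x. f m t x * g m x s \<partial>lunit) sums (\<integral>x. (\<Sum>m. f m t x * g m x s) \<partial>lunit)"
  proof (rule sums_integral)
    show "integrable lunit (\<lambda>x. f m t x * g m x s)" for m by (rule bdd_meas_integrable[OF b])
    show "AE x in lunit. summable (\<lambda>m. norm (f m t x * g m x s))"
      using M by (intro AE_I2) (auto intro!: summable_comparison_test'[of M])
    have nb: "bdd_meas (\<lambda>x. norm (f m t x * g m x s))" for m
      using bdd_meas_measurable[OF b] M(1) by (intro bdd_measI[where K="M m"]) auto
    have "norm (\<integral>x. norm (f m t x * g m x s) \<partial>lunit) \<le> M m" for m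
      by (rule integral_lunit_le[OF nb]) (use M(1) in auto)
    then show "summable (\<lambda>m. \<integral>x. norm (f m t x * g m x s) \<partial>lunit)"
      by (intro summable_comparison_test'[OF M(2)]) auto
  qed
  also have "(\<integral>x. (\<Sum>m. f m t x * g m x s) \<partial>lunit) = (\<integral>x. F t x * G x s \<partial>lunit)"
    by (rule integral_lunit_cong) (use sums_unique[OF FG] in auto)
  finally show ?thesis unfolding star_eq .
qed

text \<open>
  The powers are dominated by a geometric series, so their sum is again a Volterra kernel and may be
  star-multiplied term by term.  The second identity needs in addition that the powers of \<open>A\<close> commute
  with \<open>A\<close>.
\<close>

theorem neumann_series:
  fixes A :: "('n::finite) mkernel"
  assumes A: "mvolterra A"
  defines "C \<equiv> star_series A"
  shows "\<And>t s. t \<in> {0..1} \<Longrightarrow> s \<in> {0..1} \<Longrightarrow> summable (\<lambda>m. star_pow_Suc A m t s)"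
    and "mvolterra C"
    and "\<And>t s. t \<in> {0..1} \<Longrightarrow> s \<in> {0..1} \<Longrightarrow> C t s = A t s + mstar A C t s"
    and "\<And>t s. t \<in> {0..1} \<Longrightarrow> s \<in> {0..1} \<Longrightarrow> C t s = A t s + mstar C A t s"
proof -
  obtain a where a: "a \<ge> 0" "\<And>k l t s. t \<in> {0..1} \<Longrightarrow> s \<in> {0..1} \<Longrightarrow> cmod (entry A k l t s) \<le> a"
    using mvolterra_bound[OF A] by blast
  define P where "P m = star_pow_Suc A m" for m
  define M where "M m = a * exp (2 * a * real CARD('n) + 1) * (1/2)^m" for m :: nat
  have M: "summable M" unfolding M_def by (intro summable_mult summable_geometric) simp
  have vP: "volterra (entry (P m) k l)" for m k l unfolding P_def by (rule mvolterraD[OF mvolterra_star_pow[OF A]])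
  have PM: "cmod (entry (P m) k l t s) \<le> M m" if ts: "t \<in> {0..1}" "s \<in> {0..1}" for m k l t s
  proof -
    have "cmod (entry (P m) k l t s) \<le> a * (1/2)^m * exp ((2 * a * real CARD('n) + 1) * t)"
      unfolding P_def by (rule star_pow_bound[OF A a(1) a(2) ts])
    also have "\<dots> \<le> a * (1/2)^m * exp ((2 * a * real CARD('n) + 1) * 1)"
      using ts a(1) unfolding exp_le_cancel_iff
      by (intro mult_left_mono[where c="a * (1/2)^m"]) (simp_all add: mult_left_le)
    finally show ?thesis by (simp add: M_def mult_ac)
  qed
  have sumP: "summable (\<lambda>m. P m t s)" if ts: "t \<in> {0..1}" "s \<in> {0..1}" for t s
  proof (rule summable_comparison_test')
    show "summable (\<lambda>m. real CARD('n) * real CARD('n) * M m)" by (intro summable_mult M)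
    have "norm (P m t s) \<le> (\<Sum>k\<in>(UNIV::'n set). \<Sum>l\<in>(UNIV::'n set). M m)" for m
      using PM[OF ts] unfolding entry_def by (intro order_trans[OF norm_matrix_le_sum] sum_mono)
    then show "norm (P m t s) \<le> real CARD('n) * real CARD('n) * M m" for m
      by (simp add: mult.assoc)
  qed
  then show sumA: "summable (\<lambda>m. star_pow_Suc A m t s)" if "t \<in> {0..1}" "s \<in> {0..1}" for t s
    using that unfolding P_def by blast
  have zero: "P m t s = 0" if "t < s" for m t s
    using volterra_zero[OF vP that] by (simp add: vec_eq_iff entry_def)
  have Ce: "entry C k l t s = (\<Sum>m. entry (P m) k l t s)" if "t < s \<or> t \<in> {0..1} \<and> s \<in> {0..1}" for k l t s
  proof -
    have "summable (\<lambda>m. P m t s)" using that sumP zero by auto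
    then have "(\<Sum>m. P m t s) $ k $ l = (\<Sum>m. P m t s $ k $ l)"
      by (rule suminf_entry)
    then show ?thesis unfolding entry_def C_def star_series_def P_def .
  qed
  have vC: "volterra (entry C k l)" for k l
    unfolding volterra_def
  proof (intro conjI allI impI)
    show "entry C k l t s = 0" if "t < s" for t s
      using Ce[of t s k l] that zero[OF that] by (simp add: entry_def)
    have "uniform_limit triangle (\<lambda>n p. \<Sum>m<n. entry (P m) k l (fst p) (snd p)) (\<lambda>p. \<Sum>m. entry (P m) k l (fst p) (snd p)) sequentially"
      by (rule Weierstrass_m_test[OF _ M]) (use PM in auto)
    then have "continuous_on triangle (\<lambda>p. \<Sum>m. entry (P m) k l (fst p) (snd p))"
    proof (rule uniform_limit_theorem[rotated])
      show "\<forall>\<^sub>F n in sequentially. continuous_on triangle (\<lambda>p. \<Sum>m<n. entry (P m) k l (fst p) (snd p))"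
        using vP by (intro always_eventually allI continuous_on_sum) (simp add: volterra_def case_prod_unfold)
    qed simp
    then show "continuous_on triangle (\<lambda>(t, s). entry C k l t s)"
      by (rule continuous_on_eq) (use Ce in auto)
  qed
  then show mC: "mvolterra C" by (simp add: mvolterra_def)
  have PC: "(\<lambda>m. entry (P m) k l t s) sums entry C k l t s" if ts: "t \<in> {0..1}" "s \<in> {0..1}" for k l t s
  proof -
    have "summable (\<lambda>m. entry (P m) k l t s)"
      by (rule summable_comparison_test'[OF M]) (use PM[OF ts] in auto)
    then show ?thesis using Ce[of t s k l] ts by (simp add: sums_iff)
  qed
  have split: "C t s = A t s + X"
    if ts: "t \<in> {0..1}" "s \<in> {0..1}" and X: "\<And>k l. (\<lambda>m. entry (P (Suc m)) k l t s) sums (X $ k $ l)" for t s X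
  proof -
    have "entry C k l t s = X $ k $ l + entry (P 0) k l t s" for k l
      by (rule sums_unique2[OF PC[OF ts] sums_Suc[OF X]])
    then show ?thesis by (simp add: vec_eq_iff entry_def P_def add.commute)
  qed
  show "C t s = A t s + mstar A C t s" if ts: "t \<in> {0..1}" "s \<in> {0..1}" for t s
  proof (rule split[OF ts])
    fix k l
    have "(\<lambda>m. star (entry A k j) (entry (P m) j l) t s) sums star (entry A k j) (entry C j l) t s" for j
    proof (rule star_sums[OF mvolterraD[OF A] vP ts, where M="\<lambda>m. a * M m"])
      show "cmod (entry A k j t x * entry (P m) j l x s) \<le> a * M m" if "x \<in> {0..1}" for m x
        unfolding norm_mult using ts that a PM by (intro mult_mono) auto
      show "(\<lambda>m. entry A k j t x * entry (P m) j l x s) sums (entry A k j t x * entry C j l x s)" if "x \<in> {0..1}" for x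
        by (intro sums_mult PC that ts)
    qed (intro summable_mult M)
    then have "(\<lambda>m. \<Sum>j\<in>UNIV. star (entry A k j) (entry (P m) j l) t s) sums (\<Sum>j\<in>UNIV. star (entry A k j) (entry C j l) t s)"
      by (intro sums_sum)
    then show "(\<lambda>m. entry (P (Suc m)) k l t s) sums (mstar A C t s $ k $ l)"
      by (simp add: P_def entry_mstar) (simp add: mstar_def)
  qed
  show "C t s = A t s + mstar C A t s" if ts: "t \<in> {0..1}" "s \<in> {0..1}" for t s
  proof (rule split[OF ts])
    fix k l
    have "(\<lambda>m. star (entry (P m) k j) (entry A j l) t s) sums star (entry C k j) (entry A j l) t s" for j
    proof (rule star_sums[OF vP mvolterraD[OF A] ts, where M="\<lambda>m. M m * a"])
      show "cmod (entry (P m) k j t x * entry A j l x s) \<le> M m * a" if "x \<in> {0..1}" for m x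
        unfolding norm_mult using ts that a PM order_trans[OF norm_ge_zero PM] by (intro mult_mono) auto
      show "(\<lambda>m. entry (P m) k j t x * entry A j l x s) sums (entry C k j t x * entry A j l x s)" if "x \<in> {0..1}" for x
        by (intro sums_mult2 PC that ts)
    qed (intro summable_mult2 M)
    then have "(\<lambda>m. \<Sum>j\<in>UNIV. star (entry (P m) k j) (entry A j l) t s) sums (\<Sum>j\<in>UNIV. star (entry C k j) (entry A j l) t s)"
      by (intro sums_sum)
    then have "(\<lambda>m. mstar (P m) A t s $ k $ l) sums (mstar C A t s $ k $ l)"
      by (simp add: mstar_def)
    then show "(\<lambda>m. entry (P (Suc m)) k l t s) sums (mstar C A t s $ k $ l)"
      using star_pow_commute[OF A ts] unfolding P_def entry_def by simp
  qed
qed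

lemma block_hs_uminus: "block_hs X \<Longrightarrow> block_hs (\<lambda>k l i j. - X k l i j)"
  by (simp add: block_hs_def hilbert_schmidt_def)

lemma block_mult_uminus_left:
  assumes "block_mult_conv X Y"
  shows "block_mult (\<lambda>k l i j. - X k l i j) Y = (\<lambda>k l i j. - block_mult X Y k l i j)"
  using assms by (simp add: block_mult_def inf_mult_def block_mult_conv_def suminf_minus sum_negf)

lemma block_mult_uminus_right:
  assumes "block_mult_conv X Y"
  shows "block_mult X (\<lambda>k l i j. - Y k l i j) = (\<lambda>k l i j. - block_mult X Y k l i j)"
  using assms by (simp add: block_mult_def inf_mult_def block_mult_conv_def suminf_minus sum_negf)

lemma block_diff_eq_add: "block_diff X Y = block_add X (\<lambda>k l i j. - Y k l i j)"
  by (simp add: block_diff_def block_add_def)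

lemma l2_operator_block_one_plus_hs:
  assumes "block_hs H" shows "l2_operator (block_add block_one H k l)"
proof -
  have "block_add block_one H k l = (\<lambda>i j. (if k = l \<and> i = j then 1 else 0) + H k l i j)"
    by (simp add: block_add_def block_one_apply fun_eq_iff)
  then show ?thesis using l2_operator_one_plus_hs[of "H k l" "k = l"] assms by (simp add: block_hs_def)
qed

text \<open>
  The difference is read as \<open>I + (-X)\<close>, so that results on identity plus Hilbert-Schmidt apply.
\<close>

lemma block_one_minus_mult:
  assumes "block_hs X" "block_rows_l2 Y" "block_cols_l2 Y"
  shows "block_mult (block_diff block_one X) Y = block_diff Y (block_mult X Y)"
proof -
  have "block_mult_conv X Y" by (intro block_mult_conv_l2 block_hs_rows assms)
  moreover have "block_mult_conv (\<lambda>k l i j. - X k l i j) Y"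
    by (intro block_mult_conv_l2 block_hs_rows block_hs_uminus assms)
  moreover have "block_mult_conv block_one Y"
    by (intro block_mult_conv_l2 block_one_rows assms)
  ultimately show ?thesis
    unfolding block_diff_eq_add by (simp add: block_mult_add_left block_mult_one_left block_mult_uminus_left)
qed

lemma block_mult_one_minus:
  assumes "block_hs X" "block_rows_l2 Y" "block_cols_l2 Y"
  shows "block_mult Y (block_diff block_one X) = block_diff Y (block_mult Y X)"
proof -
  have "block_mult_conv Y X" by (intro block_mult_conv_l2 block_hs_cols assms)
  moreover have "block_mult_conv Y (\<lambda>k l i j. - X k l i j)"
    by (intro block_mult_conv_l2 block_hs_cols block_hs_uminus assms)
  moreover have "block_mult_conv Y block_one"
    by (intro block_mult_conv_l2 block_one_cols assms)
  ultimately show ?thesis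
    unfolding block_diff_eq_add by (simp add: block_mult_add_right block_mult_one_right block_mult_uminus_right)
qed

theorem block_neumann_inverse:
  fixes A :: "('n::finite) mkernel"
  assumes A: "mvolterra A"
  defines "AA \<equiv> block_coeff_mat A" and "CC \<equiv> block_coeff_mat (star_series A)"
  shows "is_block_inverse (block_diff block_one AA) (block_add block_one CC)"
    and "block_inverse (block_diff block_one AA) = block_add block_one CC"
proof -
  note N = neumann_series[OF A]
  have hA: "block_hs AA" unfolding AA_def by (rule block_hs_coeff[OF A])
  have hC: "block_hs CC" unfolding CC_def by (rule block_hs_coeff[OF N(2)])
  have rc: "block_rows_l2 (block_add block_one CC)" "block_cols_l2 (block_add block_one CC)"
    by (intro block_add_one_rows block_hs_rows hC block_add_one_cols block_hs_cols)+
  have rcA: "block_rows_l2 (block_diff block_one AA)" "block_cols_l2 (block_diff block_one AA)"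
    unfolding block_diff_eq_add
    by (intro block_add_one_rows block_hs_rows block_hs_uminus hA block_add_one_cols block_hs_cols)+
  have 1: "CC = block_add AA (block_mult AA CC)"
    unfolding CC_def AA_def block_coeff_mat_mstar[OF A N(2), symmetric]
      block_coeff_mat_add[OF A mvolterra_mstar[OF A N(2)], symmetric]
    by (rule block_coeff_mat_cong) (use N(3) in auto)
  have 2: "CC = block_add AA (block_mult CC AA)"
    unfolding CC_def AA_def block_coeff_mat_mstar[OF N(2) A, symmetric]
      block_coeff_mat_add[OF A mvolterra_mstar[OF N(2) A], symmetric]
    by (rule block_coeff_mat_cong) (use N(4) in auto)
  have c: "block_mult_conv AA block_one" "block_mult_conv AA CC" "block_mult_conv block_one AA" "block_mult_conv CC AA"
    by (intro block_mult_conv_l2 block_hs_rows block_hs_cols block_one_rows block_one_cols hA hC)+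
  have "block_mult (block_diff block_one AA) (block_add block_one CC) = block_one"
    unfolding block_one_minus_mult[OF hA rc] block_mult_add_right[OF c(1,2)] block_mult_one_right
    using 1 by (simp add: block_diff_def block_add_def fun_eq_iff)
  moreover have "block_mult (block_add block_one CC) (block_diff block_one AA) = block_one"
    unfolding block_mult_one_minus[OF hA rc] block_mult_add_left[OF c(3,4)] block_mult_one_left
    using 2 by (simp add: block_diff_def block_add_def fun_eq_iff)
  ultimately show inv: "is_block_inverse (block_diff block_one AA) (block_add block_one CC)"
    unfolding is_block_inverse_def using rc rcA l2_operator_block_one_plus_hs[OF hC] block_mult_conv_l2 by blast
  show "block_inverse (block_diff block_one AA) = block_add block_one CC"
    by (rule block_inverse_eqI[OF block_diff_eq_add block_hs_uminus[OF hA] inv rc(1)])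
qed

section \<open>Regularity of the solution of the differential equation\<close>

text \<open>
  A power series that converges on a relative neighbourhood of an end point is only known to converge on
  one side; a single point \<open>t \<noteq> a\<close> of convergence is enough to control it near \<open>a\<close>.
\<close>

lemma unit_interval_neighbour:
  fixes a r :: real
  assumes "a \<in> {0..1}" "r > 0"
  obtains t where "t \<in> {0..1}" "t \<noteq> a" "\<bar>t - a\<bar> < r"
proof (cases "a \<le> 1/2")
  case True
  show ?thesis using assms True by (intro that[of "a + min (r/2) (1/2)"]) (auto simp: min_def)
next
  case False
  show ?thesis using assms False by (intro that[of "a - min (r/2) (1/2)"]) (auto simp: min_def)
qed

lemma analytic1_continuous:
  assumes "analytic1 f" shows "continuous_on {0..1} f"
  unfolding continuous_on_eq_continuous_within
proof
  fix a :: real assume a: "a \<in> {0..1}"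
  then obtain r c where r: "r > 0" and c: "\<And>t. t \<in> {0..1} \<Longrightarrow> \<bar>t - a\<bar> < r \<Longrightarrow> (\<lambda>i. c i * of_real ((t - a) ^ i)) sums f t"
    using assms unfolding analytic1_def by blast
  obtain t0 where t0: "t0 \<in> {0..1}" "t0 \<noteq> a" "\<bar>t0 - a\<bar> < r"
    using unit_interval_neighbour[OF a r] by blast
  have "summable (\<lambda>i. c i * (complex_of_real (t0 - a)) ^ i)"
    using c[OF t0(1,3)] by (auto simp: sums_iff)
  then have "isCont (\<lambda>x. \<Sum>i. c i * x ^ i) 0"
    by (rule isCont_powser) (use t0 in auto)
  then have "continuous (at (of_real (a - a))) (\<lambda>x. \<Sum>i. c i * x ^ i)" by simp
  then have "continuous (at a within {0..1}) (\<lambda>t. \<Sum>i. c i * (of_real (t - a)) ^ i)"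
    by (rule continuous_within_compose3) (intro continuous_intros)
  then have 1: "((\<lambda>t. \<Sum>i. c i * (of_real (t - a)) ^ i) \<longlongrightarrow> (\<Sum>i. c i * (of_real (a - a)) ^ i)) (at a within {0..1})"
    unfolding continuous_within .
  have 2: "\<forall>\<^sub>F t in at a within {0..1}. (\<Sum>i. c i * (of_real (t - a)) ^ i) = f t"
    unfolding eventually_at using r by (intro exI[of _ r]) (auto simp: dist_real_def sums_iff dest: c)
  have 3: "(\<Sum>i. c i * (of_real (a - a)) ^ i) = f a"
    using c[OF a] r by (auto simp: sums_iff)
  show "continuous (at a within {0..1}) f"
    unfolding continuous_within using Lim_transform_eventually[OF 1 2] unfolding 3 .
qed

lemma analytic2_swap:
  assumes "analytic2 f" shows "analytic2 (\<lambda>s t. f t s)"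
  unfolding analytic2_def
proof (intro ballI)
  fix a b :: real assume "a \<in> {0..1}" "b \<in> {0..1}"
  then obtain r c where r: "r > 0" and c: "\<forall>t\<in>{0..1}. \<forall>s\<in>{0..1}. \<bar>t - b\<bar> < r \<longrightarrow> \<bar>s - a\<bar> < r \<longrightarrow>
     ((\<lambda>(i, j). c i j * of_real ((t - b) ^ i * (s - a) ^ j)) has_sum f t s) UNIV"
    using assms unfolding analytic2_def by meson
  show "\<exists>r>0. \<exists>c. \<forall>t\<in>{0..1}. \<forall>s\<in>{0..1}. \<bar>t - a\<bar> < r \<longrightarrow> \<bar>s - b\<bar> < r \<longrightarrow>
     ((\<lambda>(i, j). c i j * of_real ((t - a) ^ i * (s - b) ^ j)) has_sum f s t) UNIV"
  proof (intro exI[of _ r] conjI r exI[of _ "\<lambda>i j. c j i"] ballI impI)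
    fix t s :: real assume ts: "t \<in> {0..1}" "s \<in> {0..1}" "\<bar>t - a\<bar> < r" "\<bar>s - b\<bar> < r"
    have "((\<lambda>(i, j). c i j * of_real ((s - b) ^ i * (t - a) ^ j)) has_sum f s t) (UNIV \<times> UNIV)"
      using c ts by simp
    then show "((\<lambda>(i, j). c j i * of_real ((t - a) ^ i * (s - b) ^ j)) has_sum f s t) UNIV"
      by (subst (asm) has_sum_swap) (simp add: case_prod_unfold mult_ac)
  qed
qed

lemma power_diff_le:
  fixes x y h :: real
  assumes "h > 0" "\<bar>x\<bar> \<le> h / 2" "\<bar>y\<bar> \<le> h / 2"
  shows "\<bar>x ^ j - y ^ j\<bar> \<le> 2 / h * h ^ j * \<bar>x - y\<bar>"
proof -
  define u v where "u = 2 * x / h" and "v = 2 * y / h"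
  have uv: "x = h / 2 * u" "y = h / 2 * v" using assms by (auto simp: u_def v_def)
  have "norm (u ^ j - v ^ j) \<le> real j * norm (u - v)"
    by (rule norm_power_diff) (use assms in \<open>auto simp: u_def v_def abs_mult field_simps\<close>)
  then have d: "\<bar>u ^ j - v ^ j\<bar> \<le> real j * \<bar>u - v\<bar>" by simp
  have uvd: "\<bar>u - v\<bar> = 2 / h * \<bar>x - y\<bar>"
  proof -
    have "u - v = 2 / h * (x - y)" by (simp add: u_def v_def right_diff_distrib diff_divide_distrib)
    then have "\<bar>u - v\<bar> = \<bar>2 / h\<bar> * \<bar>x - y\<bar>" by (simp only: abs_mult)
    moreover have "\<bar>2 / h\<bar> = 2 / h" using assms(1) by simp
    ultimately show ?thesis by (simp only:)
  qed
  have "\<bar>x ^ j - y ^ j\<bar> = (h / 2) ^ j * \<bar>u ^ j - v ^ j\<bar>"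
  proof -
    have "x ^ j - y ^ j = (h / 2) ^ j * (u ^ j - v ^ j)"
      by (simp only: uv power_mult_distrib right_diff_distrib)
    then have "\<bar>x ^ j - y ^ j\<bar> = \<bar>(h / 2) ^ j\<bar> * \<bar>u ^ j - v ^ j\<bar>" by (simp only: abs_mult)
    moreover have "\<bar>(h / 2) ^ j\<bar> = (h / 2) ^ j" using assms(1) by simp
    ultimately show ?thesis by (simp only:)
  qed
  also have "\<dots> \<le> (h / 2) ^ j * (2 ^ j * \<bar>u - v\<bar>)"
  proof (intro mult_left_mono order_trans[OF d] mult_right_mono)
    show "real j \<le> 2 ^ j" using of_nat_less_two_power[of j, where 'a=real] by simp
  qed (use assms in auto)
  also have "\<dots> = 2 / h * h ^ j * \<bar>x - y\<bar>" unfolding uvd by (simp add: power_divide)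
  finally show ?thesis .
qed

text \<open>
  Absolute convergence at one corner \<open>(t0, s0)\<close> dominates the series of differences on a
  smaller box: there \<open>x\<^sup>j - y\<^sup>j\<close> is at most a multiple of \<open>\<bar>x - y\<bar>\<close> times the power at the corner.
\<close>

lemma analytic2_local_lipschitz:
  assumes "analytic2 f" shows "local_lipschitz {0..1} {0..1} f"
proof (rule local_lipschitzI)
  fix a b :: real assume a: "a \<in> {0..1}" and b: "b \<in> {0..1}"
  then obtain r c where r: "r > 0" and c: "\<And>t s. t\<in>{0..1} \<Longrightarrow> s\<in>{0..1} \<Longrightarrow> \<bar>t - a\<bar> < r \<Longrightarrow> \<bar>s - b\<bar> < r \<Longrightarrow>
     ((\<lambda>(i, j). c i j * of_real ((t - a) ^ i * (s - b) ^ j)) has_sum f t s) UNIV"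
    using assms unfolding analytic2_def by meson
  obtain t0 where t0: "t0 \<in> {0..1}" "t0 \<noteq> a" "\<bar>t0 - a\<bar> < r"
    using unit_interval_neighbour[OF a r] by blast
  obtain s0 where s0: "s0 \<in> {0..1}" "s0 \<noteq> b" "\<bar>s0 - b\<bar> < r"
    using unit_interval_neighbour[OF b r] by blast
  define h k where "h = \<bar>t0 - a\<bar>" and "k = \<bar>s0 - b\<bar>"
  have hk: "h > 0" "k > 0" "h < r" "k < r" using t0 s0 by (auto simp: h_def k_def)
  have "(\<lambda>(i, j). c i j * of_real ((t0 - a) ^ i * (s0 - b) ^ j)) summable_on UNIV"
    using c[OF t0(1) s0(1) t0(3) s0(3)] by (rule has_sum_imp_summable)
  then have "(\<lambda>p. cmod ((\<lambda>(i, j). c i j * of_real ((t0 - a) ^ i * (s0 - b) ^ j)) p)) summable_on UNIV"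
    unfolding summable_on_iff_abs_summable_on_complex .
  then have "(\<lambda>(i, j). cmod (c i j) * (h ^ i * k ^ j)) summable_on UNIV"
    by (rule summable_on_cong[THEN iffD1, rotated]) (auto simp: norm_mult h_def k_def power_abs abs_mult simp del: of_real_mult of_real_power of_real_diff)
  then obtain K where K: "((\<lambda>(i, j). cmod (c i j) * (h ^ i * k ^ j)) has_sum K) UNIV"
    by (auto simp: summable_on_def)
  have K0: "K \<ge> 0" by (rule has_sum_nonneg[OF K]) (use hk in auto)
  define u where "u = min h (k / 2)"
  show "\<exists>u>0. \<exists>L. \<forall>t\<in>cball a u \<inter> {0..1}. L-lipschitz_on (cball b u \<inter> {0..1}) (f t)"
  proof (rule exI[of _ u], intro conjI exI[of _ "2 / k * K"] ballI lipschitz_onI)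
    show "u > 0" using hk by (simp add: u_def)
    show "0 \<le> 2 / k * K" using hk K0 by simp
    fix t s s' assume t: "t \<in> cball a u \<inter> {0..1}" and s: "s \<in> cball b u \<inter> {0..1}" "s' \<in> cball b u \<inter> {0..1}"
    then have le: "\<bar>t - a\<bar> \<le> h" "\<bar>s - b\<bar> \<le> k / 2" "\<bar>s' - b\<bar> \<le> k / 2"
      by (auto simp: u_def dist_real_def abs_minus_commute)
    have d: "((\<lambda>p. (case p of (i, j) \<Rightarrow> c i j * of_real ((t - a) ^ i * (s - b) ^ j)) -
        (case p of (i, j) \<Rightarrow> c i j * of_real ((t - a) ^ i * (s' - b) ^ j))) has_sum (f t s - f t s')) UNIV"
    proof -
      have "\<bar>t - a\<bar> < r" "\<bar>s - b\<bar> < r" "\<bar>s' - b\<bar> < r" using le hk by auto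
      then have "((\<lambda>(i, j). c i j * of_real ((t - a) ^ i * (s - b) ^ j)) has_sum f t s) UNIV"
        "((\<lambda>(i, j). c i j * of_real ((t - a) ^ i * (s' - b) ^ j)) has_sum f t s') UNIV"
        using t s by (auto intro!: c simp del: of_real_mult of_real_power of_real_diff)
      from has_sum_add[OF this(1) has_sum_uminusI[OF this(2)]]
      show ?thesis by (simp only: diff_conv_add_uminus[symmetric])
    qed
    have "cmod (f t s - f t s') \<le> K * (2 / k * \<bar>s - s'\<bar>)"
    proof (rule norm_infsum_le[OF d has_sum_cmult_left[OF K]])
      fix p :: "nat \<times> nat"
      obtain i j where p: "p = (i, j)" by (cases p)
      have "cmod (c i j * of_real ((t - a) ^ i * (s - b) ^ j) - c i j * of_real ((t - a) ^ i * (s' - b) ^ j))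
         = cmod (c i j * of_real ((t - a) ^ i * ((s - b) ^ j - (s' - b) ^ j)))"
        by (simp only: right_diff_distrib of_real_diff)
      also have "\<dots> = cmod (c i j) * (\<bar>t - a\<bar> ^ i * \<bar>(s - b) ^ j - (s' - b) ^ j\<bar>)"
        by (simp add: norm_mult abs_mult power_abs del: of_real_mult of_real_diff of_real_power)
      also have "\<dots> \<le> cmod (c i j) * (h ^ i * (2 / k * k ^ j * \<bar>(s - b) - (s' - b)\<bar>))"
        using hk le by (intro mult_left_mono mult_mono power_mono power_diff_le) auto
      also have "\<dots> = cmod (c i j) * (h ^ i * k ^ j) * (2 / k * \<bar>s - s'\<bar>)" by simp
      finally show "cmod ((case p of (i, j) \<Rightarrow> c i j * of_real ((t - a) ^ i * (s - b) ^ j)) -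
        (case p of (i, j) \<Rightarrow> c i j * of_real ((t - a) ^ i * (s' - b) ^ j)))
          \<le> (case p of (i, j) \<Rightarrow> cmod (c i j) * (h ^ i * k ^ j)) * (2 / k * \<bar>s - s'\<bar>)"
        by (simp only: p prod.case)
    qed
    also have "\<dots> = 2 / k * K * \<bar>s - s'\<bar>" by simp
    finally show "dist (f t s) (f t s') \<le> 2 / k * K * dist s s'"
      by (simp only: dist_norm real_norm_def)
  qed
qed

lemma analytic2_lipschitz:
  assumes "analytic2 f"
  shows "\<exists>L. \<forall>t\<in>{0..1}. L-lipschitz_on {0..1} (f t)"
proof -
  have cont: "continuous_on {0..1} (\<lambda>t. f t s)" if "s \<in> {0..1}" for s
    using local_lipschitz_continuous_on[OF analytic2_local_lipschitz[OF analytic2_swap[OF assms]] that] .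
  show ?thesis
  proof (rule local_lipschitz_compact_implies_lipschitz[OF analytic2_local_lipschitz[OF assms]
      compact_Icc compact_Icc cont])
    fix L assume "\<And>t. t \<in> {0..1} \<Longrightarrow> L-lipschitz_on {0..1} (f t)"
    then show ?thesis by blast
  qed
qed

lemma analytic2_lipschitz_jointly:
  assumes "analytic2 f"
  shows "\<exists>L. L-lipschitz_on ({0..1} \<times> {0..1}) (\<lambda>(t, s). f t s)"
proof -
  obtain L1 where L1: "\<And>t. t \<in> {0..1} \<Longrightarrow> L1-lipschitz_on {0..1} (f t)"
    using analytic2_lipschitz[OF assms] by blast
  obtain L2 where L2: "\<And>s. s \<in> {0..1} \<Longrightarrow> L2-lipschitz_on {0..1} (\<lambda>t. f t s)"
    using analytic2_lipschitz[OF analytic2_swap[OF assms]] by blast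
  have nn: "L1 \<ge> 0" "L2 \<ge> 0" using lipschitz_on_nonneg[OF L1[of 0]] lipschitz_on_nonneg[OF L2[of 0]] by auto
  have "(L1 + L2)-lipschitz_on ({0..1} \<times> {0..1}) (\<lambda>(t, s). f t s)"
  proof (rule lipschitz_onI, clarify)
    fix t s t' s' :: real assume m: "t \<in> {0..1}" "s \<in> {0..1}" "t' \<in> {0..1}" "s' \<in> {0..1}"
    have "dist (f t s) (f t' s') \<le> dist (f t s) (f t s') + dist (f t s') (f t' s')" by (rule dist_triangle)
    also have "\<dots> \<le> L1 * dist s s' + L2 * dist t t'"
      using lipschitz_onD[OF L1[OF m(1)] m(2,4)] lipschitz_onD[OF L2[OF m(4)] m(1,3)] by simp
    also have "\<dots> \<le> L1 * dist (t, s) (t', s') + L2 * dist (t, s) (t', s')"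
      using nn dist_fst_le[of "(t, s)" "(t', s')"] dist_snd_le[of "(t, s)" "(t', s')"]
      by (intro add_mono mult_left_mono) auto
    finally show "dist (f t s) (f t' s') \<le> (L1 + L2) * dist (t, s) (t', s')" by (simp add: distrib_right)
  qed (use nn in auto)
  then show ?thesis ..
qed

text \<open>
  The squared norm of \<open>D\<close>, unlike the norm, is differentiable.  By \<open>2 \<parallel>D\<parallel> b \<le> \<parallel>D\<parallel>\<^sup>2 + b\<^sup>2\<close> the function \<open>g\<close>
  is decreasing, with \<open>k = 2 a + 1\<close>.
\<close>

lemma gronwall:
  fixes D :: "real \<Rightarrow> 'a::euclidean_space"
  assumes der: "\<And>x. c \<le> x \<Longrightarrow> x \<le> d \<Longrightarrow> (D has_vector_derivative D' x) (at x within {c..d})"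
    and bound: "\<And>x. c \<le> x \<Longrightarrow> x \<le> d \<Longrightarrow> norm (D' x) \<le> a * norm (D x) + b"
    and a: "a \<ge> 0" and b: "b \<ge> 0" and cd: "c \<le> d" "d \<le> c + 1"
  shows "norm (D d) \<le> exp (2 * a + 1) * (norm (D c) + b)"
proof -
  define k where "k = 2 * a + 1"
  define g where "g x = exp (- k * (x - c)) * (D x \<bullet> D x) - b\<^sup>2 * x" for x
  define g' where "g' x = exp (- k * (x - c)) * (2 * (D x \<bullet> D' x) - k * (D x \<bullet> D x)) - b\<^sup>2" for x
  have dg: "(g has_derivative (\<lambda>h. h * g' x)) (at x within {c..d})" if "c \<le> x" "x \<le> d" for x
  proof -
    have "(D has_derivative (\<lambda>h. h *\<^sub>R D' x)) (at x within {c..d})"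
      using der[OF that] by (simp add: has_vector_derivative_def)
    then have "(g has_derivative (\<lambda>h. (exp (- k * (x - c)) * (D x \<bullet> (h *\<^sub>R D' x) + (h *\<^sub>R D' x) \<bullet> D x) +
        (exp (- k * (x - c)) * (- k * h)) * (D x \<bullet> D x)) - b\<^sup>2 * h)) (at x within {c..d})"
      unfolding g_def by (auto intro!: derivative_eq_intros simp: fun_eq_iff)
    then show ?thesis
      by (rule has_derivative_eq_rhs) (simp add: g'_def fun_eq_iff algebra_simps inner_commute)
  qed
  have g'le: "g' x \<le> 0" if "c \<le> x" "x \<le> d" for x
  proof -
    have "2 * (D x \<bullet> D' x) \<le> 2 * (norm (D x) * norm (D' x))"
      using norm_cauchy_schwarz[of "D x" "D' x"] by simp
    also have "\<dots> \<le> 2 * (norm (D x) * (a * norm (D x) + b))"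
      using bound[OF that] by (intro mult_left_mono) auto
    also have "\<dots> = 2 * a * (norm (D x))\<^sup>2 + 2 * norm (D x) * b" by (simp add: power2_eq_square algebra_simps)
    also have "\<dots> \<le> 2 * a * (norm (D x))\<^sup>2 + ((norm (D x))\<^sup>2 + b\<^sup>2)"
      using sum_squares_bound[of "norm (D x)" b] by simp
    finally have "2 * (D x \<bullet> D' x) - k * (D x \<bullet> D x) \<le> b\<^sup>2"
      by (simp add: k_def power2_norm_eq_inner algebra_simps)
    then have "exp (- k * (x - c)) * (2 * (D x \<bullet> D' x) - k * (D x \<bullet> D x)) \<le> exp (- k * (x - c)) * b\<^sup>2"
      by (intro mult_left_mono) auto
    also have "\<dots> \<le> 1 * b\<^sup>2"
      using that a by (intro mult_right_mono) (auto simp: k_def intro!: mult_nonpos_nonneg)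
    finally show ?thesis by (simp add: g'_def)
  qed
  have "\<exists>x\<in>{c..d}. g d - g c = (d - c) * g' x"
    by (rule mvt_very_simple[OF cd(1)]) (rule dg)
  then obtain x where x: "c \<le> x" "x \<le> d" "g d - g c = (d - c) * g' x" by auto
  have "(d - c) * g' x \<le> 0" using g'le[OF x(1,2)] cd(1) by (intro mult_nonneg_nonpos) auto
  then have "g d \<le> g c" using x(3) by linarith
  then have "exp (- k * (d - c)) * (norm (D d))\<^sup>2 \<le> (norm (D c))\<^sup>2 + b\<^sup>2 * (d - c)"
    by (simp add: g_def power2_norm_eq_inner algebra_simps)
  also have "\<dots> \<le> (norm (D c))\<^sup>2 + b\<^sup>2 * 1"
    using cd by (intro add_left_mono mult_left_mono) auto
  also have "\<dots> \<le> (norm (D c) + b)\<^sup>2" using b by (simp add: power2_sum)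
  finally have 1: "exp (- k * (d - c)) * (norm (D d))\<^sup>2 \<le> (norm (D c) + b)\<^sup>2" .
  have k: "k \<ge> 1" using a by (simp add: k_def)
  have "(norm (D d))\<^sup>2 = exp (k * (d - c)) * (exp (- k * (d - c)) * (norm (D d))\<^sup>2)"
    by (simp add: mult.assoc[symmetric] flip: exp_add)
  also have "\<dots> \<le> exp (k * (d - c)) * (norm (D c) + b)\<^sup>2" using 1 by (intro mult_left_mono) auto
  also have "\<dots> \<le> exp (2 * k) * (norm (D c) + b)\<^sup>2"
  proof -
    have "k * (d - c) \<le> k * 1" using k cd by (intro mult_left_mono) auto
    then show ?thesis using k by (intro mult_right_mono) auto
  qed
  also have "\<dots> = (exp k * (norm (D c) + b))\<^sup>2"
    by (simp add: power_mult_distrib exp_double)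
  finally show ?thesis unfolding k_def[symmetric]
    by (rule power2_le_imp_le) (use b in auto)
qed

lemma norm_entry_le: "cmod ((X :: complex^'n^'m) $ k $ l) \<le> norm X"
  by (rule order_trans[OF Finite_Cartesian_Product.norm_nth_le Finite_Cartesian_Product.norm_nth_le])

lemma norm_matrix_mult_le:
  fixes X Y :: "complex^'n^'n"
  shows "norm (X ** Y) \<le> real CARD('n) ^ 3 * (norm X * norm Y)"
proof -
  have "cmod ((X ** Y) $ k $ l) \<le> real CARD('n) * (norm X * norm Y)" for k l
  proof -
    have "cmod ((X ** Y) $ k $ l) \<le> (\<Sum>j\<in>UNIV. cmod (X $ k $ j * Y $ j $ l))"
      by (simp add: matrix_matrix_mult_def norm_sum)
    also have "\<dots> \<le> (\<Sum>j\<in>(UNIV::'n set). norm X * norm Y)"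
      unfolding norm_mult by (intro sum_mono mult_mono norm_entry_le) auto
    finally show ?thesis by simp
  qed
  then have "norm (X ** Y) \<le> (\<Sum>k\<in>(UNIV::'n set). \<Sum>l\<in>(UNIV::'n set). real CARD('n) * (norm X * norm Y))"
    by (intro order_trans[OF norm_matrix_le_sum] sum_mono)
  then show ?thesis by (simp add: power3_eq_cube mult.assoc)
qed

lemma lipschitz_matrix:
  fixes F :: "'a::metric_space \<Rightarrow> complex^'n^'n"
  assumes "\<And>k l. \<exists>L. L-lipschitz_on S (\<lambda>x. F x $ k $ l)"
  shows "\<exists>L. L-lipschitz_on S F"
proof -
  obtain L where L: "\<And>k l. (L k l)-lipschitz_on S (\<lambda>x. F x $ k $ l)" using assms by metis
  have "(\<Sum>k\<in>UNIV. \<Sum>l\<in>UNIV. L k l)-lipschitz_on S F"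
  proof (rule lipschitz_onI)
    fix x y assume xy: "x \<in> S" "y \<in> S"
    have "dist (F x) (F y) \<le> (\<Sum>k\<in>UNIV. \<Sum>l\<in>UNIV. cmod (F x $ k $ l - F y $ k $ l))"
      using norm_matrix_le_sum[of "F x - F y"] by (simp add: dist_norm)
    also have "\<dots> \<le> (\<Sum>k\<in>UNIV. \<Sum>l\<in>UNIV. L k l * dist x y)"
      using lipschitz_onD[OF L xy] by (intro sum_mono) (simp add: dist_norm)
    finally show "dist (F x) (F y) \<le> (\<Sum>k\<in>UNIV. \<Sum>l\<in>UNIV. L k l) * dist x y"
      by (simp add: sum_distrib_right)
  qed (intro sum_nonneg lipschitz_on_nonneg[OF L])
  then show ?thesis ..
qed

text \<open>
  Gronwall's inequality bounds \<open>Ut\<close> first, hence also its derivative in \<open>t\<close>.  For the dependence on the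
  initial time, \<open>Ut(\<cdot>, s) - Ut(\<cdot>, s')\<close> solves a linear equation whose inhomogeneity and whose value at time
  \<open>s'\<close> are both of size \<open>O(\<bar>s - s'\<bar>)\<close>.
\<close>

theorem ode_solution_lipschitz:
  fixes At :: "real \<Rightarrow> complex^'n^'n" and Bt Ut :: "real \<Rightarrow> real \<Rightarrow> complex^'n^'n"
  assumes contA: "continuous_on {0..1} At"
    and lipB: "LB-lipschitz_on ({0..1} \<times> {0..1}) (\<lambda>(t, s). Bt t s)"
    and ode: "\<And>t s. 0 \<le> s \<Longrightarrow> s \<le> t \<Longrightarrow> t \<le> 1 \<Longrightarrow>
       ((\<lambda>\<tau>. Ut \<tau> s) has_vector_derivative (At t ** Ut t s + Bt t s)) (at t within {s..1})"
    and init: "\<And>s. 0 \<le> s \<Longrightarrow> s \<le> 1 \<Longrightarrow> Ut s s = mat 1"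
  shows "\<exists>L. L-lipschitz_on triangle (\<lambda>(t, s). Ut t s)"
proof -
  define N where "N = real CARD('n) ^ 3"
  have N: "N \<ge> 0" by (simp add: N_def)
  have "compact (At ` {0..1})" by (intro compact_continuous_image contA) auto
  then obtain a0 where "\<forall>z\<in>At ` {0..1}. norm z \<le> a0"
    using bounded_iff[THEN iffD1, OF compact_imp_bounded] by blast
  then have a0: "norm (At t) \<le> a0" if "t \<in> {0..1}" for t using that by auto
  have a0nn: "a0 \<ge> 0" by (rule order_trans[OF norm_ge_zero a0[of 0]]) simp
  have "compact ((\<lambda>(t, s). Bt t s) ` ({0..1} \<times> {0..1}))"
    by (intro compact_continuous_image lipschitz_on_continuous_on[OF lipB] compact_Times) auto
  then obtain b0 where "\<forall>z\<in>(\<lambda>(t, s). Bt t s) ` ({0..1} \<times> {0..1}). norm z \<le> b0"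
    using bounded_iff[THEN iffD1, OF compact_imp_bounded] by blast
  then have b0: "norm (Bt t s) \<le> b0" if "t \<in> {0..1}" "s \<in> {0..1}" for t s using that by auto
  have b0nn: "b0 \<ge> 0" by (rule order_trans[OF norm_ge_zero b0[of 0 0]]) simp_all
  define a where "a = N * a0"
  have a: "a \<ge> 0" unfolding a_def using N a0nn by simp
  have Amul: "norm (At t ** X) \<le> a * norm X" if "t \<in> {0..1}" for t and X :: "complex^'n^'n"
  proof -
    have "norm (At t ** X) \<le> N * (norm (At t) * norm X)" unfolding N_def by (rule norm_matrix_mult_le)
    also have "\<dots> \<le> N * (a0 * norm X)" using a0[OF that] N by (intro mult_left_mono mult_right_mono) auto
    finally show ?thesis by (simp add: a_def mult.assoc)
  qed
  have der: "((\<lambda>\<tau>. Ut \<tau> s) has_vector_derivative (At x ** Ut x s + Bt x s)) (at x within {c..d})"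
    if "0 \<le> s" "s \<le> c" "c \<le> x" "x \<le> d" "d \<le> 1" for s c d x
    by (rule has_vector_derivative_within_subset[OF ode]) (use that in auto)
  define K where "K = exp (2 * a + 1) * (norm (mat 1 :: complex^'n^'n) + b0)"
  have K: "norm (Ut t s) \<le> K" if "0 \<le> s" "s \<le> t" "t \<le> 1" for t s
  proof -
    have "norm (Ut t s) \<le> exp (2 * a + 1) * (norm (Ut s s) + b0)"
    proof (rule gronwall[where D="\<lambda>\<tau>. Ut \<tau> s" and D'="\<lambda>x. At x ** Ut x s + Bt x s"])
      fix x assume x: "s \<le> x" "x \<le> t"
      show "((\<lambda>\<tau>. Ut \<tau> s) has_vector_derivative (At x ** Ut x s + Bt x s)) (at x within {s..t})"
        by (rule der) (use that x in auto)
      show "norm (At x ** Ut x s + Bt x s) \<le> a * norm (Ut x s) + b0"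
        by (intro norm_triangle_mono Amul b0) (use that x in auto)
    qed (use a b0nn that in auto)
    then show ?thesis using init[of s] that by (simp add: K_def)
  qed
  have Knn: "K \<ge> 0" by (rule order_trans[OF norm_ge_zero K[of 0 0]]) simp_all
  define M where "M = a * K + b0"
  have M: "M \<ge> 0" unfolding M_def using a Knn b0nn by simp
  have lip_t: "norm (Ut t s - Ut t' s) \<le> M * \<bar>t - t'\<bar>"
    if "0 \<le> s" "s \<le> t" "t \<le> 1" "s \<le> t'" "t' \<le> 1" for t t' s
  proof -
    have "norm (Ut t s - Ut t' s) \<le> M * norm (t - t')"
    proof (rule differentiable_bound[where S="{s..1}" and f'="\<lambda>x h. h *\<^sub>R (At x ** Ut x s + Bt x s)"])
      fix x assume x: "x \<in> {s..1}"
      show "((\<lambda>t. Ut t s) has_derivative (\<lambda>h. h *\<^sub>R (At x ** Ut x s + Bt x s))) (at x within {s..1})"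
        using ode[of s x] x that by (simp add: has_vector_derivative_def)
      have "norm (At x ** Ut x s + Bt x s) \<le> a * norm (Ut x s) + b0"
        by (intro norm_triangle_mono Amul b0) (use that x in auto)
      also have "\<dots> \<le> M" unfolding M_def using K[of s x] x that a by (intro add_right_mono mult_left_mono) auto
      finally have V: "norm (At x ** Ut x s + Bt x s) \<le> M" .
      show "onorm (\<lambda>h. h *\<^sub>R (At x ** Ut x s + Bt x s)) \<le> M"
      proof (rule onorm_le)
        fix h :: real
        have "\<bar>h\<bar> * norm (At x ** Ut x s + Bt x s) \<le> \<bar>h\<bar> * M" using V by (intro mult_left_mono) auto
        then show "norm (h *\<^sub>R (At x ** Ut x s + Bt x s)) \<le> M * norm h" by (simp add: mult.commute)
      qed
    qed (use that in auto)
    then show ?thesis by simp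
  qed
  define L where "L = exp (2 * a + 1) * (M + LB)"
  have LB: "LB \<ge> 0" by (rule lipschitz_on_nonneg[OF lipB])
  have L: "L \<ge> 0" unfolding L_def using M LB by simp
  have lip_s': "norm (Ut t s - Ut t s') \<le> L * (s' - s)" if "0 \<le> s" "s \<le> s'" "s' \<le> t" "t \<le> 1" for t s s'
  proof -
    have "norm (Ut t s - Ut t s') \<le> exp (2 * a + 1) * (norm (Ut s' s - Ut s' s') + LB * (s' - s))"
    proof (rule gronwall[where D="\<lambda>\<tau>. Ut \<tau> s - Ut \<tau> s'" and D'="\<lambda>x. (At x ** Ut x s + Bt x s) - (At x ** Ut x s' + Bt x s')"])
      fix x assume x: "s' \<le> x" "x \<le> t"
      show "((\<lambda>\<tau>. Ut \<tau> s - Ut \<tau> s') has_vector_derivative (At x ** Ut x s + Bt x s) - (At x ** Ut x s' + Bt x s')) (at x within {s'..t})"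
        by (intro has_vector_derivative_diff der) (use that x in auto)
      have eq: "(At x ** Ut x s + Bt x s) - (At x ** Ut x s' + Bt x s') = At x ** (Ut x s - Ut x s') + (Bt x s - Bt x s')"
        by (simp add: matrix_matrix_mult_def vec_eq_iff right_diff_distrib sum_subtractf)
      have Bd: "norm (Bt x s - Bt x s') \<le> LB * (s' - s)"
        using lipschitz_onD[OF lipB, of "(x, s)" "(x, s')"] that x by (simp add: dist_norm dist_Pair_Pair)
      show "norm ((At x ** Ut x s + Bt x s) - (At x ** Ut x s' + Bt x s')) \<le> a * norm (Ut x s - Ut x s') + LB * (s' - s)"
        unfolding eq by (intro norm_triangle_mono Amul Bd) (use that x in auto)
    qed (use a LB that in auto)
    also have "norm (Ut s' s - Ut s' s') \<le> M * (s' - s)"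
      using lip_t[of s s' s] init[of s] init[of s'] that by simp
    finally show ?thesis by (simp add: L_def algebra_simps)
  qed
  have lip_s: "norm (Ut t s - Ut t s') \<le> L * \<bar>s - s'\<bar>" if "0 \<le> s" "s \<le> t" "0 \<le> s'" "s' \<le> t" "t \<le> 1" for t s s'
  proof (cases "s \<le> s'")
    case True then show ?thesis using lip_s'[of s s' t] that by simp
  next
    case False then show ?thesis using lip_s'[of s' s t] that by (simp add: norm_minus_commute)
  qed
  have "(M + L + M)-lipschitz_on triangle (\<lambda>(t, s). Ut t s)"
  proof (rule lipschitz_onI, clarify)
    fix t s t' s' :: real assume m: "0 \<le> s" "s \<le> t" "t \<le> 1" "0 \<le> s'" "s' \<le> t'" "t' \<le> 1"
    define d where "d = dist (t, s) (t', s')"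
    have d: "\<bar>t - t'\<bar> \<le> d" "\<bar>s - s'\<bar> \<le> d"
      using dist_fst_le[of "(t, s)" "(t', s')"] dist_snd_le[of "(t, s)" "(t', s')"] by (auto simp: d_def dist_real_def)
    \<comment> \<open>The path through \<open>(w, s)\<close> and \<open>(w, s')\<close> stays inside the triangle.\<close>
    define w where "w = max t t'"
    have 1: "norm (Ut t s - Ut w s) \<le> M * d"
      by (rule order_trans[OF lip_t mult_left_mono]) (use m M d in \<open>auto simp: w_def\<close>)
    have 2: "norm (Ut w s - Ut w s') \<le> L * d"
      by (rule order_trans[OF lip_s mult_left_mono]) (use m L d in \<open>auto simp: w_def\<close>)
    have 3: "norm (Ut w s' - Ut t' s') \<le> M * d"
      by (rule order_trans[OF lip_t mult_left_mono]) (use m M d in \<open>auto simp: w_def\<close>)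
    have "dist (Ut t s) (Ut t' s') \<le> M * d + L * d + M * d"
      using norm_triangle_le[OF add_mono[OF norm_triangle_le[OF add_mono[OF 1 2]] 3]]
      by (simp add: dist_norm)
    then show "dist (Ut t s) (Ut t' s') \<le> (M + L + M) * dist (t, s) (t', s')"
      by (simp add: d_def distrib_right)
  qed (use M L in auto)
  then show ?thesis ..
qed

section \<open>Pointwise convergence\<close>

lemma christoffel_darboux:
  "2 * (s - x) * (\<Sum>k\<le>n. legendre01 k s * legendre01 k x) =
     jac n * (legendre01 (Suc n) s * legendre01 n x - legendre01 n s * legendre01 (Suc n) x)"
proof (induction n)
  case 0
  show ?case using legendre01_1[of s] legendre01_1[of x] by (simp add: legendre01_0 algebra_simps)
next
  case (Suc n)
  show ?case
    using Suc.IH legendre01_recurrence[of s n] legendre01_recurrence[of x n]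
    unfolding sum.atMost_Suc by algebra
qed

lemma legendre_coeff_const: "legendre_coeff (\<lambda>x. c) k = (if k = 0 then c else 0)"
proof -
  have "legendre_coeff (\<lambda>x. c) k = legendre_coeff (\<lambda>x. c * of_real (legendre01 0 x)) k"
    by (simp add: legendre01_0)
  then show ?thesis by (simp only: legendre_coeff_scale legendre_coeff_legendre) auto
qed

text \<open>
  By the Christoffel-Darboux formula the error is a combination of two consecutive Legendre coefficients of
  the difference quotient \<open>q\<close> of \<open>h\<close> at \<open>s\<close>, with bounded factors.  The quotient is bounded by the Lipschitz
  condition, so its coefficients tend to \<open>0\<close>.
\<close>

theorem legendre_pointwise_convergence:
  assumes h: "bdd_meas h" and s: "0 < s" "s < 1"
    and lip: "\<And>x. 0 \<le> x \<Longrightarrow> x \<le> 1 \<Longrightarrow> cmod (h x - h s) \<le> L * \<bar>x - s\<bar>"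
  shows "(\<lambda>n. \<Sum>k\<le>n. legendre_coeff h k * of_real (legendre01 k s)) \<longlonglongrightarrow> h s"
proof -
  \<comment> \<open>The value at \<open>s\<close> is \<open>0\<close>, so that \<open>qx\<close> holds there as well.\<close>
  define q where "q x = (h x - h s) / of_real (s - x)" for x
  have qx: "h x - h s = q x * of_real (s - x)" for x by (auto simp: q_def)
  have hs: "bdd_meas (\<lambda>x. h x - h s)" by (intro bdd_meas_diff h bdd_meas_const)
  have q: "bdd_meas q"
  proof (rule bdd_measI)
    have "(\<lambda>x. complex_of_real (s - x)) \<in> borel_measurable lunit"
      by (intro continuous_measurable_lunit continuous_intros)
    then show "q \<in> borel_measurable lunit"
      unfolding q_def[abs_def] using bdd_meas_measurable[OF hs] by measurable
    have L0: "L \<ge> 0"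
    proof -
      have "0 \<le> cmod (h 0 - h s)" by simp
      also have "\<dots> \<le> L * \<bar>0 - s\<bar>" by (rule lip) auto
      finally show ?thesis using s by (simp add: zero_le_mult_iff)
    qed
    fix x :: real assume x: "0 \<le> x" "x \<le> 1"
    show "cmod (q x) \<le> L"
    proof (cases "x = s")
      case False
      then show ?thesis using lip[OF x]
        by (simp add: q_def norm_divide divide_le_eq abs_minus_commute del: of_real_diff)
    qed (use L0 in \<open>simp add: q_def\<close>)
  qed
  obtain K where K: "\<And>n. \<bar>legendre01 n s\<bar> \<le> K" using legendre01_bounded[OF s] by blast
  have diff: "(\<Sum>k\<le>n. legendre_coeff h k * of_real (legendre01 k s)) - h s =
     of_real (jac n / 2) * (of_real (legendre01 (Suc n) s) * legendre_coeff q n - of_real (legendre01 n s) * legendre_coeff q (Suc n))" for n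
  proof -
    have "(\<Sum>k\<le>n. legendre_coeff h k * of_real (legendre01 k s)) - h s =
       (\<Sum>k\<le>n. legendre_coeff (\<lambda>x. h x - h s) k * of_real (legendre01 k s))"
    proof -
      have "(\<Sum>k\<le>n. (if k = 0 then h s else 0) * of_real (legendre01 k s)) = h s"
        by (subst sum.atMost_shift) (simp add: legendre01_0)
      then show ?thesis
        by (simp add: legendre_coeff_diff[OF h bdd_meas_const] legendre_coeff_const left_diff_distrib sum_subtractf)
    qed
    also have "\<dots> = (\<integral>x. (\<Sum>k\<le>n. (h x - h s) * of_real (legendre01 k x) * of_real (legendre01 k s)) \<partial>lunit)"
      unfolding legendre_coeff_def
      by (subst Bochner_Integration.integral_sum) (auto intro!: bdd_meas_integrable bdd_meas_mult hs)
    also have "\<dots> = (\<integral>x. of_real (jac n / 2) * (of_real (legendre01 (Suc n) s) * (q x * of_real (legendre01 n x))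
         - of_real (legendre01 n s) * (q x * of_real (legendre01 (Suc n) x))) \<partial>lunit)"
    proof (rule integral_lunit_cong)
      fix x :: real
      have "(\<Sum>k\<le>n. (h x - h s) * of_real (legendre01 k x) * of_real (legendre01 k s)) =
         q x * of_real ((s - x) * (\<Sum>k\<le>n. legendre01 k s * legendre01 k x))"
        unfolding qx by (simp add: sum_distrib_left mult_ac)
      also have "(s - x) * (\<Sum>k\<le>n. legendre01 k s * legendre01 k x) =
         jac n / 2 * (legendre01 (Suc n) s * legendre01 n x - legendre01 n s * legendre01 (Suc n) x)"
        using christoffel_darboux[of s x n] by (simp add: field_simps)
      finally show "(\<Sum>k\<le>n. (h x - h s) * of_real (legendre01 k x) * of_real (legendre01 k s)) =
         of_real (jac n / 2) * (of_real (legendre01 (Suc n) s) * (q x * of_real (legendre01 n x))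
         - of_real (legendre01 n s) * (q x * of_real (legendre01 (Suc n) x)))"
        by (simp add: algebra_simps)
    qed
    also have "\<dots> = of_real (jac n / 2) * (of_real (legendre01 (Suc n) s) * legendre_coeff q n - of_real (legendre01 n s) * legendre_coeff q (Suc n))"
    proof -
      have "integrable lunit (\<lambda>x. q x * of_real (legendre01 k x))" for k
        by (intro bdd_meas_integrable bdd_meas_mult q bdd_meas_legendre)
      then show ?thesis unfolding legendre_coeff_def by simp
    qed
    finally show ?thesis .
  qed
  have "(\<lambda>n. (\<Sum>k\<le>n. legendre_coeff h k * of_real (legendre01 k s)) - h s) \<longlonglongrightarrow> 0"
  proof (rule Lim_null_comparison)
    have "(\<lambda>n. cmod (legendre_coeff q n)) \<longlonglongrightarrow> 0"
      by (rule tendsto_norm_zero[OF legendre_coeff_tendsto_0[OF q]])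
    moreover from this have "(\<lambda>n. cmod (legendre_coeff q (Suc n))) \<longlonglongrightarrow> 0" by (rule LIMSEQ_Suc)
    ultimately have "(\<lambda>n. 1 / 2 * (K * cmod (legendre_coeff q n) + K * cmod (legendre_coeff q (Suc n)))) \<longlonglongrightarrow> 1 / 2 * (K * 0 + K * 0)"
      by (intro tendsto_intros)
    then show "(\<lambda>n. 1 / 2 * (K * cmod (legendre_coeff q n) + K * cmod (legendre_coeff q (Suc n)))) \<longlonglongrightarrow> 0" by simp
    have "cmod ((\<Sum>k\<le>n. legendre_coeff h k * of_real (legendre01 k s)) - h s)
       \<le> 1 / 2 * (K * cmod (legendre_coeff q n) + K * cmod (legendre_coeff q (Suc n)))" for n
    proof -
      have j: "cmod (complex_of_real (jac n / 2)) \<le> 1 / 2" using jac_pos[of n] jac_le_1[of n] by (simp del: of_real_divide)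
      have t: "cmod (of_real (legendre01 m s) * z) \<le> K * cmod z" for m z
        unfolding norm_mult using K[of m] by (intro mult_right_mono) auto
      have "cmod (of_real (legendre01 (Suc n) s) * legendre_coeff q n - of_real (legendre01 n s) * legendre_coeff q (Suc n))
          \<le> K * cmod (legendre_coeff q n) + K * cmod (legendre_coeff q (Suc n))"
        by (rule order_trans[OF norm_triangle_ineq4 add_mono[OF t t]])
      then show ?thesis unfolding diff norm_mult[of "of_real (jac n / 2)"]
        using j by (intro mult_mono) auto
    qed
    then show "\<forall>\<^sub>F n in sequentially. cmod ((\<Sum>k\<le>n. legendre_coeff h k * of_real (legendre01 k s)) - h s)
       \<le> 1 / 2 * (K * cmod (legendre_coeff q n) + K * cmod (legendre_coeff q (Suc n)))" by simp
  qed
  then show ?thesis by (rule LIM_zero_cancel)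
qed

lemma row_coeff_theta:
  assumes "0 \<le> t" "t \<le> 1"
  shows "row_coeff theta m t = of_real (legendre_int m t)"
proof -
  have "row_coeff theta m t = (\<integral>x. indicator {0..t} x *\<^sub>R complex_of_real (legendre01 m x) \<partial>lunit)"
    unfolding row_coeff_def legendre_coeff_def
    by (rule integral_lunit_cong) (auto simp: heaviside_def indicator_def)
  also have "\<dots> = of_real (legendre_int m t) - of_real (legendre_int m 0)"
    by (rule integral_lunit_FTC[where F="\<lambda>x. complex_of_real (legendre_int m x)"])
      (use assms in \<open>auto intro!: continuous_intros has_vector_derivative_of_real legendre_int_deriv
        simp flip: has_real_derivative_iff_has_vector_derivative\<close>)
  finally show ?thesis by (simp add: legendre_int_at_0)
qed

text \<open>
  The matrix \<open>T\<close> represents integration from \<open>0\<close>; its columns are the expansions of \<open>legendre_int m\<close>.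
\<close>

lemma coeff_mat_theta:
  "coeff_mat theta k m = of_real ((if k = Suc m then prim m else 0) +
      (if m = 0 then if k = 0 then 1 / 2 else 0 else if k = m - 1 then - prim (m - 1) else 0))"
proof -
  let ?r = "\<lambda>x. if m = 0 then 1 / 2 * legendre01 0 x else - prim (m - 1) * legendre01 (m - 1) x"
  have "coeff_mat theta k m = legendre_coeff (\<lambda>x. of_real (prim m) * of_real (legendre01 (Suc m) x) +
      of_real (if m = 0 then 1 / 2 else - prim (m - 1)) * of_real (legendre01 (m - 1) x)) k"
    unfolding coeff_mat_row
  proof (rule legendre_coeff_cong)
    fix x :: real assume "0 \<le> x" "x \<le> 1"
    then show "row_coeff theta m x = of_real (prim m) * of_real (legendre01 (Suc m) x) +
      of_real (if m = 0 then 1 / 2 else - prim (m - 1)) * of_real (legendre01 (m - 1) x)"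
      unfolding row_coeff_theta[OF \<open>0 \<le> x\<close> \<open>x \<le> 1\<close>] legendre_int_eq_sum
      by (auto simp: legendre01_0)
  qed
  then show ?thesis
    unfolding legendre_coeff_add[OF bdd_meas_mult[OF bdd_meas_const bdd_meas_legendre]
        bdd_meas_mult[OF bdd_meas_const bdd_meas_legendre]] legendre_coeff_scale legendre_coeff_legendre
    by auto
qed

lemma inverse_square_tail:
  assumes "M > 0"
  shows "summable (\<lambda>i. 1 / (real (i + M))\<^sup>2)" "(\<Sum>i. 1 / (real (i + M))\<^sup>2) \<le> 2 / real M"
proof -
  have lim: "(\<lambda>i. - 2 / real (i + M)) \<longlonglongrightarrow> 0"
    by (intro LIMSEQ_ignore_initial_segment[where f="\<lambda>i. - 2 / real i"] lim_const_over_n)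
  have T: "(\<lambda>i. - 2 / real (Suc i + M) - - 2 / real (i + M)) sums (0 - - 2 / real (0 + M))"
    by (rule telescope_sums[OF lim])
  have le: "1 / (real (i + M))\<^sup>2 \<le> - 2 / real (Suc i + M) - - 2 / real (i + M)" for i
  proof -
    define x where "x = real (i + M)"
    have x: "x \<ge> 1" using assms by (simp add: x_def)
    have "1 / x\<^sup>2 \<le> 2 / (x * (x + 1))"
      using x by (simp add: divide_simps power2_eq_square)
    also have "\<dots> = - 2 / (x + 1) - - 2 / x" using x by (simp add: field_simps)
    finally show ?thesis by (simp add: x_def add_ac)
  qed
  show S: "summable (\<lambda>i. 1 / (real (i + M))\<^sup>2)"
    by (rule summable_comparison_test'[OF sums_summable[OF T]]) (use le in auto)
  have "(\<Sum>i. 1 / (real (i + M))\<^sup>2) \<le> (\<Sum>i. - 2 / real (Suc i + M) - - 2 / real (i + M))"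
    by (rule suminf_le[OF le S sums_summable[OF T]])
  then show "(\<Sum>i. 1 / (real (i + M))\<^sup>2) \<le> 2 / real M" using sums_unique[OF T] by simp
qed

context
  fixes t s :: real
  assumes t: "0 < t" "t < 1" and s: "0 < s" "s < 1"
begin

text \<open>
  The truncation error at \<open>t\<close> of the (finite) Legendre expansion of \<open>legendre_int m\<close>.
\<close>

definition theta_defect :: "nat \<Rightarrow> nat \<Rightarrow> complex" where
  "theta_defect n m = (\<Sum>k\<le>n. coeff_mat theta k m * of_real (legendre01 k t)) - of_real (legendre_int m t)"

lemma theta_defect_eq:
  "(\<Sum>k\<le>n. coeff_mat theta k m * of_real (legendre01 k t)) =
    of_real ((if Suc m \<le> n then prim m * legendre01 (Suc m) t else 0) +
      (if m - 1 \<le> n then if m = 0 then 1 / 2 else - prim (m - 1) * legendre01 (m - 1) t else 0))"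
proof -
  have "(\<Sum>k\<le>n. coeff_mat theta k m * of_real (legendre01 k t)) =
    of_real ((\<Sum>k\<le>n. if k = Suc m then prim m * legendre01 (Suc m) t else 0) +
     (\<Sum>k\<le>n. if k = m - 1 then (if m = 0 then 1 / 2 else - prim (m - 1) * legendre01 (m - 1) t) else 0))"
    unfolding sum.distrib[symmetric] of_real_sum
    by (rule sum.cong) (auto simp: coeff_mat_theta legendre01_0 algebra_simps)
  then show ?thesis by simp
qed

lemma theta_defect_zero: "m < n \<Longrightarrow> theta_defect n m = 0"
  unfolding theta_defect_def theta_defect_eq legendre_int_eq_sum by auto

lemma theta_defect_bound:
  assumes K: "\<And>n. \<bar>legendre01 n t\<bar> \<le> K" and m: "m > 0"
  shows "cmod (theta_defect n m) \<le> 2 * K / real m"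
proof -
  have K0: "K \<ge> 0" using K[of 0] by simp
  have p: "\<bar>prim m * legendre01 (Suc m) t\<bar> \<le> K / (2 * real m)"
    "\<bar>prim (m - 1) * legendre01 (m - 1) t\<bar> \<le> K / (2 * real m)"
  proof -
    have "\<bar>prim j * legendre01 i t\<bar> \<le> 1 / (2 * real m) * K" if "j \<ge> m - 1" for i j
    proof -
      have "prim j \<le> 1 / (2 * (real j + 1))" by (rule prim_le)
      also have "\<dots> \<le> 1 / (2 * real m)" using that m by (intro divide_left_mono) auto
      finally show ?thesis unfolding abs_mult using prim_pos[of j] K[of i] by (intro mult_mono) auto
    qed
    then show "\<bar>prim m * legendre01 (Suc m) t\<bar> \<le> K / (2 * real m)"
      "\<bar>prim (m - 1) * legendre01 (m - 1) t\<bar> \<le> K / (2 * real m)" by auto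
  qed
  define u v where "u = prim m * legendre01 (Suc m) t" and "v = prim (m - 1) * legendre01 (m - 1) t"
  have "theta_defect n m = of_real (((if Suc m \<le> n then u else 0) + (if m - 1 \<le> n then - v else 0)) - (u - v))"
    unfolding theta_defect_def theta_defect_eq legendre_int_eq_sum using m by (simp add: u_def v_def)
  then have "cmod (theta_defect n m) = \<bar>((if Suc m \<le> n then u else 0) + (if m - 1 \<le> n then - v else 0)) - (u - v)\<bar>"
    by (simp only: norm_of_real)
  also have "\<dots> \<le> \<bar>u\<bar> + \<bar>v\<bar>" by (auto split: if_splits)
  also have "\<dots> \<le> K / (2 * real m) + K / (2 * real m)" using p by (intro add_mono) (simp_all add: u_def v_def)
  also have "\<dots> \<le> 2 * K / real m" using m K0 by (simp add: field_simps)
  finally show ?thesis .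
qed

text \<open>
  Let \<open>x n m\<close> be the inner sum.  Only \<open>m \<ge> n\<close> contributes.  There the squares of the defects sum up to
  \<open>O(1/n)\<close>, whereas \<open>\<bar>x n m\<bar>\<^sup>2 = O(n) h m\<close> with \<open>h m\<close> the squared norm of the \<open>m\<close>-th row of \<open>V\<close>.  The two
  powers of \<open>n\<close> cancel in the Cauchy-Schwarz inequality and a tail of the series of \<open>h\<close> remains.
\<close>

lemma theta_defect_tendsto_0:
  assumes V: "hilbert_schmidt V"
  shows "(\<lambda>n. \<Sum>m. theta_defect n m * (\<Sum>l\<le>n. V m l * of_real (legendre01 l s))) \<longlonglongrightarrow> 0"
proof -
  obtain K1 where K1: "\<And>n. \<bar>legendre01 n t\<bar> \<le> K1" using legendre01_bounded[OF t] by blast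
  obtain K2 where K2: "K2 > 0" "\<And>n. \<bar>legendre01 n s\<bar> \<le> K2" using legendre01_bounded[OF s] by blast
  define h where "h m = (\<Sum>l. (cmod (V m l))\<^sup>2)" for m
  have h: "summable h" unfolding h_def by (rule hilbert_schmidt_row_norms[OF V])
  have row: "summable (\<lambda>l. (cmod (V m l))\<^sup>2)" for m
    using hilbert_schmidt_row[OF V] by (simp add: square_summable_nat)
  have h0: "h m \<ge> 0" for m unfolding h_def by (rule suminf_nonneg[OF row]) simp
  define tail where "tail n = (\<Sum>i. h (i + n))" for n
  have tail0: "tail n \<ge> 0" for n
    unfolding tail_def by (rule suminf_nonneg) (use h h0 in \<open>auto simp: summable_iff_shift\<close>)
  have "(\<lambda>n. suminf h - sum h {..<n}) \<longlonglongrightarrow> suminf h - suminf h"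
    by (intro tendsto_intros summable_LIMSEQ h)
  then have tail: "tail \<longlonglongrightarrow> 0"
    unfolding tail_def[abs_def] using suminf_minus_initial_segment[OF h] by simp
  define x where "x n m = (\<Sum>l\<le>n. V m l * of_real (legendre01 l s))" for n m
  have x: "(cmod (x n m))\<^sup>2 \<le> h m * (K2\<^sup>2 * (real n + 1))" for n m
  proof -
    have "cmod (x n m) \<le> (\<Sum>l\<le>n. cmod (V m l * of_real (legendre01 l s)))" unfolding x_def by (rule norm_sum)
    also have "\<dots> \<le> sqrt (h m) * sqrt (K2\<^sup>2 * (real n + 1))"
    proof (rule sum_norm_mult_le)
      show "(\<Sum>l\<le>n. (cmod (V m l))\<^sup>2) \<le> (sqrt (h m))\<^sup>2"
        using h0 unfolding h_def by (simp add: sum_le_suminf[OF row])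
      have "(\<Sum>l\<le>n. (cmod (complex_of_real (legendre01 l s)))\<^sup>2) \<le> (\<Sum>l\<le>n. K2\<^sup>2)"
        using K2 by (intro sum_mono power_mono) auto
      then show "(\<Sum>l\<le>n. (cmod (complex_of_real (legendre01 l s)))\<^sup>2) \<le> (sqrt (K2\<^sup>2 * (real n + 1)))\<^sup>2"
        by (simp add: algebra_simps)
    qed (use h0 in auto)
    finally have "(cmod (x n m))\<^sup>2 \<le> (sqrt (h m) * sqrt (K2\<^sup>2 * (real n + 1)))\<^sup>2" by (rule power_mono) simp
    then show ?thesis using h0 by (simp add: power_mult_distrib)
  qed
  \<comment> \<open>The constant is \<open>(2 K1)\<^sup>2 (2/n) K2\<^sup>2 (n + 1) \<le> 16 K1\<^sup>2 K2\<^sup>2\<close>.\<close>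
  have main: "cmod (\<Sum>m. theta_defect n m * x n m) \<le> sqrt (16 * K1\<^sup>2 * K2\<^sup>2 * tail n)" if n: "n > 0" for n
  proof -
    define d y where "d i = theta_defect n (i + n)" and "y i = x n (i + n)" for i
    have db: "(cmod (d i))\<^sup>2 \<le> (2 * K1)\<^sup>2 * (1 / (real (i + n))\<^sup>2)" for i
    proof -
      have "cmod (d i) \<le> 2 * K1 / real (i + n)" unfolding d_def by (rule theta_defect_bound[OF K1]) (use n in auto)
      then have "(cmod (d i))\<^sup>2 \<le> (2 * K1 / real (i + n))\<^sup>2" by (rule power_mono) simp
      then show ?thesis by (simp add: power_divide)
    qed
    have hs: "summable (\<lambda>i. h (i + n))" using h by (simp add: summable_iff_shift)
    have ds: "summable (\<lambda>i. (cmod (d i))\<^sup>2)"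
      by (rule summable_comparison_test'[OF summable_mult[OF inverse_square_tail(1)[OF n]]]) (use db in auto)
    have ys: "summable (\<lambda>i. (cmod (y i))\<^sup>2)"
      by (rule summable_comparison_test'[OF summable_mult2[OF hs]]) (use x in \<open>auto simp: y_def\<close>)
    have D: "(\<Sum>i. (cmod (d i))\<^sup>2) \<le> (2 * K1)\<^sup>2 * (2 / real n)"
    proof -
      have "(\<Sum>i. (cmod (d i))\<^sup>2) \<le> (\<Sum>i. (2 * K1)\<^sup>2 * (1 / (real (i + n))\<^sup>2))"
        by (rule suminf_le[OF db ds summable_mult[OF inverse_square_tail(1)[OF n]]])
      also have "\<dots> = (2 * K1)\<^sup>2 * (\<Sum>i. 1 / (real (i + n))\<^sup>2)" by (rule suminf_mult[OF inverse_square_tail(1)[OF n]])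
      also have "\<dots> \<le> (2 * K1)\<^sup>2 * (2 / real n)" by (intro mult_left_mono inverse_square_tail(2)[OF n]) auto
      finally show ?thesis .
    qed
    have Y: "(\<Sum>i. (cmod (y i))\<^sup>2) \<le> tail n * (K2\<^sup>2 * (real n + 1))"
    proof -
      have "(\<Sum>i. (cmod (y i))\<^sup>2) \<le> (\<Sum>i. h (i + n) * (K2\<^sup>2 * (real n + 1)))"
        by (rule suminf_le[OF _ ys summable_mult2[OF hs]]) (use x in \<open>auto simp: y_def\<close>)
      also have "\<dots> = tail n * (K2\<^sup>2 * (real n + 1))" unfolding tail_def by (rule suminf_mult2[OF hs, symmetric])
      finally show ?thesis .
    qed
    have sdy: "summable (\<lambda>i. d i * y i)"
      by (rule square_summable_mult_suminf) (use ds ys in \<open>auto simp: square_summable_nat\<close>)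
    have "(\<Sum>m. theta_defect n m * x n m) = (\<Sum>i. d i * y i)"
    proof -
      have "summable (\<lambda>m. theta_defect n m * x n m)"
        using sdy unfolding d_def y_def by (subst (asm) summable_iff_shift)
      from suminf_split_initial_segment[OF this, of n] show ?thesis
        by (simp add: d_def y_def theta_defect_zero)
    qed
    then have "(cmod (\<Sum>m. theta_defect n m * x n m))\<^sup>2 \<le> (\<Sum>i. (cmod (d i))\<^sup>2) * (\<Sum>i. (cmod (y i))\<^sup>2)"
      using cauchy_schwarz_suminf[of d y] ds ys by (simp add: square_summable_nat)
    also have "\<dots> \<le> ((2 * K1)\<^sup>2 * (2 / real n)) * (tail n * (K2\<^sup>2 * (real n + 1)))"
      using D Y by (intro mult_mono) (auto intro!: suminf_nonneg ds ys)
    also have "\<dots> = (4 * K1\<^sup>2 * K2\<^sup>2 * tail n) * (2 * (real n + 1) / real n)"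
      by (simp add: power_mult_distrib mult_ac)
    also have "\<dots> \<le> (4 * K1\<^sup>2 * K2\<^sup>2 * tail n) * 4"
      using n tail0[of n] by (intro mult_left_mono) (auto simp: field_simps)
    finally show ?thesis by (intro real_le_rsqrt) simp
  qed
  have "(\<lambda>n. \<Sum>m. theta_defect n m * x n m) \<longlonglongrightarrow> 0"
  proof (rule Lim_null_comparison)
    show "\<forall>\<^sub>F n in sequentially. cmod (\<Sum>m. theta_defect n m * x n m) \<le> sqrt (16 * K1\<^sup>2 * K2\<^sup>2 * tail n)"
      using eventually_gt_at_top[of 0] by eventually_elim (rule main)
    have "(\<lambda>n. sqrt (16 * K1\<^sup>2 * K2\<^sup>2 * tail n)) \<longlonglongrightarrow> sqrt (16 * K1\<^sup>2 * K2\<^sup>2 * 0)"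
      by (intro tendsto_intros tail)
    then show "(\<lambda>n. sqrt (16 * K1\<^sup>2 * K2\<^sup>2 * tail n)) \<longlonglongrightarrow> 0" by simp
  qed
  then show ?thesis unfolding x_def .
qed

text \<open>
  Sum over the first index at first.  The row coefficients of \<open>w\<close> at \<open>t\<close> are limits of these inner sums, with
  errors that are linear in the defects: \<open>E1\<close> comes from \<open>\<Theta>\<close>, where only the last column has a defect, and
  \<open>E2\<close> from \<open>\<Theta> \<star> v\<close>.  What remains is the one-dimensional Legendre series of \<open>w t\<close> at \<open>s\<close>.
\<close>

theorem legendre_limit_theta_star:
  assumes v: "volterra v" and w: "\<And>a b. a \<in> {0..1} \<Longrightarrow> b \<in> {0..1} \<Longrightarrow> w a b = c * theta a b + star theta v a b"
    and lip: "\<And>x. 0 \<le> x \<Longrightarrow> x \<le> 1 \<Longrightarrow> cmod (w t x - w t s) \<le> L * \<bar>x - s\<bar>"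
  shows "legendre_limit (coeff_mat w) t s (w t s)"
proof -
  define V where "V = coeff_mat v"
  have V: "hilbert_schmidt V" unfolding V_def by (rule hilbert_schmidt_coeff_mat[OF v])
  define w' where "w' a b = c * theta a b + star theta v a b" for a b
  have vs: "volterra (star theta v)" by (rule volterra_star[OF volterra_theta v])
  have w': "volterra w'" unfolding w'_def by (intro volterra_add volterra_scale volterra_theta vs)
  have ww: "w a b = w' a b" if "a \<in> {0..1}" "b \<in> {0..1}" for a b using w[OF that] by (simp add: w'_def)
  have W: "coeff_mat w k l = c * coeff_mat theta k l + coeff_mat (star theta v) k l" for k l
  proof -
    have "coeff_mat w = coeff_mat w'" by (rule coeff_mat_cong) (use ww in auto)
    then show ?thesis unfolding w'_def
      by (simp add: coeff_mat_add[OF volterra_scale[OF volterra_theta] vs] coeff_mat_scale)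
  qed
  have R: "legendre_coeff (w t) l = c * of_real (legendre_int l t) + (\<Sum>m. V m l * of_real (legendre_int m t))"
    and Rs: "summable (\<lambda>m. V m l * of_real (legendre_int m t))" for l
  proof -
    have tt: "0 \<le> t" "t \<le> 1" using t by auto
    have "legendre_coeff (w t) l = row_coeff w' l t"
      unfolding row_coeff_def by (rule legendre_coeff_cong) (use ww tt in auto)
    also have "\<dots> = c * row_coeff theta l t + row_coeff (star theta v) l t"
      unfolding w'_def row_coeff_def
        legendre_coeff_add[OF bdd_meas_mult[OF bdd_meas_const volterra_bdd_meas_row[OF volterra_theta tt]]
          volterra_bdd_meas_row[OF vs tt]] legendre_coeff_scale ..
    finally have 1: "legendre_coeff (w t) l = c * of_real (legendre_int l t) + row_coeff (star theta v) l t"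
      unfolding row_coeff_theta[OF tt] .
    have 2: "row_coeff (star theta v) l t = (\<integral>x. row_coeff v l x * theta t x \<partial>lunit)"
      unfolding row_coeff_star[OF volterra_theta v tt] by (simp add: mult.commute)
    have "(\<lambda>m. legendre_coeff (row_coeff v l) m * legendre_coeff (theta t) m) sums (\<integral>x. row_coeff v l x * theta t x \<partial>lunit)"
      by (rule parseval[OF continuous_on_row_coeff[OF v] volterra_bdd_meas_row[OF volterra_theta tt]])
    then have "(\<lambda>m. V m l * of_real (legendre_int m t)) sums row_coeff (star theta v) l t"
      unfolding 2 V_def coeff_mat_row[of v] row_coeff_theta[OF tt, symmetric] row_coeff_def[of theta] .
    then show "legendre_coeff (w t) l = c * of_real (legendre_int l t) + (\<Sum>m. V m l * of_real (legendre_int m t))"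
      "summable (\<lambda>m. V m l * of_real (legendre_int m t))"
      using 1 by (auto simp: sums_iff)
  qed
  define E1 where "E1 n = c * theta_defect n n * of_real (legendre01 n s)" for n
  define E2 where "E2 n = (\<Sum>m. theta_defect n m * (\<Sum>l\<le>n. V m l * of_real (legendre01 l s)))" for n
  have split: "(\<Sum>k\<le>n. \<Sum>l\<le>n. coeff_mat w k l * of_real (legendre01 k t) * of_real (legendre01 l s)) =
     (\<Sum>l\<le>n. legendre_coeff (w t) l * of_real (legendre01 l s)) + E1 n + E2 n" for n
  proof -
    have inner: "(\<lambda>m. V m l * theta_defect n m) sums
      ((\<Sum>k\<le>n. coeff_mat w k l * of_real (legendre01 k t)) - legendre_coeff (w t) l - c * theta_defect n l)" for l
    proof -
      have "(\<lambda>m. \<Sum>k\<le>n. coeff_mat theta k m * V m l * of_real (legendre01 k t)) sums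
         (\<Sum>k\<le>n. coeff_mat (star theta v) k l * of_real (legendre01 k t))"
        unfolding V_def by (intro sums_sum sums_mult2 coeff_mat_star volterra_theta v)
      from sums_diff[OF this summable_sums[OF Rs[of l]]]
      have "(\<lambda>m. V m l * theta_defect n m) sums
        ((\<Sum>k\<le>n. coeff_mat (star theta v) k l * of_real (legendre01 k t)) - (\<Sum>m. V m l * of_real (legendre_int m t)))"
        unfolding theta_defect_def by (simp add: right_diff_distrib sum_distrib_left mult_ac)
      also have "(\<Sum>k\<le>n. coeff_mat (star theta v) k l * of_real (legendre01 k t)) - (\<Sum>m. V m l * of_real (legendre_int m t)) =
         (\<Sum>k\<le>n. coeff_mat w k l * of_real (legendre01 k t)) - legendre_coeff (w t) l - c * theta_defect n l"
        unfolding R W theta_defect_def by (simp add: distrib_right sum.distrib sum_distrib_left algebra_simps)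
      finally show ?thesis .
    qed
    have "(\<lambda>m. \<Sum>l\<le>n. V m l * theta_defect n m * of_real (legendre01 l s)) sums
       (\<Sum>l\<le>n. ((\<Sum>k\<le>n. coeff_mat w k l * of_real (legendre01 k t)) - legendre_coeff (w t) l - c * theta_defect n l) * of_real (legendre01 l s))"
      by (intro sums_sum sums_mult2 inner)
    then have "E2 n = (\<Sum>l\<le>n. ((\<Sum>k\<le>n. coeff_mat w k l * of_real (legendre01 k t)) - legendre_coeff (w t) l - c * theta_defect n l) * of_real (legendre01 l s))"
      unfolding E2_def by (simp add: sums_iff sum_distrib_left mult_ac)
    also have "\<dots> = (\<Sum>l\<le>n. (\<Sum>k\<le>n. coeff_mat w k l * of_real (legendre01 k t)) * of_real (legendre01 l s))
        - (\<Sum>l\<le>n. legendre_coeff (w t) l * of_real (legendre01 l s)) - (\<Sum>l\<le>n. c * theta_defect n l * of_real (legendre01 l s))"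
      by (simp only: left_diff_distrib sum_subtractf)
    also have "(\<Sum>l\<le>n. c * theta_defect n l * of_real (legendre01 l s)) = E1 n"
    proof -
      have "(\<Sum>l\<le>n. c * theta_defect n l * of_real (legendre01 l s)) = (\<Sum>l\<in>{n}. c * theta_defect n l * of_real (legendre01 l s))"
        by (rule sum.mono_neutral_right) (auto simp: theta_defect_zero)
      then show ?thesis by (simp add: E1_def)
    qed
    also have "(\<Sum>l\<le>n. (\<Sum>k\<le>n. coeff_mat w k l * of_real (legendre01 k t)) * of_real (legendre01 l s)) =
       (\<Sum>k\<le>n. \<Sum>l\<le>n. coeff_mat w k l * of_real (legendre01 k t) * of_real (legendre01 l s))"
      unfolding sum_distrib_right by (rule sum.swap)
    finally show ?thesis by (simp add: algebra_simps)
  qed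
  have "bdd_meas (w' t)" by (rule volterra_bdd_meas_row[OF w']) (use t in auto)
  then have "(\<lambda>n. \<Sum>l\<le>n. legendre_coeff (w' t) l * of_real (legendre01 l s)) \<longlonglongrightarrow> w' t s"
    by (rule legendre_pointwise_convergence[OF _ s, where L=L]) (use lip ww t s in auto)
  moreover have "legendre_coeff (w' t) l = legendre_coeff (w t) l" for l
    by (rule legendre_coeff_cong) (use ww t in auto)
  ultimately have main: "(\<lambda>n. \<Sum>l\<le>n. legendre_coeff (w t) l * of_real (legendre01 l s)) \<longlonglongrightarrow> w t s"
    using ww[of t s] t s by simp
  obtain K1 where K1: "\<And>n. \<bar>legendre01 n t\<bar> \<le> K1" using legendre01_bounded[OF t] by blast
  obtain K2 where K2: "\<And>n. \<bar>legendre01 n s\<bar> \<le> K2" using legendre01_bounded[OF s] by blast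
  have E1: "E1 \<longlonglongrightarrow> 0"
  proof (rule Lim_null_comparison)
    show "(\<lambda>n. (cmod c * (2 * K1) * K2) / real n) \<longlonglongrightarrow> 0" by (rule lim_const_over_n)
    show "\<forall>\<^sub>F n in sequentially. cmod (E1 n) \<le> (cmod c * (2 * K1) * K2) / real n"
      using eventually_gt_at_top[of 0]
    proof eventually_elim
      case (elim n)
      have "cmod (E1 n) \<le> cmod c * (2 * K1 / real n) * K2"
        unfolding E1_def norm_mult using theta_defect_bound[OF K1 elim, of n] K2[of n]
        by (intro mult_mono mult_nonneg_nonneg) (auto intro: order_trans[OF norm_ge_zero])
      then show ?case by simp
    qed
  qed
  have E2: "E2 \<longlonglongrightarrow> 0" unfolding E2_def[abs_def] by (rule theta_defect_tendsto_0[OF V])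
  show ?thesis unfolding legendre_limit_def split
    using tendsto_add[OF tendsto_add[OF main E1] E2] by simp
qed

end

section \<open>The solution in the Legendre basis\<close>

lemma continuous_on_entry:
  fixes F :: "'a::topological_space \<Rightarrow> complex^'n^'m"
  assumes "continuous_on S F" shows "continuous_on S (\<lambda>x. F x $ k $ l)"
  by (intro bounded_linear.continuous_on[OF bounded_linear_vec_nth] assms)

lemma continuous_on_matrix_mult:
  fixes F G :: "'a::topological_space \<Rightarrow> complex^'n^'n"
  assumes "continuous_on S F" "continuous_on S G" shows "continuous_on S (\<lambda>x. F x ** G x)"
  unfolding matrix_matrix_mult_def
  by (intro continuous_on_vec_lambda continuous_on_sum continuous_on_mult continuous_on_entry assms)

lemma entry_heaviside:
  "entry (\<lambda>t s. heaviside (t - s) *\<^sub>R F t s) k l = (\<lambda>t s. theta t s * F t s $ k $ l)"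
  by (simp add: entry_def scaleR_conv_of_real[where 'a=complex])

lemma mvolterra_heaviside:
  assumes "continuous_on triangle (\<lambda>(t, s). F t s)"
  shows "mvolterra (\<lambda>t s. heaviside (t - s) *\<^sub>R F t s)"
  unfolding mvolterra_def entry_heaviside
proof (intro allI volterra_heaviside_mult)
  fix k l
  show "continuous_on triangle (\<lambda>(t, s). F t s $ k $ l)"
    using continuous_on_entry[OF assms, of k l] by (simp add: case_prod_unfold)
qed

lemma block_coeff_mat_theta:
  "block_coeff_mat (\<lambda>t s. heaviside (t - s) *\<^sub>R (mat 1 :: complex^'n^'n)) = block_diag (coeff_mat theta)"
proof (intro ext)
  fix k l :: 'n and i j
  have "entry (\<lambda>t s. heaviside (t - s) *\<^sub>R (mat 1 :: complex^'n^'n)) k l = (\<lambda>t s. (if k = l then 1 else 0) * theta t s)"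
    unfolding entry_heaviside by (simp add: mat_def)
  then show "block_coeff_mat (\<lambda>t s. heaviside (t - s) *\<^sub>R (mat 1 :: complex^'n^'n)) k l i j = block_diag (coeff_mat theta) k l i j"
    unfolding block_coeff_mat_def block_diag_def by (simp only: coeff_mat_scale) simp
qed

lemma block_mult_conv_flat:
  assumes "\<And>k l i j. (\<lambda>(q, m). X k q i m * Y q l m j) summable_on UNIV"
  shows "block_mult_conv X Y"
  unfolding block_mult_conv_def
proof (intro allI)
  fix k q l i j
  show "summable (\<lambda>m. X k q i m * Y q l m j)"
    using summable_on_SigmaD1[of "\<lambda>q m. X k q i m * Y q l m j" UNIV "\<lambda>_. UNIV" q] assms[of k i l j]
    by (intro summable_on_imp_summable) simp
qed

lemma star_theta_FTC:
  assumes ode: "\<And>x. s \<le> x \<Longrightarrow> x \<le> 1 \<Longrightarrow> (F has_vector_derivative f x) (at x within {s..1})"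
    and f: "continuous_on {s..1} f" and ts: "0 \<le> s" "s \<le> t" "t \<le> 1"
  shows "star theta (\<lambda>x s. theta x s * f x) t s = F t - F s"
proof -
  have "star theta (\<lambda>x s. theta x s * f x) t s = (\<integral>x. indicator {s..t} x *\<^sub>R f x \<partial>lunit)"
    unfolding star_eq by (rule integral_lunit_cong) (auto simp: heaviside_def indicator_def)
  also have "\<dots> = F t - F s"
  proof (rule integral_lunit_FTC)
    show "(F has_vector_derivative f x) (at x within {s..t})" if "s \<le> x" "x \<le> t" for x
      by (rule has_vector_derivative_within_subset[OF ode]) (use that ts in auto)
    show "continuous_on {s..t} f" by (rule continuous_on_subset[OF f]) (use ts in auto)
  qed (use ts in auto)
  finally show ?thesis .
qed

text \<open>
  Points on different sides of the jump at \<open>t\<close> satisfy \<open>\<bar>x - s\<bar> \<ge> \<bar>t - s\<bar>\<close>, so there the crude bound \<open>2 K\<close>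
  suffices.
\<close>

lemma lipschitz_off_jump:
  fixes g :: "real \<Rightarrow> complex"
  assumes lip: "\<And>x. 0 \<le> x \<Longrightarrow> x \<le> t \<Longrightarrow> s \<le> t \<Longrightarrow> cmod (g x - g s) \<le> L * \<bar>x - s\<bar>"
    and zero: "\<And>x. t < x \<Longrightarrow> g x = 0" and bound: "\<And>x. 0 \<le> x \<Longrightarrow> x \<le> 1 \<Longrightarrow> cmod (g x) \<le> K"
    and L: "L \<ge> 0" and K: "K \<ge> 0" and ts: "t \<noteq> s" "0 \<le> s" "s \<le> 1" and x: "0 \<le> x" "x \<le> 1"
  shows "cmod (g x - g s) \<le> (L + 2 * K / \<bar>t - s\<bar>) * \<bar>x - s\<bar>"
proof -
  have split: "(L + 2 * K / \<bar>t - s\<bar>) * \<bar>x - s\<bar> = L * \<bar>x - s\<bar> + 2 * K / \<bar>t - s\<bar> * \<bar>x - s\<bar>"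
    by (rule distrib_right)
  have nn: "L * \<bar>x - s\<bar> \<ge> 0" "2 * K / \<bar>t - s\<bar> * \<bar>x - s\<bar> \<ge> 0" using L K by auto
  consider "x \<le> t" "s \<le> t" | "t < x" "t < s" | "\<bar>t - s\<bar> \<le> \<bar>x - s\<bar>" by linarith
  then show ?thesis
  proof cases
    case 1 then show ?thesis using lip[OF x(1)] nn split by linarith
  next
    case 2 then show ?thesis using zero[of x] zero[of s] nn split by simp
  next
    case 3
    have "cmod (g x - g s) \<le> cmod (g x) + cmod (g s)" by (rule norm_triangle_ineq4)
    also have "\<dots> \<le> 2 * K" using bound[OF x] bound[of s] ts by simp
    also have "\<dots> \<le> 2 * K / \<bar>t - s\<bar> * \<bar>x - s\<bar>"
      using 3 ts K by (simp add: pos_le_divide_eq mult_left_mono)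
    finally show ?thesis using nn split by linarith
  qed
qed

theorem mainTheorem4:
  fixes At :: "real \<Rightarrow> complex ^ 'n ^ ('n::finite)"
    and Bt Ut U A B C :: "real \<Rightarrow> real \<Rightarrow> complex ^ 'n ^ 'n"
    and UU AA BB CC TT :: "'n blockmat"
  assumes A_analytic: "\<And>k l. analytic1 (\<lambda>t. At t $ k $ l)"
    and B_analytic: "\<And>k l. analytic2 (\<lambda>t s. Bt t s $ k $ l)"
    and ode: "\<And>t s. 0 \<le> s \<Longrightarrow> s \<le> t \<Longrightarrow> t \<le> 1 \<Longrightarrow>
       ((\<lambda>\<tau>. Ut \<tau> s) has_vector_derivative (At t ** Ut t s + Bt t s)) (at t within {s..1})"
    and init: "\<And>s. 0 \<le> s \<Longrightarrow> s \<le> 1 \<Longrightarrow> Ut s s = mat 1"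
  defines "U \<equiv> \<lambda>t s. heaviside (t - s) *\<^sub>R Ut t s"
    and "A \<equiv> \<lambda>t s. heaviside (t - s) *\<^sub>R At t"
    and "B \<equiv> \<lambda>t s. heaviside (t - s) *\<^sub>R Bt t s"
    and "C \<equiv> star_series A"
    and "UU \<equiv> block_coeff_mat U"
    and "AA \<equiv> block_coeff_mat A"
    and "BB \<equiv> block_coeff_mat B"
    and "CC \<equiv> block_coeff_mat C"
    and "TT \<equiv> block_diag (coeff_mat (\<lambda>t s. of_real (heaviside (t - s))))"
  shows "(\<forall>t\<in>{0..1}. \<forall>s\<in>{0..1}. summable (\<lambda>m. star_pow_Suc A m t s)) \<and>
    is_block_inverse (block_diff block_one AA) (block_add block_one CC) \<and>
    block_inverse (block_diff block_one AA) = block_add block_one CC \<and>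
    block_mult_conv TT (block_add block_one CC) \<and>
    block_mult_conv (block_mult TT (block_add block_one CC)) (block_add block_one BB) \<and>
    UU = block_mult (block_mult TT (block_add block_one CC)) (block_add block_one BB) \<and>
    UU = block_mult (block_mult TT (block_inverse (block_diff block_one AA)))
           (block_add block_one BB) \<and>
    (\<forall>k l. \<forall>t\<in>{0<..<1}. \<forall>s\<in>{0<..<1}. t \<noteq> s \<longrightarrow>
       legendre_limit (UU k l) t s (U t s $ k $ l))"
proof -
  have contA: "continuous_on {0..1} At"
  proof -
    have "continuous_on {0..1} (\<lambda>t. \<chi> k l. At t $ k $ l)"
      by (intro continuous_on_vec_lambda analytic1_continuous A_analytic)
    then show ?thesis by simp
  qed
  have "\<exists>L. L-lipschitz_on ({0..1} \<times> {0..1}) (\<lambda>(t, s). Bt t s)"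
    by (rule lipschitz_matrix) (use analytic2_lipschitz_jointly[OF B_analytic] in \<open>simp add: case_prod_unfold\<close>)
  then obtain LB where lipB: "LB-lipschitz_on ({0..1} \<times> {0..1}) (\<lambda>(t, s). Bt t s)" ..
  have "\<exists>L. L-lipschitz_on triangle (\<lambda>(t, s). Ut t s)"
    by (rule ode_solution_lipschitz[OF contA lipB ode init])
  then obtain L where lipU: "L-lipschitz_on triangle (\<lambda>(t, s). Ut t s)" ..
  have L0: "L \<ge> 0" by (rule lipschitz_on_nonneg[OF lipU])

  have cU: "continuous_on triangle (\<lambda>(t, s). Ut t s)" by (rule lipschitz_on_continuous_on[OF lipU])
  have cB: "continuous_on triangle (\<lambda>(t, s). Bt t s)"
    by (rule continuous_on_subset[OF lipschitz_on_continuous_on[OF lipB]]) auto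
  have cA: "continuous_on triangle (\<lambda>(t, s). At t)"
    unfolding case_prod_unfold
    by (rule continuous_on_compose2[OF contA continuous_on_fst[OF continuous_on_id]]) auto
  define f where "f t s = At t ** Ut t s + Bt t s" for t s
  have cf: "continuous_on triangle (\<lambda>(t, s). f t s)"
    using continuous_on_add[OF continuous_on_matrix_mult[OF cA cU] cB] by (simp add: f_def case_prod_unfold)
  \<comment> \<open>The derivative of \<open>U\<close> off the diagonal.\<close>
  define V where "V = (\<lambda>t s. heaviside (t - s) *\<^sub>R f t s)"
  define \<Theta> where "\<Theta> = (\<lambda>t s. heaviside (t - s) *\<^sub>R (mat 1 :: complex^'n^'n))"
  have mU: "mvolterra U" unfolding U_def by (rule mvolterra_heaviside[OF cU])
  have mA: "mvolterra A" unfolding A_def by (rule mvolterra_heaviside[OF cA])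
  have mB: "mvolterra B" unfolding B_def by (rule mvolterra_heaviside[OF cB])
  have mV: "mvolterra V" unfolding V_def by (rule mvolterra_heaviside[OF cf])
  have mT: "mvolterra \<Theta>" unfolding \<Theta>_def by (rule mvolterra_heaviside) (simp add: case_prod_unfold)
  note mC = neumann_series(2)[OF mA, folded C_def]

  have primitive: "star theta (entry V k l) t s = theta t s * (Ut t s $ k $ l - mat 1 $ k $ l)"
    if ts: "t \<in> {0..1}" "s \<in> {0..1}" for k l t s
  proof (cases "s \<le> t")
    case True
    have "star theta (entry V k l) t s = star theta (\<lambda>x s'. theta x s' * f x s $ k $ l) t s"
      unfolding V_def entry_heaviside by (rule star_cong) auto
    also have "\<dots> = Ut t s $ k $ l - Ut s s $ k $ l"
    proof (rule star_theta_FTC)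
      fix x assume x: "s \<le> x" "x \<le> 1"
      have "((\<lambda>\<tau>. Ut \<tau> s) has_vector_derivative f x s) (at x within {s..1})"
        unfolding f_def by (rule ode) (use x ts in auto)
      then show "((\<lambda>x. Ut x s $ k $ l) has_vector_derivative f x s $ k $ l) (at x within {s..1})"
        by (intro bounded_linear.has_vector_derivative[OF bounded_linear_vec_nth])
    next
      have "continuous_on {s..1} (\<lambda>x. (\<lambda>(t, s). f t s) (x, s))"
        by (rule continuous_on_compose2[OF cf]) (use ts in \<open>auto intro!: continuous_intros\<close>)
      then show "continuous_on {s..1} (\<lambda>x. f x s $ k $ l)" by (intro continuous_on_entry) simp
    qed (use ts True in auto)
    finally show ?thesis using True ts init[of s] by (simp add: heaviside_def)
  next
    case False
    then show ?thesis
      using volterra_zero[OF volterra_star[OF volterra_theta mvolterraD[OF mV]], of t s k l] by (simp add: heaviside_def)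
  qed
  have entryU: "entry U k l t s = mat 1 $ k $ l * theta t s + star theta (entry V k l) t s"
    if "t \<in> {0..1}" "s \<in> {0..1}" for k l t s
    unfolding primitive[OF that] U_def entry_heaviside by (simp add: algebra_simps)
  have kernelU: "U t s = \<Theta> t s + mstar \<Theta> V t s" if ts: "t \<in> {0..1}" "s \<in> {0..1}" for t s
  proof -
    have "mstar \<Theta> V t s $ k $ l = star theta (entry V k l) t s" for k l
    proof -
      have "star (entry \<Theta> k j) (entry V j l) t s = (if k = j then star theta (entry V j l) t s else 0)" for j
        unfolding \<Theta>_def entry_heaviside star_eq by (simp add: mat_def)
      then show ?thesis by (simp add: mstar_def)
    qed
    moreover have "\<Theta> t s $ k $ l = mat 1 $ k $ l * theta t s" for k l
      by (simp add: \<Theta>_def scaleR_conv_of_real[where 'a=complex])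
    ultimately show ?thesis using entryU[OF ts] by (simp add: vec_eq_iff entry_def)
  qed
  have kernelV: "V t s = A t s + mstar A V t s + B t s" if ts: "t \<in> {0..1}" "s \<in> {0..1}" for t s
  proof -
    have "mstar A V t s $ k $ l = theta t s * ((At t ** Ut t s) $ k $ l - At t $ k $ l)" for k l
    proof -
      have "star (entry A k j) (entry V j l) t s = At t $ k $ j * star theta (entry V j l) t s" for j
        unfolding A_def entry_heaviside[of "\<lambda>t s. At t"] star_eq
        by (simp only: mult.assoc mult.left_commute[of _ "At t $ k $ j"] integral_mult_right_zero)
      then have "mstar A V t s $ k $ l = theta t s * ((\<Sum>j\<in>UNIV. At t $ k $ j * Ut t s $ j $ l) - (\<Sum>j\<in>UNIV. At t $ k $ j * mat 1 $ j $ l))"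
        by (simp add: mstar_def primitive[OF ts] right_diff_distrib mult.left_commute[of _ "theta t s"]
            sum_distrib_left sum_subtractf)
      also have "(\<Sum>j\<in>UNIV. At t $ k $ j * mat 1 $ j $ l) = (At t ** mat 1) $ k $ l"
        by (simp add: matrix_matrix_mult_def)
      also have "(\<Sum>j\<in>UNIV. At t $ k $ j * Ut t s $ j $ l) = (At t ** Ut t s) $ k $ l"
        by (simp add: matrix_matrix_mult_def)
      finally show ?thesis by simp
    qed
    then show ?thesis
      by (simp add: vec_eq_iff V_def A_def B_def f_def scaleR_conv_of_real[where 'a=complex] algebra_simps)
  qed

  define VV where "VV = block_coeff_mat V"
  have TT: "TT = block_coeff_mat \<Theta>" unfolding TT_def \<Theta>_def by (rule block_coeff_mat_theta[symmetric])
  have hT: "block_hs TT" and hA: "block_hs AA" and hB: "block_hs BB" and hC: "block_hs CC" and hV: "block_hs VV"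
    unfolding TT AA_def BB_def CC_def VV_def by (intro block_hs_coeff mT mA mB mC mV)+
  note l2 = block_hs_rows block_hs_cols block_add_one_rows block_add_one_cols block_one_rows block_one_cols hT hA hB hC hV
  have UU: "UU = block_mult TT (block_add block_one VV)"
  proof -
    have "UU = block_coeff_mat (\<lambda>t s. \<Theta> t s + mstar \<Theta> V t s)"
      unfolding UU_def by (rule block_coeff_mat_cong) (use kernelU in auto)
    also have "\<dots> = block_add TT (block_mult TT VV)"
      unfolding TT VV_def by (simp add: block_coeff_mat_add mvolterra_mstar block_coeff_mat_mstar mT mV)
    also have "\<dots> = block_mult TT (block_add block_one VV)"
      by (subst block_mult_add_right) (auto intro: block_mult_conv_l2 l2 simp: block_mult_one_right)
    finally show ?thesis .
  qed
  have VV: "VV = block_add (block_add AA (block_mult AA VV)) BB"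
  proof -
    have "VV = block_coeff_mat (\<lambda>t s. (A t s + mstar A V t s) + B t s)"
      unfolding VV_def by (rule block_coeff_mat_cong) (use kernelV in auto)
    then show ?thesis
      unfolding AA_def BB_def VV_def
      by (simp add: block_coeff_mat_add mvolterra_mstar mvolterra_add block_coeff_mat_mstar mA mB mV)
  qed
  have "block_mult (block_diff block_one AA) (block_add block_one VV) =
      block_diff (block_add block_one VV) (block_add AA (block_mult AA VV))"
    by (subst block_one_minus_mult, (intro l2)+, subst block_mult_add_right)
      (auto intro: block_mult_conv_l2 l2 simp: block_mult_one_right)
  also have "\<dots> = block_add block_one BB"
    using VV by (simp add: block_diff_def block_add_def fun_eq_iff algebra_simps)
  finally have IAV: "block_mult (block_diff block_one AA) (block_add block_one VV) = block_add block_one BB" .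
  note inv = block_neumann_inverse[OF mA, folded AA_def C_def, folded CC_def]
  have IV: "block_add block_one VV = block_mult (block_add block_one CC) (block_add block_one BB)"
  proof -
    have "block_mult (block_mult (block_add block_one CC) (block_diff block_one AA)) (block_add block_one VV)
       = block_mult (block_add block_one CC) (block_mult (block_diff block_one AA) (block_add block_one VV))"
      by (rule block_mult_assoc(1)[OF _ block_hs_uminus[OF hA] block_diff_eq_add]) (intro l2)+
    then show ?thesis
      using inv(1) by (simp add: IAV is_block_inverse_def block_mult_one_left)
  qed
  have assoc: "block_mult (block_mult TT (block_add block_one CC)) (block_add block_one BB)
      = block_mult TT (block_mult (block_add block_one CC) (block_add block_one BB))"
    by (rule block_mult_assoc(1)[OF _ hC refl]) (intro l2)+
  have conv: "block_mult_conv (block_mult TT (block_add block_one CC)) (block_add block_one BB)"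
    by (intro block_mult_conv_flat block_mult_assoc(2)[OF _ hC refl]) (intro l2)+
  have UU': "UU = block_mult (block_mult TT (block_add block_one CC)) (block_add block_one BB)"
    unfolding assoc UU IV ..

  have limit: "legendre_limit (UU k l) t s (U t s $ k $ l)"
    if t: "t \<in> {0<..<1}" and s: "s \<in> {0<..<1}" and ts: "t \<noteq> s" for k l t s
  proof -
    obtain K where K: "K \<ge> 0" "\<And>t s. t \<in> {0..1} \<Longrightarrow> s \<in> {0..1} \<Longrightarrow> cmod (entry U k l t s) \<le> K"
      using volterra_bound[OF mvolterraD[OF mU]] by blast
    have "legendre_limit (coeff_mat (entry U k l)) t s (entry U k l t s)"
    proof (rule legendre_limit_theta_star[OF _ _ _ _ mvolterraD[OF mV] entryU])
      fix x :: real assume x: "0 \<le> x" "x \<le> 1"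
      show "cmod (entry U k l t x - entry U k l t s) \<le> (L + 2 * K / \<bar>t - s\<bar>) * \<bar>x - s\<bar>"
      proof (rule lipschitz_off_jump)
        fix x assume x: "0 \<le> x" "x \<le> t" "s \<le> t"
        have "cmod ((Ut t x - Ut t s) $ k $ l) \<le> norm (Ut t x - Ut t s)" by (rule norm_entry_le)
        also have "\<dots> \<le> L * \<bar>x - s\<bar>"
          using lipschitz_onD[OF lipU, of "(t, x)" "(t, s)"] x t s by (simp add: dist_norm dist_Pair_Pair)
        finally show "cmod (entry U k l t x - entry U k l t s) \<le> L * \<bar>x - s\<bar>"
          using x unfolding U_def entry_heaviside by (simp add: heaviside_def)
      qed (use volterra_zero[OF mvolterraD[OF mU]] K L0 t s ts x in auto)
    qed (use t s in auto)
    then show ?thesis by (simp add: UU_def block_coeff_mat_def entry_def)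
  qed

  have conv1: "block_mult_conv TT (block_add block_one CC)"
    by (intro block_mult_conv_l2 l2)
  show ?thesis
    unfolding inv(2)
    by (intro conjI ballI allI impI neumann_series(1)[OF mA] inv(1) refl conv1 conv UU' limit)
qed

end
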